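(* Let $2n\ge4$ and let $\omega$ be a $T^{2n}$-invariant symplectic form on $T^{2n}$. The moduli space of formal curves of Ricci-type symplectic connections on $(T^{2n},\omega)$ starting with the standard flat connection $\nabla^0$, under the action of formal curves of symplectomorphisms, is described by the space $\mathcal{A}$ of formal curves of linear maps $A^t:\mathbb{R}^{2n}\to\mathfrak{sp}(2n,\mathbb{R})[[t]]$, $A^t=\sum_{k\ge1}t^kA^{(k)}$, satisfying $A^t(X)A^t(Y)=0$ and $A^t(X)Y=A^t(Y)X$ for all $X,Y\in\mathbb{R}^{2n}$, modulo the action of $Sp(2n,\mathbb{Z})$. That is: for $A^t\in\mathcal{A}$, $\nabla^0+A^t$ is a formal curve of Ricci-type symplectic connections on $(T^{2n},\omega)$, and $A^t\mapsto[\nabla^0+A^t]$ induces a bijection from $\mathcal{A}/Sp(2n,\mathbb{Z})$ onto the set of equivalence classes of formal curves of Ricci-type symplectic connections on $(T^{2n},\omega)$ starting at $\nabla^0$, two such curves $\nabla^t,\nabla'^t$ being equivalent if $\nabla'^t=\psi_t\cdot\nabla^t$ for some formal curve of symplectomorphisms $\psi_t$ of $(T^{2n},\omega)$.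
   Context: $T^{2n}=\mathbb{R}^{2n}/\mathbb{Z}^{2n}$ with angle coordinates $x^a$ and invariant vector fields $\partial_a$; the standard flat connection $\nabla^0$ is defined by $\nabla^0_{\partial_a}\partial_b=0$. The $T^{2n}$-invariant form $\omega$ (constant components) corresponds to a linear symplectic form $\Omega$ on $\mathbb{R}^{2n}$. $\mathfrak{sp}(2n,\mathbb{R})$ is the Lie algebra of endomorphisms of $\mathbb{R}^{2n}$ that are infinitesimally symplectic for $\Omega$, and $Sp(2n,\mathbb{Z})$ is the group of linear symplectic automorphisms $C$ of $(\mathbb{R}^{2n},\Omega)$ with $C(\mathbb{Z}^{2n})=\mathbb{Z}^{2n}$, acting by $(C\cdot A^t)(X)Y=C\,A^t(C^{-1}X)\,C^{-1}Y$. A linear map $A^t$ as in the claim is regarded as a series of $T^{2n}$-invariant $(2,1)$-tensors on $T^{2n}$. A symplectic connection on $(M,\omega)$ is a torsion-free linear connection $\nabla$ with $\nabla\omega=0$. Formal curve of symplectic connections: a formal power series $\nabla^t=\nabla+\sum_{k\ge1}t^kA^{(k)}$, where $\nabla$ is a symplectic connection (the curve starts at $\nabla$) and the $A^{(k)}$ are $(2,1)$-tensors with $\omega(A^{(k)}(X)Y,Z)$ totally symmetric. Its formal curvature is $R^t(X,Y)=\nabla^t_X\nabla^t_Y-\nabla^t_Y\nabla^t_X-\nabla^t_{[X,Y]}$; put $R^t(X,Y;Z,T)=\omega(R^t(X,Y)Z,T)$, $r^t(X,Y)=\operatorname{Trace}[Z\mapsto R^t(X,Z)Y]$. The curve is of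 Ricci type if $$R^t(X,Y;Z,T)=\tfrac{-1}{2(n+1)}\big[2\omega(X,Y)r^t(Z,T)+\omega(X,Z)r^t(Y,T)+\omega(X,T)r^t(Y,Z)-\omega(Y,Z)r^t(X,T)-\omega(Y,T)r^t(X,Z)\big].$$ Formal curve of symplectomorphisms of $(M,\omega)$: a homomorphism of Poisson algebras $\psi_t=\psi^{(0)}+\sum_{k\ge1}t^k\psi^{(k)}:C^\infty(M)\to C^\infty(M)[[t]]$ with $\psi^{(0)}:C^\infty(M)\to C^\infty(M)$ an isomorphism; it is extended $\mathbb{R}[[t]]$-linearly to $C^\infty(M)[[t]]$. It acts on formal curves of vector fields (viewed as derivations of $C^\infty(M)[[t]]$) by $(\psi_t\cdot X_t)f=\psi_t(X_t(\psi_t^{-1}f))$ and on formal curves of symplectic connections by $(\psi_t\cdot\nabla^t)_XY=\psi_t\cdot\big(\nabla^t_{\psi_t^{-1}\cdot X}\,\psi_t^{-1}\cdot Y\big)$. *)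

theory Defs
  imports "HOL-Analysis.Analysis" "HOL-Computational_Algebra.Formal_Power_Series"
begin

section \<open>The torus and its algebra of smooth functions\<close>

definition int_lattice :: "(real^'n) set" where
  "int_lattice = {x. \<forall>i. x $ i \<in> \<int>}"

definition torus_rel :: "real^'n \<Rightarrow> real^'n \<Rightarrow> bool" where
  "torus_rel x y \<longleftrightarrow> x - y \<in> int_lattice"

lemma equivp_torus_rel: "equivp (torus_rel :: real^'n \<Rightarrow> real^'n \<Rightarrow> bool)"
proof (rule equivpI)
  show "reflp (torus_rel :: real^'n \<Rightarrow> real^'n \<Rightarrow> bool)"
    by (auto simp: reflp_def torus_rel_def int_lattice_def)
  show "symp (torus_rel :: real^'n \<Rightarrow> real^'n \<Rightarrow> bool)"
    unfolding symp_def torus_rel_def int_lattice_def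
  proof (intro allI impI CollectI)
    fix x y :: "real^'n" and i
    assume "x - y \<in> {x. \<forall>i. x $ i \<in> \<int>}"
    then have "- ((x - y) $ i) \<in> \<int>" by (intro Ints_minus) auto
    then show "(y - x) $ i \<in> \<int>" by simp
  qed
  show "transp (torus_rel :: real^'n \<Rightarrow> real^'n \<Rightarrow> bool)"
    unfolding transp_def torus_rel_def int_lattice_def
  proof (intro allI impI CollectI)
    fix x y z :: "real^'n" and i
    assume "x - y \<in> {x. \<forall>i. x $ i \<in> \<int>}" "y - z \<in> {x. \<forall>i. x $ i \<in> \<int>}"
    then have "(x - y) $ i + (y - z) $ i \<in> \<int>" by (intro Ints_add) auto
    then show "(x - z) $ i \<in> \<int>" by simp
  qed
qed

quotient_type (overloaded) 'n torus = "real^'n" / torus_rel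
  by (rule equivp_torus_rel)

abbreviation proj :: "real^'n \<Rightarrow> 'n torus" where
  "proj \<equiv> abs_torus"

fun Ck :: "nat \<Rightarrow> ('a::real_normed_vector \<Rightarrow> real) \<Rightarrow> bool" where
  "Ck 0 f \<longleftrightarrow> continuous_on UNIV f"
| "Ck (Suc k) f \<longleftrightarrow> (\<forall>x. f differentiable (at x)) \<and>
     (\<forall>v. Ck k (\<lambda>x. frechet_derivative f (at x) v))"

definition smooth :: "('a::real_normed_vector \<Rightarrow> real) \<Rightarrow> bool" where
  "smooth f \<longleftrightarrow> (\<forall>k. Ck k f)"

lemma Ck_const: "Ck k (\<lambda>x::'a::real_normed_vector. c)"
  by (induction k arbitrary: c) auto

lemma Ck_SucD: "Ck (Suc k) f \<Longrightarrow> Ck k f"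
proof (induction k arbitrary: f)
  case 0
  then show ?case
    by (auto simp: continuous_on_eq_continuous_at intro: differentiable_imp_continuous_within)
next
  case (Suc k)
  have "f differentiable (at x)" for x using Suc.prems by simp
  moreover have "Ck k (\<lambda>x. frechet_derivative f (at x) v)" for v
    using Suc.prems by (intro Suc.IH) simp
  ultimately show ?case by simp
qed

lemma Ck_add: "Ck k f \<Longrightarrow> Ck k g \<Longrightarrow> Ck k (\<lambda>x. f x + g x)"
proof (induction k arbitrary: f g)
  case 0
  then show ?case by (auto intro: continuous_on_add)
next
  case (Suc k)
  have "frechet_derivative (\<lambda>x. f x + g x) (at x) =
      (\<lambda>v. frechet_derivative f (at x) v + frechet_derivative g (at x) v)" for x
    using Suc.prems
    by (intro frechet_derivative_at[symmetric] has_derivative_add)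
      (auto simp: frechet_derivative_works)
  then show ?case using Suc by (auto intro: differentiable_add)
qed

lemma Ck_mult: "Ck k f \<Longrightarrow> Ck k g \<Longrightarrow> Ck k (\<lambda>x. f x * g x)"
proof (induction k arbitrary: f g)
  case 0
  then show ?case by (auto intro: continuous_on_mult)
next
  case (Suc k)
  have *: "frechet_derivative (\<lambda>x. f x * g x) (at x) =
      (\<lambda>v. f x * frechet_derivative g (at x) v + frechet_derivative f (at x) v * g x)" for x
    using Suc.prems
    by (intro frechet_derivative_at[symmetric] has_derivative_mult)
      (auto simp: frechet_derivative_works)
  have "Ck k f" "Ck k g" using Suc.prems Ck_SucD by blast+
  then show ?case using Suc by (auto simp: * intro!: differentiable_mult Ck_add)
qed

lemma Ck_uminus: "Ck k f \<Longrightarrow> Ck k (\<lambda>x. - f x)"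
  using Ck_mult[OF Ck_const[of k "-1"], of f] by simp

text \<open>A function on the quotient \<open>\<real>\<^sup>n / \<int>\<^sup>n\<close> is smooth iff its lift to the universal cover is.\<close>

typedef (overloaded) 'n smfun = "{f :: ('n::finite) torus \<Rightarrow> real. smooth (f \<circ> proj)}"
  by (rule exI[of _ "\<lambda>_. 0"]) (auto simp: smooth_def comp_def Ck_const)

setup_lifting type_definition_smfun

instantiation smfun :: (finite) "{comm_ring_1, real_algebra_1}"
begin

lift_definition zero_smfun :: "'a smfun" is "\<lambda>_. 0"
  by (simp add: smooth_def comp_def Ck_const)
lift_definition one_smfun :: "'a smfun" is "\<lambda>_. 1"
  by (simp add: smooth_def comp_def Ck_const)
lift_definition plus_smfun :: "'a smfun \<Rightarrow> 'a smfun \<Rightarrow> 'a smfun" is "\<lambda>f g p. f p + g p"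
  by (simp add: smooth_def comp_def Ck_add)
lift_definition times_smfun :: "'a smfun \<Rightarrow> 'a smfun \<Rightarrow> 'a smfun" is "\<lambda>f g p. f p * g p"
  by (simp add: smooth_def comp_def Ck_mult)
lift_definition scaleR_smfun :: "real \<Rightarrow> 'a smfun \<Rightarrow> 'a smfun" is "\<lambda>c f p. c * f p"
  by (simp add: smooth_def comp_def Ck_mult Ck_const)
lift_definition uminus_smfun :: "'a smfun \<Rightarrow> 'a smfun" is "\<lambda>f p. - f p"
  by (simp add: smooth_def comp_def Ck_uminus)
definition minus_smfun :: "'a smfun \<Rightarrow> 'a smfun \<Rightarrow> 'a smfun" where
  "minus_smfun f g = f + - g"

instance
proof
  fix a b c :: "'a smfun" and r q :: real
  show "a * b * c = a * (b * c)" by transfer (simp add: mult.assoc)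
  show "a * b = b * a" by transfer (simp add: mult.commute)
  show "1 * a = a" by transfer simp
  show "a * 1 = a" by transfer simp
  show "a * (b + c) = a * b + a * c" by transfer (simp add: distrib_left)
  show "a + b + c = a + (b + c)" by transfer (simp add: add.assoc)
  show "a + b = b + a" by transfer (simp add: add.commute)
  show "0 + a = a" by transfer simp
  show "- a + a = 0" by transfer simp
  show "a - b = a + - b" by (rule minus_smfun_def)
  show "(a + b) * c = a * c + b * c" by transfer (simp add: distrib_right)
  show "(0::'a smfun) \<noteq> 1" by transfer (simp add: fun_eq_iff)
  show "r *\<^sub>R (a + b) = r *\<^sub>R a + r *\<^sub>R b" by transfer (simp add: distrib_left)
  show "(r + q) *\<^sub>R a = r *\<^sub>R a + q *\<^sub>R a" by transfer (simp add: distrib_right)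
  show "r *\<^sub>R q *\<^sub>R a = (r * q) *\<^sub>R a" by transfer (simp add: mult.assoc)
  show "1 *\<^sub>R a = a" by transfer simp
  show "r *\<^sub>R a * b = r *\<^sub>R (a * b)" by transfer (simp add: mult.assoc)
  show "a * r *\<^sub>R b = r *\<^sub>R (a * b)" by transfer (simp add: mult.left_commute)
qed

end

lemma smooth_frechet_derivative: "smooth f \<Longrightarrow> smooth (\<lambda>x. frechet_derivative f (at x) v)"
  unfolding smooth_def by (metis Ck.simps(2))

lemma proj_shift: "proj (x + (rep_torus (proj y) - y)) = proj x"
proof -
  have "proj (rep_torus (proj y)) = proj y"
    by (rule Quotient3_abs_rep[OF Quotient3_torus])
  then have "torus_rel (rep_torus (proj y)) y"
    by (simp only: torus.abs_eq_iff)
  then have "torus_rel (x + (rep_torus (proj y) - y)) x" by (simp add: torus_rel_def)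
  then show ?thesis by (simp only: torus.abs_eq_iff)
qed

lemma frechet_derivative_proj:
  assumes "smooth (f \<circ> proj)"
  shows "frechet_derivative (f \<circ> proj) (at (rep_torus (proj x))) =
    frechet_derivative (f \<circ> proj) (at x)"
proof -
  define d where "d = rep_torus (proj x) - x"
  have per: "(f \<circ> proj) \<circ> (\<lambda>y. y + d) = f \<circ> proj"
    by (simp add: comp_def d_def proj_shift)
  have diff: "(f \<circ> proj) differentiable (at y)" for y
    using assms unfolding smooth_def by (metis Ck.simps(2))
  have "((f \<circ> proj) \<circ> (\<lambda>y. y + d) has_derivative
      frechet_derivative (f \<circ> proj) (at (x + d)) \<circ> (\<lambda>y. y)) (at x)"
    using diff by (intro diff_chain_at) (auto simp: frechet_derivative_works intro!: derivative_eq_intros)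
  then show ?thesis
    unfolding per by (simp add: frechet_derivative_at d_def comp_def)
qed

text \<open>The invariant vector field \<open>\<partial>\<^sub>a\<close>: differentiate the lift in the coordinate direction \<open>a\<close>.
  The choice of representative \<open>rep_torus p\<close> is immaterial by \<open>frechet_derivative_proj\<close>.\<close>

lift_definition partial :: "'n \<Rightarrow> ('n::finite) smfun \<Rightarrow> 'n smfun" is
  "\<lambda>a f p. frechet_derivative (f \<circ> proj) (at (rep_torus p)) (axis a 1)"
proof -
  fix a :: 'n and f :: "'n torus \<Rightarrow> real"
  assume f: "smooth (f \<circ> proj)"
  have "(\<lambda>p. frechet_derivative (f \<circ> proj) (at (rep_torus p)) (axis a 1)) \<circ> proj =
      (\<lambda>x. frechet_derivative (f \<circ> proj) (at x) (axis a 1))"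
    by (simp add: comp_def frechet_derivative_proj[OF f, unfolded comp_def])
  then show "smooth ((\<lambda>p. frechet_derivative (f \<circ> proj) (at (rep_torus p)) (axis a 1)) \<circ> proj)"
    using smooth_frechet_derivative[OF f] by simp
qed


section \<open>Vector fields, symplectic forms and connections on the torus\<close>

text \<open>Since \<open>(\<partial>\<^sub>a)\<close> is a global frame of the tangent bundle, a vector field
  \<open>X = \<Sum>\<^sub>a X\<^sup>a \<partial>\<^sub>a\<close> is given by its components \<open>X $ a\<close>, and a 2-form by
  \<open>w $ a $ b = w(\<partial>\<^sub>a, \<partial>\<^sub>b)\<close>.\<close>

type_synonym 'n vfield = "('n smfun)^'n"
type_synonym 'n form2 = "('n smfun)^'n^'n"

definition bil :: "('r::comm_ring_1)^'n^'n \<Rightarrow> 'r^'n \<Rightarrow> 'r^'n \<Rightarrow> 'r" where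
  "bil w X Y = (\<Sum>a\<in>UNIV. \<Sum>b\<in>UNIV. w $ a $ b * X $ a * Y $ b)"

definition vf_app :: "('n::finite) vfield \<Rightarrow> 'n smfun \<Rightarrow> 'n smfun" where
  "vf_app X f = (\<Sum>a\<in>UNIV. X $ a * partial a f)"

definition vf_bracket :: "('n::finite) vfield \<Rightarrow> 'n vfield \<Rightarrow> 'n vfield" where
  "vf_bracket X Y = (\<chi> a. vf_app X (Y $ a) - vf_app Y (X $ a))"

definition form_at :: "('n::finite) form2 \<Rightarrow> 'n torus \<Rightarrow> real^'n \<Rightarrow> real^'n \<Rightarrow> real" where
  "form_at w p = bil (\<chi> a b. Rep_smfun (w $ a $ b) p)"

definition symplectic_form :: "('n::finite) form2 \<Rightarrow> bool" where
  "symplectic_form w \<longleftrightarrow>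
     (\<forall>a b. w $ a $ b = - (w $ b $ a)) \<and>
     (\<forall>a b c. partial a (w $ b $ c) + partial b (w $ c $ a) + partial c (w $ a $ b) = 0) \<and>
     (\<forall>p v. (\<forall>u. form_at w p v u = 0) \<longrightarrow> v = 0)"

text \<open>The torus acts on itself by translations, which preserve the frame \<open>(\<partial>\<^sub>a)\<close>.\<close>

definition torus_invariant :: "('n::finite) form2 \<Rightarrow> bool" where
  "torus_invariant w \<longleftrightarrow> (\<forall>v x. form_at w (proj (x + v)) = form_at w (proj x))"

definition linear_form :: "('n::finite) form2 \<Rightarrow> real^'n \<Rightarrow> real^'n \<Rightarrow> real" where
  "linear_form w = form_at w (proj 0)"

definition linear_connection :: "(('n::finite) vfield \<Rightarrow> 'n vfield \<Rightarrow> 'n vfield) \<Rightarrow> bool" where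
  "linear_connection D \<longleftrightarrow>
     (\<forall>X X' Y. D (X + X') Y = D X Y + D X' Y) \<and>
     (\<forall>f X Y. D (f *s X) Y = f *s D X Y) \<and>
     (\<forall>X Y Y'. D X (Y + Y') = D X Y + D X Y') \<and>
     (\<forall>f X Y. D X (f *s Y) = vf_app X f *s Y + f *s D X Y)"

definition symplectic_connection ::
    "('n::finite) form2 \<Rightarrow> ('n vfield \<Rightarrow> 'n vfield \<Rightarrow> 'n vfield) \<Rightarrow> bool" where
  "symplectic_connection w D \<longleftrightarrow> linear_connection D \<and>
     (\<forall>X Y. D X Y - D Y X = vf_bracket X Y) \<and>
     (\<forall>X Y Z. vf_app X (bil w Y Z) = bil w (D X Y) Z + bil w Y (D X Z))"

definition tensor21 :: "(('n::finite) vfield \<Rightarrow> 'n vfield \<Rightarrow> 'n vfield) \<Rightarrow> bool" where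
  "tensor21 A \<longleftrightarrow>
     (\<forall>X X' Y. A (X + X') Y = A X Y + A X' Y) \<and>
     (\<forall>f X Y. A (f *s X) Y = f *s A X Y) \<and>
     (\<forall>X Y Y'. A X (Y + Y') = A X Y + A X Y') \<and>
     (\<forall>f X Y. A X (f *s Y) = f *s A X Y)"

definition totally_symmetric ::
    "('n::finite) form2 \<Rightarrow> ('n vfield \<Rightarrow> 'n vfield \<Rightarrow> 'n vfield) \<Rightarrow> bool" where
  "totally_symmetric w A \<longleftrightarrow>
     (\<forall>X Y Z. bil w (A X Y) Z = bil w (A Y X) Z \<and> bil w (A X Y) Z = bil w (A X Z) Y)"

text \<open>\<open>\<nabla>\<^sup>0\<close>, the connection for which every \<open>\<partial>\<^sub>b\<close> is parallel.\<close>

definition flat_connection :: "('n::finite) vfield \<Rightarrow> 'n vfield \<Rightarrow> 'n vfield" where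
  "flat_connection X Y = (\<chi> b. vf_app X (Y $ b))"


section \<open>Formal curves\<close>

type_synonym 'n ffun = "('n smfun) fps"
type_synonym 'n fvfield = "('n ffun)^'n"
type_synonym 'n fcurve = "('n vfield \<Rightarrow> 'n vfield \<Rightarrow> 'n vfield) fps"

definition vf_coeff :: "'n fvfield \<Rightarrow> nat \<Rightarrow> ('n::finite) vfield" where
  "vf_coeff X k = (\<chi> a. fps_nth (X $ a) k)"

definition fpartial :: "'n \<Rightarrow> ('n::finite) ffun \<Rightarrow> 'n ffun" where
  "fpartial a F = Abs_fps (\<lambda>k. partial a (fps_nth F k))"

definition fvf_app :: "('n::finite) fvfield \<Rightarrow> 'n ffun \<Rightarrow> 'n ffun" where
  "fvf_app X F = (\<Sum>a\<in>UNIV. X $ a * fpartial a F)"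

definition fvf_bracket :: "('n::finite) fvfield \<Rightarrow> 'n fvfield \<Rightarrow> 'n fvfield" where
  "fvf_bracket X Y = (\<chi> a. fvf_app X (Y $ a) - fvf_app Y (X $ a))"

definition fform :: "('n::finite) form2 \<Rightarrow> 'n fvfield \<Rightarrow> 'n fvfield \<Rightarrow> 'n ffun" where
  "fform w = bil (\<chi> a b. fps_const (w $ a $ b))"

definition symplectic_curve :: "('n::finite) form2 \<Rightarrow> 'n fcurve \<Rightarrow> bool" where
  "symplectic_curve w D \<longleftrightarrow> symplectic_connection w (fps_nth D 0) \<and>
     (\<forall>k\<ge>1. tensor21 (fps_nth D k) \<and> totally_symmetric w (fps_nth D k))"

text \<open>The \<open>\<real>[[t]]\<close>-bilinear extension of \<open>\<nabla>\<^sup>t = \<Sum>\<^sub>l t\<^sup>l D\<^sub>l\<close> to formal curves of vector fields.\<close>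

definition curve_ext :: "('n::finite) fcurve \<Rightarrow> 'n fvfield \<Rightarrow> 'n fvfield \<Rightarrow> 'n fvfield" where
  "curve_ext D X Y = (\<chi> c. Abs_fps (\<lambda>m. \<Sum>l\<le>m. \<Sum>i\<le>m - l.
     fps_nth D l (vf_coeff X i) (vf_coeff Y (m - l - i)) $ c))"

definition curvature ::
    "('n::finite) fcurve \<Rightarrow> 'n fvfield \<Rightarrow> 'n fvfield \<Rightarrow> 'n fvfield \<Rightarrow> 'n fvfield" where
  "curvature D X Y Z = curve_ext D X (curve_ext D Y Z) - curve_ext D Y (curve_ext D X Z)
     - curve_ext D (fvf_bracket X Y) Z"

definition curvature4 :: "('n::finite) form2 \<Rightarrow> 'n fcurve \<Rightarrow>
    'n fvfield \<Rightarrow> 'n fvfield \<Rightarrow> 'n fvfield \<Rightarrow> 'n fvfield \<Rightarrow> 'n ffun" where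
  "curvature4 w D X Y Z T = fform w (curvature D X Y Z) T"

text \<open>The trace of \<open>Z \<mapsto> R(X, Z) Y\<close>, computed in the frame \<open>(\<partial>\<^sub>a)\<close>; \<open>axis a 1\<close> is \<open>\<partial>\<^sub>a\<close>.\<close>

definition ricci :: "('n::finite) fcurve \<Rightarrow> 'n fvfield \<Rightarrow> 'n fvfield \<Rightarrow> 'n ffun" where
  "ricci D X Y = (\<Sum>a\<in>UNIV. curvature D X (axis a 1) Y $ a)"

text \<open>The dimension of the torus is \<open>CARD('n) = 2n\<close>, so that \<open>2 (n + 1) = CARD('n) + 2\<close>.\<close>

definition ricci_type :: "('n::finite) form2 \<Rightarrow> 'n fcurve \<Rightarrow> bool" where
  "ricci_type w D \<longleftrightarrow> (\<forall>X Y Z T. curvature4 w D X Y Z T =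
     fps_const (of_real (- 1 / (real CARD('n) + 2))) *
       (2 * fform w X Y * ricci D Z T
        + fform w X Z * ricci D Y T + fform w X T * ricci D Y Z
        - fform w Y Z * ricci D X T - fform w Y T * ricci D X Z))"

definition ricci_curves :: "('n::finite) form2 \<Rightarrow> 'n fcurve set" where
  "ricci_curves w = {D. symplectic_curve w D \<and> ricci_type w D \<and> fps_nth D 0 = flat_connection}"


section \<open>Formal curves of symplectomorphisms\<close>

text \<open>Sign convention: \<open>w(X\<^sub>f, Y) = df(Y)\<close> and \<open>{f, g} = X\<^sub>f g\<close>. The opposite sign
  conventions lead to the same Poisson homomorphisms.\<close>

definition hamiltonian_vf :: "('n::finite) form2 \<Rightarrow> 'n smfun \<Rightarrow> 'n vfield" where
  "hamiltonian_vf w f = (THE X. \<forall>Y. bil w X Y = vf_app Y f)"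

definition poisson :: "('n::finite) form2 \<Rightarrow> 'n smfun \<Rightarrow> 'n smfun \<Rightarrow> 'n smfun" where
  "poisson w f g = vf_app (hamiltonian_vf w f) g"

definition fpoisson :: "('n::finite) form2 \<Rightarrow> 'n ffun \<Rightarrow> 'n ffun \<Rightarrow> 'n ffun" where
  "fpoisson w F G = Abs_fps (\<lambda>m. \<Sum>i\<le>m. poisson w (fps_nth F i) (fps_nth G (m - i)))"

text \<open>\<open>\<real>\<close>-linearity of \<open>\<psi>\<close> amounts to linearity of every \<open>\<psi>\<^sup>(\<^sup>k\<^sup>)\<close>.\<close>

definition symplecto_curve :: "('n::finite) form2 \<Rightarrow> ('n smfun \<Rightarrow> 'n ffun) \<Rightarrow> bool" where
  "symplecto_curve w \<psi> \<longleftrightarrow>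
     (\<forall>k. linear (\<lambda>f. fps_nth (\<psi> f) k)) \<and>
     \<psi> 1 = 1 \<and>
     (\<forall>f g. \<psi> (f * g) = \<psi> f * \<psi> g) \<and>
     (\<forall>f g. \<psi> (poisson w f g) = fpoisson w (\<psi> f) (\<psi> g)) \<and>
     bij (\<lambda>f. fps_nth (\<psi> f) 0)"

definition symplecto_ext :: "(('n::finite) smfun \<Rightarrow> 'n ffun) \<Rightarrow> 'n ffun \<Rightarrow> 'n ffun" where
  "symplecto_ext \<psi> F = Abs_fps (\<lambda>m. \<Sum>i\<le>m. fps_nth (\<psi> (fps_nth F i)) (m - i))"

text \<open>The formal vector field corresponding to the derivation \<open>\<Psi> \<circ> X \<circ> \<Psi>\<^sup>-\<^sup>1\<close>, for an
  automorphism \<open>\<Psi>\<close> of the algebra of formal functions.\<close>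

definition fvf_act ::
    "(('n::finite) ffun \<Rightarrow> 'n ffun) \<Rightarrow> 'n fvfield \<Rightarrow> 'n fvfield" where
  "fvf_act \<Psi> X = (THE Y. \<forall>F. fvf_app Y F = \<Psi> (fvf_app X (inv \<Psi> F)))"

definition conn_act :: "(('n::finite) ffun \<Rightarrow> 'n ffun) \<Rightarrow>
    ('n fvfield \<Rightarrow> 'n fvfield \<Rightarrow> 'n fvfield) \<Rightarrow> 'n fvfield \<Rightarrow> 'n fvfield \<Rightarrow> 'n fvfield" where
  "conn_act \<Psi> D X Y = fvf_act \<Psi> (D (fvf_act (inv \<Psi>) X) (fvf_act (inv \<Psi>) Y))"

definition curve_equiv :: "('n::finite) form2 \<Rightarrow> ('n fcurve \<times> 'n fcurve) set" where
  "curve_equiv w = {(D, D'). D \<in> ricci_curves w \<and> D' \<in> ricci_curves w \<and>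
     (\<exists>\<psi>. symplecto_curve w \<psi> \<and>
       curve_ext D' = conn_act (symplecto_ext \<psi>) (curve_ext D))}"


section \<open>Formal curves of linear maps\<close>

definition sp :: "('n::finite) form2 \<Rightarrow> (real^'n^'n) set" where
  "sp w = {M. \<forall>x y. linear_form w (M *v x) y + linear_form w x (M *v y) = 0}"

text \<open>The product in \<open>End(\<real>\<^sup>n)[[t]]\<close> is written out as a Cauchy product, because
  \<open>*\<close> on \<open>real^'n^'n\<close> is the entrywise product.\<close>

definition linear_curves :: "('n::finite) form2 \<Rightarrow> (real^'n \<Rightarrow> (real^'n^'n) fps) set" where
  "linear_curves w = {A.
     (\<forall>k. linear (\<lambda>x. fps_nth (A x) k)) \<and>
     (\<forall>x k. fps_nth (A x) k \<in> sp w) \<and>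
     (\<forall>x. fps_nth (A x) 0 = 0) \<and>
     (\<forall>x y m. (\<Sum>i\<le>m. fps_nth (A x) i ** fps_nth (A y) (m - i)) = 0) \<and>
     (\<forall>x y k. fps_nth (A x) k *v y = fps_nth (A y) k *v x)}"

text \<open>Preserving the nondegenerate form already makes \<open>C\<close> invertible.\<close>

definition Sp_Z :: "('n::finite) form2 \<Rightarrow> (real^'n^'n) set" where
  "Sp_Z w = {C. (\<forall>x y. linear_form w (C *v x) (C *v y) = linear_form w x y) \<and>
     (\<lambda>x. C *v x) ` int_lattice = int_lattice}"

definition Sp_act ::
    "real^'n^'n \<Rightarrow> (real^'n \<Rightarrow> (real^'n^'n) fps) \<Rightarrow> real^'n \<Rightarrow> (real^'n^'n) fps" where
  "Sp_act C A x = Abs_fps (\<lambda>k. C ** fps_nth (A (matrix_inv C *v x)) k ** matrix_inv C)"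

definition Sp_equiv :: "('n::finite) form2 \<Rightarrow>
    ((real^'n \<Rightarrow> (real^'n^'n) fps) \<times> (real^'n \<Rightarrow> (real^'n^'n) fps)) set" where
  "Sp_equiv w = {(A, A'). A \<in> linear_curves w \<and> A' \<in> linear_curves w \<and>
     (\<exists>C\<in>Sp_Z w. A' = Sp_act C A)}"

definition invariant_tensor ::
    "(real^'n \<Rightarrow> real^'n^'n) \<Rightarrow> ('n::finite) vfield \<Rightarrow> 'n vfield \<Rightarrow> 'n vfield" where
  "invariant_tensor B X Y = (\<chi> c. \<Sum>a\<in>UNIV. \<Sum>b\<in>UNIV.
     of_real ((B (axis a 1) *v axis b 1) $ c) * X $ a * Y $ b)"

definition flat_plus :: "(real^'n \<Rightarrow> (real^'n^'n) fps) \<Rightarrow> ('n::finite) fcurve" where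
  "flat_plus A = Abs_fps (\<lambda>k X Y. (if k = 0 then flat_connection X Y else 0)
     + invariant_tensor (\<lambda>x. fps_nth (A x) k) X Y)"

end

theory Submission
  imports Defs
begin

text \<open>Vector fields and connections are studied over the ring of formal functions, on which the
  coordinate derivations act.

  Surjectivity: suppose that the coefficients of a Ricci-type curve of order below \<open>m\<close> are
  invariant. The terms of order \<open>m\<close> in the curvature are then an exact two-form plus a constant, so
  they are closed, and on the torus a closed curvature of Ricci type is constant. Hence the coefficient
  of order \<open>m\<close> is an invariant tensor plus the third derivatives of a function \<open>h\<close>, which are
  removed by the exponential of the Hamiltonian field of \<open>- t\<^sup>m h\<close>. The composites of these gauge
  transformations converge \<open>t\<close>-adically, and in the limit the connection is \<open>\<nabla>\<^sup>0 + A\<close> with \<open>A\<close>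
  invariant. For such a connection the Ricci tensor vanishes by pure algebra as soon as the dimension
  exceeds two, and the vanishing of the curvature amounts to \<open>A(X) A(Y) = 0\<close>.

  Injectivity: if a formal symplectomorphism relates two such connections, its Jacobian satisfies a
  differential equation that makes it constant order by order, since a function on the torus with
  constant derivative has derivative zero. The functions \<open>exp (2 \<pi> i x\<^sup>a)\<close> then force the Jacobian
  to be an integral matrix without corrections of positive order in \<open>t\<close>.\<close>

section \<open>Smooth functions on the torus\<close>

text \<open>The coordinates \<open>x $ a\<close> are not functions on the torus. Their substitutes
  are the pairs \<open>sinx a\<close>, \<open>cosx a\<close>: components of fields and Jacobians are
  recovered from the identity that the squares add up to one, which is the origin of the factors
  \<open>2 * pi\<close>. Torsion-freeness and compatibility with the form are merged into one
  condition, total symmetry of the Christoffel symbols after lowering the upper index. It makes all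
  tensor computations index computations with the constant matrix \<open>Om\<close> and its inverse
  \<open>P\<close>. Every induction on the order rests on one remark: Christoffel symbols have no
  term of order zero. Quadratic expressions at order \<open>m\<close> therefore involve only orders
  below \<open>m\<close>, and the coefficient of order \<open>m\<close> enters the curvature
  linearly, through its first derivatives. The dimension bound makes \<open>CARD('n) - 2\<close>
  invertible. This is used once in the algebra that kills the Ricci tensor and once in showing that
  a closed curvature of Ricci type is constant.\<close>

definition lift :: "('n::finite) smfun \<Rightarrow> real^'n \<Rightarrow> real" where
  "lift f x = Rep_smfun f (proj x)"

lemma smooth_lift: "smooth (lift f)"
  using Rep_smfun[of f] by (simp add: lift_def[abs_def] comp_def)

lemma lift_ext: "(\<And>x. lift f x = lift g x) \<Longrightarrow> f = g"
proof -
  assume eq: "\<And>x. lift f x = lift g x"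
  have "Rep_smfun f p = Rep_smfun g p" for p
  proof -
    have "proj (rep_torus p) = p" by (rule Quotient3_abs_rep[OF Quotient3_torus])
    with eq[of "rep_torus p"] show ?thesis by (simp only: lift_def)
  qed
  then show ?thesis by (intro Rep_smfun_inject[THEN iffD1] ext)
qed

lemma lift_add [simp]: "lift (f + g) x = lift f x + lift g x"
  by (simp add: lift_def plus_smfun.rep_eq)
lemma lift_mult [simp]: "lift (f * g) x = lift f x * lift g x"
  by (simp add: lift_def times_smfun.rep_eq)
lemma lift_uminus [simp]: "lift (- f) x = - lift f x"
  by (simp add: lift_def uminus_smfun.rep_eq)
lemma lift_diff [simp]: "lift (f - g) x = lift f x - lift g x"
  using lift_add[of f "- g" x] by (simp del: lift_add)
lemma lift_0 [simp]: "lift 0 x = 0"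
  by (simp add: lift_def zero_smfun.rep_eq)
lemma lift_1 [simp]: "lift 1 x = 1"
  by (simp add: lift_def one_smfun.rep_eq)
lemma lift_scaleR [simp]: "lift (c *\<^sub>R f) x = c * lift f x"
  by (simp add: lift_def scaleR_smfun.rep_eq)
lemma lift_of_real [simp]: "lift (of_real c) x = c"
  by (simp add: of_real_def)
lemma lift_numeral [simp]: "lift (numeral k) x = numeral k"
  using lift_of_real[of "numeral k" x] by (simp del: lift_of_real)
lemma lift_sum [simp]: "lift (sum f A) x = (\<Sum>a\<in>A. lift (f a) x)"
  by (induction A rule: infinite_finite_induct) auto

lemma proj_eq_iff: "proj x = proj y \<longleftrightarrow> x - y \<in> int_lattice"
  by (simp only: torus.abs_eq_iff torus_rel_def)

lemma lift_periodic: "z \<in> int_lattice \<Longrightarrow> lift f (x + z) = lift f x"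
proof -
  assume "z \<in> int_lattice"
  then have "proj (x + z) = proj x" by (simp only: proj_eq_iff add_diff_cancel_left')
  then show ?thesis by (simp only: lift_def)
qed

lemma axis_int_lattice: "axis a 1 \<in> int_lattice"
  by (simp add: int_lattice_def axis_def)

lemma ex_lift:
  fixes g :: "real^'n::finite \<Rightarrow> real"
  assumes "smooth g" and "\<And>x z. z \<in> int_lattice \<Longrightarrow> g (x + z) = g x"
  obtains f where "lift f = g"
proof -
  define F where "F p = g (rep_torus p)" for p
  have F: "F (proj x) = g x" for x
  proof -
    have "proj (rep_torus (proj x)) = proj x" by (rule Quotient3_abs_rep[OF Quotient3_torus])
    then have "rep_torus (proj x) - x \<in> int_lattice" by (simp only: proj_eq_iff)
    from assms(2)[OF this, of x] show ?thesis by (simp add: F_def)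
  qed
  have "smooth (F \<circ> proj)" using assms(1) F by (simp add: comp_def)
  then have "lift (Abs_smfun F) = g"
    by (intro ext) (simp add: lift_def Abs_smfun_inverse F)
  then show thesis by (rule that)
qed

lemma smooth_differentiable: "smooth f \<Longrightarrow> f differentiable (at x)"
  unfolding smooth_def by (metis Ck.simps(2))

lemma lift_partial: "lift (partial a f) x = frechet_derivative (lift f) (at x) (axis a 1)"
proof -
  have "lift f = Rep_smfun f \<circ> proj" by (simp add: lift_def fun_eq_iff)
  moreover have "smooth (Rep_smfun f \<circ> proj)" using Rep_smfun[of f] by simp
  ultimately show ?thesis
    using frechet_derivative_proj[of "Rep_smfun f" x]
    by (simp add: lift_def partial.rep_eq)
qed

text \<open>A linear map is determined by its values on the axis vectors. In this form the
  differentiation rules reduce to comparing coefficients of \<open>v $ a\<close>.\<close>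

lemma has_derivative_lift:
  "(lift f has_derivative (\<lambda>v. \<Sum>a\<in>UNIV. v $ a * lift (partial a f) x)) (at x)"
proof -
  have D: "(lift f has_derivative frechet_derivative (lift f) (at x)) (at x)"
    using smooth_differentiable[OF smooth_lift] by (simp add: frechet_derivative_works)
  interpret bounded_linear "frechet_derivative (lift f) (at x)"
    using D by (rule has_derivative_bounded_linear)
  have "frechet_derivative (lift f) (at x) v = (\<Sum>a\<in>UNIV. v $ a * lift (partial a f) x)" for v
  proof -
    have "v = (\<Sum>a\<in>UNIV. v $ a *\<^sub>R axis a 1)"
      by (simp add: vec_eq_iff axis_def if_distrib[where f="\<lambda>x. _ * x"] cong: if_cong)
    then have "frechet_derivative (lift f) (at x) v =
        frechet_derivative (lift f) (at x) (\<Sum>a\<in>UNIV. v $ a *\<^sub>R axis a 1)"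
      by simp
    also have "\<dots> = (\<Sum>a\<in>UNIV. v $ a * lift (partial a f) x)"
      by (simp add: sum scaleR lift_partial)
    finally show ?thesis .
  qed
  then have "frechet_derivative (lift f) (at x) = (\<lambda>v. \<Sum>a\<in>UNIV. v $ a * lift (partial a f) x)"
    by (rule ext)
  with D show ?thesis by simp
qed

lemma partial_eqI:
  assumes "\<And>x. (lift f has_derivative (\<lambda>v. \<Sum>a\<in>UNIV. v $ a * p a x)) (at x)"
  shows "lift (partial a f) x = p a x"
proof -
  have "frechet_derivative (lift f) (at x) = (\<lambda>v. \<Sum>a\<in>UNIV. v $ a * p a x)"
    using frechet_derivative_at[OF assms] by (rule sym)
  then show ?thesis
    by (simp add: lift_partial axis_def if_distrib[where f="\<lambda>x. x * _"] cong: if_cong)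
qed

lemma smooth_sum_mult_lift:
  "smooth (\<lambda>x. \<Sum>a\<in>A. v a * lift (p a) x)"
proof (cases "finite A")
  case True
  then have "Ck k (\<lambda>x. \<Sum>a\<in>A. v a * lift (p a) x)" for k
  proof (induction A)
    case (insert a A)
    have "Ck k (lift (p a))" using smooth_lift[of "p a"] by (simp add: smooth_def)
    then have "Ck k (\<lambda>x. v a * lift (p a) x + (\<Sum>a\<in>A. v a * lift (p a) x))"
      by (intro Ck_add Ck_mult Ck_const insert.IH)
    then show ?case using insert.hyps by simp
  qed (simp add: Ck_const)
  then show ?thesis by (simp add: smooth_def)
qed (simp add: smooth_def Ck_const)

text \<open>The recursion of \<open>Ck\<close> has to be entered only once: after one
  differentiation the function is a combination of lifts, which are already smooth.\<close>

lemma smooth_if_partials_lift: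
  assumes "\<And>x. (g has_derivative (\<lambda>v. \<Sum>a\<in>UNIV. v $ a * lift (p a) x)) (at x)"
  shows "smooth g"
proof -
  have fd: "frechet_derivative g (at x) = (\<lambda>v. \<Sum>a\<in>UNIV. v $ a * lift (p a) x)" for x
    using frechet_derivative_at[OF assms] by (rule sym)
  have "Ck k g" for k
  proof (cases k)
    case 0
    have "isCont g x" for x by (rule has_derivative_continuous[OF assms])
    then show ?thesis by (simp add: 0 continuous_on_eq_continuous_at)
  next
    case (Suc l)
    have "g differentiable (at x)" for x using assms unfolding differentiable_def by blast
    moreover have "Ck l (\<lambda>x. \<Sum>a\<in>UNIV. v $ a * lift (p a) x)" for v
      using smooth_sum_mult_lift[where A=UNIV and v="\<lambda>a. v $ a" and p=p] by (simp add: smooth_def)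
    ultimately show ?thesis by (simp add: Suc fd)
  qed
  then show ?thesis by (simp add: smooth_def)
qed

lemma partial_unique:
  assumes "\<And>x. (lift f has_derivative (\<lambda>v. \<Sum>a\<in>UNIV. v $ a * lift (p a) x)) (at x)"
  shows "partial a f = p a"
  using assms by (intro lift_ext partial_eqI[where p="\<lambda>a. lift (p a)"])

section \<open>Differentiation rules, by uniqueness of the total derivative\<close>

lemma partial_add [simp]: "partial a (f + g) = partial a f + partial a g"
proof (rule partial_unique[where p="\<lambda>a. partial a f + partial a g"])
  fix x
  have "lift (f + g) = (\<lambda>x. lift f x + lift g x)" by auto
  then show "(lift (f + g) has_derivative
      (\<lambda>v. \<Sum>a\<in>UNIV. v $ a * lift (partial a f + partial a g) x)) (at x)"
    using has_derivative_add[OF has_derivative_lift[of f x] has_derivative_lift[of g x]]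
    by (simp add: sum.distrib distrib_left)
qed

lemma partial_mult [simp]: "partial a (f * g) = partial a f * g + f * partial a g"
proof (rule partial_unique[where p="\<lambda>a. partial a f * g + f * partial a g"])
  fix x
  have "lift (f * g) = (\<lambda>x. lift f x * lift g x)" by auto
  then show "(lift (f * g) has_derivative
      (\<lambda>v. \<Sum>a\<in>UNIV. v $ a * lift (partial a f * g + f * partial a g) x)) (at x)"
    using has_derivative_mult[OF has_derivative_lift[of f x] has_derivative_lift[of g x]]
    by (simp add: sum.distrib distrib_left sum_distrib_left sum_distrib_right ac_simps)
qed

lemma partial_of_real [simp]: "partial a (of_real c) = 0"
proof (rule partial_unique[where p="\<lambda>a. 0"])
  fix x
  have "lift (of_real c :: 'a smfun) = (\<lambda>x. c)" by auto
  then show "(lift (of_real c :: 'a smfun) has_derivative (\<lambda>v. \<Sum>a\<in>UNIV. v $ a * lift 0 x)) (at x)"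
    by simp
qed

lemma partial_0 [simp]: "partial a 0 = 0"
  using partial_of_real[of a 0] by simp
lemma partial_1 [simp]: "partial a 1 = 0"
  using partial_of_real[of a 1] by simp
lemma partial_uminus [simp]: "partial a (- f) = - partial a f"
proof -
  have "partial a (f + - f) = 0" by (simp del: partial_add)
  then show ?thesis by (simp only: partial_add) (simp add: eq_neg_iff_add_eq_0 add.commute)
qed
lemma partial_diff [simp]: "partial a (f - g) = partial a f - partial a g"
  using partial_add[of a f "- g"] by (simp del: partial_add)
lemma partial_sum [simp]: "partial a (sum f A) = (\<Sum>x\<in>A. partial a (f x))"
  by (induction A rule: infinite_finite_induct) auto
lemma scaleR_smfun_conv: "c *\<^sub>R (f :: 'n::finite smfun) = of_real c * f"
  by (simp add: scaleR_conv_of_real)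
lemma DERIV_lift:
  "((\<lambda>s. lift f (x + s *\<^sub>R axis a 1)) has_real_derivative lift (partial a f) (x + s *\<^sub>R axis a 1)) (at s)"
proof -
  have "((\<lambda>s. x + s *\<^sub>R axis a 1) has_derivative (\<lambda>h. h *\<^sub>R axis a 1)) (at s)"
    by (auto intro!: derivative_eq_intros)
  from has_derivative_compose[OF this has_derivative_lift]
  show ?thesis
    by (simp add: has_field_derivative_def axis_def mult.commute[of _ "lift _ _"]
        if_distrib[where f="\<lambda>x. _ * x"] if_distrib[where f="\<lambda>x. x * _"] cong: if_cong)
qed

lemma continuous_lift [continuous_intros]:
  assumes "continuous_on S g" shows "continuous_on S (\<lambda>x. lift f (g x))"
proof -
  have "isCont (lift f) x" for x by (rule has_derivative_continuous[OF has_derivative_lift])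
  then have "continuous_on UNIV (lift f)" by (simp add: continuous_on_eq_continuous_at)
  from continuous_on_compose2[OF this assms] show ?thesis by auto
qed

text \<open>Schwarz's theorem: both mixed partials are limits of the same second difference quotient,
  evaluated by applying the mean value theorem in either order.\<close>

lemma second_difference:
  fixes f :: "'n::finite smfun"
  assumes "h > 0"
  obtains s t where "0 < s" "s < h" "0 < t" "t < h"
    "lift f (x + h *\<^sub>R axis a 1 + h *\<^sub>R axis b 1) - lift f (x + h *\<^sub>R axis a 1)
      - lift f (x + h *\<^sub>R axis b 1) + lift f x
      = h * h * lift (partial b (partial a f)) (x + s *\<^sub>R axis a 1 + t *\<^sub>R axis b 1)"
proof -
  define g where "g s = lift f ((x + h *\<^sub>R axis b 1) + s *\<^sub>R axis a 1) - lift f (x + s *\<^sub>R axis a 1)" for s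
  have "(g has_real_derivative (lift (partial a f) ((x + h *\<^sub>R axis b 1) + s *\<^sub>R axis a 1)
      - lift (partial a f) (x + s *\<^sub>R axis a 1))) (at s)" for s
    unfolding g_def by (intro DERIV_diff DERIV_lift)
  from MVT2[OF assms this] obtain s where s: "0 < s" "s < h"
    "g h - g 0 = h * (lift (partial a f) ((x + h *\<^sub>R axis b 1) + s *\<^sub>R axis a 1)
      - lift (partial a f) (x + s *\<^sub>R axis a 1))" by auto
  from MVT2[OF assms DERIV_lift[of "partial a f" "x + s *\<^sub>R axis a 1" b]]
  obtain t where t: "0 < t" "t < h"
    "lift (partial a f) (x + s *\<^sub>R axis a 1 + h *\<^sub>R axis b 1) - lift (partial a f) (x + s *\<^sub>R axis a 1)
      = h * lift (partial b (partial a f)) (x + s *\<^sub>R axis a 1 + t *\<^sub>R axis b 1)" by auto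
  show thesis
    using s(3) t(3)
    by (intro that[OF s(1,2) t(1,2)]) (simp add: g_def algebra_simps)
qed

lemma partial_commute: "partial a (partial b f) = partial b (partial a f)"
proof (rule lift_ext)
  fix x
  have lim: "((\<lambda>n. lift g (x + s n *\<^sub>R axis a 1 + t n *\<^sub>R axis b 1)) \<longlongrightarrow> lift g x) sequentially"
    if "\<And>n. 0 < s n \<and> s n < inverse (real (Suc n))" "\<And>n. 0 < t n \<and> t n < inverse (real (Suc n))"
    for s t a b and g :: "'a smfun"
  proof -
    have "s \<longlonglongrightarrow> 0" "t \<longlonglongrightarrow> 0"
      using that by (auto intro!: tendsto_sandwich[OF _ _ tendsto_const LIMSEQ_inverse_real_of_nat]
          always_eventually less_imp_le)
    then have "(\<lambda>n. x + s n *\<^sub>R axis a 1 + t n *\<^sub>R axis b 1) \<longlonglongrightarrow> x + 0 *\<^sub>R axis a 1 + 0 *\<^sub>R axis b 1"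
      by (intro tendsto_intros)
    moreover have "isCont (lift g) x" by (rule has_derivative_continuous[OF has_derivative_lift])
    ultimately show ?thesis by (auto intro: isCont_tendsto_compose)
  qed
  define h where "h n = inverse (real (Suc n))" for n
  have h: "h n > 0" for n by (simp add: h_def)
  define \<Delta> where "\<Delta> n = lift f (x + h n *\<^sub>R axis a 1 + h n *\<^sub>R axis b 1) - lift f (x + h n *\<^sub>R axis a 1)
      - lift f (x + h n *\<^sub>R axis b 1) + lift f x" for n
  have "\<forall>n. \<exists>s t. (0 < s \<and> s < h n) \<and> (0 < t \<and> t < h n) \<and>
      \<Delta> n = h n * h n * lift (partial b (partial a f)) (x + s *\<^sub>R axis a 1 + t *\<^sub>R axis b 1)"
    unfolding \<Delta>_def using second_difference[OF h] by metis
  then obtain s t where st: "\<And>n. 0 < s n \<and> s n < h n" "\<And>n. 0 < t n \<and> t n < h n"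
    "\<And>n. \<Delta> n = h n * h n * lift (partial b (partial a f)) (x + s n *\<^sub>R axis a 1 + t n *\<^sub>R axis b 1)"
    by metis
  \<comment> \<open>The second difference is symmetric in the two directions, so
    \<open>second_difference\<close> also applies with \<open>a\<close> and \<open>b\<close>
    exchanged.\<close>
  have \<Delta>: "\<Delta> n = lift f (x + h n *\<^sub>R axis b 1 + h n *\<^sub>R axis a 1) - lift f (x + h n *\<^sub>R axis b 1)
      - lift f (x + h n *\<^sub>R axis a 1) + lift f x" for n
    by (simp add: \<Delta>_def add.assoc add.commute[of "h n *\<^sub>R axis a 1"])
  have "\<forall>n. \<exists>s t. (0 < s \<and> s < h n) \<and> (0 < t \<and> t < h n) \<and>
      \<Delta> n = h n * h n * lift (partial a (partial b f)) (x + s *\<^sub>R axis b 1 + t *\<^sub>R axis a 1)"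
    unfolding \<Delta> using second_difference[OF h] by metis
  then obtain s' t' where st': "\<And>n. 0 < s' n \<and> s' n < h n" "\<And>n. 0 < t' n \<and> t' n < h n"
    "\<And>n. \<Delta> n = h n * h n * lift (partial a (partial b f)) (x + s' n *\<^sub>R axis b 1 + t' n *\<^sub>R axis a 1)"
    by metis
  have "lift (partial a (partial b f)) (x + s' n *\<^sub>R axis b 1 + t' n *\<^sub>R axis a 1)
      = lift (partial b (partial a f)) (x + s n *\<^sub>R axis a 1 + t n *\<^sub>R axis b 1)" for n
    using st(3)[of n] st'(3)[of n] h[of n] by simp
  moreover have "(\<lambda>n. lift (partial b (partial a f)) (x + s n *\<^sub>R axis a 1 + t n *\<^sub>R axis b 1))
      \<longlonglongrightarrow> lift (partial b (partial a f)) x"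
    using st(1,2) by (intro lim) (simp_all add: h_def)
  moreover have "(\<lambda>n. lift (partial a (partial b f)) (x + s' n *\<^sub>R axis b 1 + t' n *\<^sub>R axis a 1))
      \<longlonglongrightarrow> lift (partial a (partial b f)) x"
    using st'(1,2) by (intro lim) (simp_all add: h_def)
  ultimately show "lift (partial a (partial b f)) x = lift (partial b (partial a f)) x"
    by (simp add: LIMSEQ_unique)
qed

section \<open>Constant functions, and derivatives that are constant\<close>

definition const_fun :: "('n::finite) smfun \<Rightarrow> bool" where
  "const_fun f \<longleftrightarrow> (\<forall>a. partial a f = 0)"

lemma const_fun_intros [intro, simp]:
  "const_fun 0" "const_fun 1" "const_fun (of_real c)"
  "const_fun f \<Longrightarrow> const_fun g \<Longrightarrow> const_fun (f + g)"
  "const_fun f \<Longrightarrow> const_fun g \<Longrightarrow> const_fun (f - g)"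
  "const_fun f \<Longrightarrow> const_fun g \<Longrightarrow> const_fun (f * g)"
  "const_fun f \<Longrightarrow> const_fun (- f)"
  by (auto simp: const_fun_def)

lemma const_fun_sum [intro]: "(\<And>x. x \<in> A \<Longrightarrow> const_fun (f x)) \<Longrightarrow> const_fun (sum f A)"
  by (simp add: const_fun_def)

lemma const_funE:
  assumes "const_fun f" obtains c where "f = of_real c"
proof -
  have "(lift f has_derivative (\<lambda>v. 0)) (at x within UNIV)" for x
    using has_derivative_lift[of f x] assms by (simp add: const_fun_def)
  from has_derivative_zero_constant[OF convex_UNIV this]
  obtain c where "\<And>x. lift f x = c" by auto
  then have "f = of_real c" by (intro lift_ext) simp
  then show thesis by (rule that)
qed

text \<open>Along a unit segment in direction \<open>a\<close> the lift grows by the constant value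
  of the derivative, and periodicity forces that growth to be zero.\<close>

lemma partial_eq_0_if_const:
  assumes "const_fun (partial a f)"
  shows "partial a f = 0"
proof -
  obtain c where c: "partial a f = of_real c" using assms by (rule const_funE)
  have "c = 0"
  proof (rule ccontr)
    assume "c \<noteq> 0"
    have D: "((\<lambda>s. lift f (0 + s *\<^sub>R axis a 1)) has_real_derivative c) (at s)" for s
      using DERIV_lift[of f 0 a s] by (simp only: c lift_of_real)
    have "lift f (0 + 1 *\<^sub>R axis a 1) - lift f (0 + 0 *\<^sub>R axis a 1) = (1 - 0) * c"
      using MVT2[OF zero_less_one D] by blast
    then show False using lift_periodic[OF axis_int_lattice, of f 0 a] \<open>c \<noteq> 0\<close> by simp
  qed
  then show ?thesis by (simp add: c)
qed

lemma const_fun_if_partials: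
  "(\<And>a. const_fun (partial a f)) \<Longrightarrow> const_fun f"
  unfolding const_fun_def[of f] by (intro allI partial_eq_0_if_const)

subsection \<open>Trigonometric functions\<close>

lemma frechet_derivative_trig:
  fixes x :: "real^'n::finite"
  shows "frechet_derivative (\<lambda>x. sin (2 * pi * x $ a)) (at x) = (\<lambda>v. (2 * pi * v $ a) * cos (2 * pi * x $ a))"
    and "frechet_derivative (\<lambda>x. cos (2 * pi * x $ a)) (at x) = (\<lambda>v. (- 2 * pi * v $ a) * sin (2 * pi * x $ a))"
  by (rule frechet_derivative_at[symmetric];
      auto intro!: derivative_eq_intros bounded_linear.has_derivative[OF bounded_linear_vec_nth] simp: mult_ac)+

lemma differentiable_trig:
  fixes x :: "real^'n::finite"
  shows "(\<lambda>x. sin (2 * pi * x $ a)) differentiable (at x)"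
    and "(\<lambda>x. cos (2 * pi * x $ a)) differentiable (at x)"
  unfolding differentiable_def
  by (rule exI; auto intro!: derivative_eq_intros bounded_linear.has_derivative[OF bounded_linear_vec_nth])+

text \<open>Each of the two functions has a multiple of the other as derivative, so the induction
  must carry both.\<close>

lemma smooth_trig:
  "smooth (\<lambda>x::real^'n::finite. sin (2 * pi * x $ a))" "smooth (\<lambda>x::real^'n. cos (2 * pi * x $ a))"
proof -
  have "Ck k (\<lambda>x::real^'n. sin (2 * pi * x $ a)) \<and> Ck k (\<lambda>x::real^'n. cos (2 * pi * x $ a))" for k
  proof (induction k)
    case 0
    show ?case by (auto intro!: continuous_intros)
  next
    case (Suc k)
    then show ?case
      unfolding Ck.simps frechet_derivative_trig
      by (intro conjI allI differentiable_trig Ck_mult Ck_const) auto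
  qed
  then show "smooth (\<lambda>x::real^'n. sin (2 * pi * x $ a))" "smooth (\<lambda>x::real^'n. cos (2 * pi * x $ a))"
    by (auto simp: smooth_def)
qed

lemma ex_trig:
  fixes a :: "'n::finite"
  shows "\<exists>f. lift f = (\<lambda>x. sin (2 * pi * x $ a))" and "\<exists>f. lift f = (\<lambda>x. cos (2 * pi * x $ a))"
proof -
  have *: "sin (2 * pi * (x + z) $ a) = sin (2 * pi * x $ a)"
    "cos (2 * pi * (x + z) $ a) = cos (2 * pi * x $ a)"
    if "z \<in> int_lattice" for x z :: "real^'n"
  proof -
    have "z $ a \<in> \<int>" using that by (simp add: int_lattice_def)
    note this[THEN sin_integer_2pi] this[THEN cos_integer_2pi]
    then show "sin (2 * pi * (x + z) $ a) = sin (2 * pi * x $ a)"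
      "cos (2 * pi * (x + z) $ a) = cos (2 * pi * x $ a)"
      by (simp_all add: distrib_left sin_add cos_add)
  qed
  show "\<exists>f. lift f = (\<lambda>x. sin (2 * pi * x $ a))"
    using ex_lift[OF smooth_trig(1)[of a]] * by metis
  show "\<exists>f. lift f = (\<lambda>x. cos (2 * pi * x $ a))"
    using ex_lift[OF smooth_trig(2)[of a]] * by metis
qed

definition sinx :: "'n::finite \<Rightarrow> 'n smfun" where
  "sinx a = (SOME f. lift f = (\<lambda>x. sin (2 * pi * x $ a)))"
definition cosx :: "'n::finite \<Rightarrow> 'n smfun" where
  "cosx a = (SOME f. lift f = (\<lambda>x. cos (2 * pi * x $ a)))"

lemma lift_sinx: "lift (sinx a) = (\<lambda>x. sin (2 * pi * x $ a))"
  unfolding sinx_def by (rule someI_ex[OF ex_trig(1)])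
lemma lift_cosx: "lift (cosx a) = (\<lambda>x. cos (2 * pi * x $ a))"
  unfolding cosx_def by (rule someI_ex[OF ex_trig(2)])

lemma partial_sinx: "partial b (sinx a) = (if a = b then of_real (2 * pi) * cosx a else 0)"
  and partial_cosx: "partial b (cosx a) = (if a = b then - of_real (2 * pi) * sinx a else 0)"
  by (rule lift_ext; simp only: lift_partial lift_sinx lift_cosx frechet_derivative_trig;
      simp add: axis_def lift_sinx lift_cosx)+

lemma sinx_cosx: "sinx a * sinx a + cosx a * cosx a = 1"
proof (rule lift_ext)
  fix x
  show "lift (sinx a * sinx a + cosx a * cosx a) x = lift 1 x"
    using sin_cos_squared_add[of "2 * pi * x $ a"] by (simp add: lift_sinx lift_cosx power2_eq_square)
qed

subsection \<open>Closed one-forms\<close>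

text \<open>Poincare's lemma: the primitive is the integral of the form along the ray from the
  origin. Its gradient has the integrand \<open>G a x s\<close>, which is the
  \<open>s\<close>-derivative of \<open>s * \<alpha> a (s *\<^sub>R x)\<close> and so integrates to
  \<open>\<alpha> a x\<close>.\<close>

lemma closed_form_primitive:
  fixes \<alpha> :: "'n::finite \<Rightarrow> real^'n \<Rightarrow> real"
  assumes der: "\<And>b x. (\<alpha> b has_derivative (\<lambda>v. \<Sum>a\<in>UNIV. v $ a * D a b x)) (at x)"
    and cont: "\<And>a b. continuous_on UNIV (D a b)"
    and sym: "\<And>a b x. D a b x = D b a x"
  obtains H where "\<And>x. (H has_derivative (\<lambda>v. \<Sum>a\<in>UNIV. v $ a * \<alpha> a x)) (at x)"
proof -
  \<comment> \<open>Coordinate functionals as bounded linear maps, the type of derivative with which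
    \<open>leibniz_rule\<close> differentiates under the integral.\<close>
  define B :: "'n \<Rightarrow> (real^'n) \<Rightarrow>\<^sub>L real" where "B a = Blinfun (\<lambda>v. v $ a)" for a
  have B: "blinfun_apply (B a) v = v $ a" for a v
    by (simp add: B_def bounded_linear_vec_nth bounded_linear_Blinfun_apply)
  define G where "G a x s = \<alpha> a (s *\<^sub>R x) + s * (\<Sum>b\<in>UNIV. x $ b * D b a (s *\<^sub>R x))" for a s and x :: "real^'n"
  define f where "f x s = (\<Sum>b\<in>UNIV. \<alpha> b (s *\<^sub>R x) * x $ b)" for x :: "real^'n" and s
  define fx where "fx x s = (\<Sum>a\<in>UNIV. G a x s *\<^sub>R B a)" for x :: "real^'n" and s
  define H where "H x = integral (cbox 0 1) (f x)" for x
  have c\<alpha>: "continuous_on S (\<lambda>x. \<alpha> a (g x))" if "continuous_on S g" for a S and g :: "'x::topological_space \<Rightarrow> _"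
  proof -
    have "isCont (\<alpha> a) x" for x by (rule has_derivative_continuous[OF der])
    then have "continuous_on UNIV (\<alpha> a)" by (simp add: continuous_on_eq_continuous_at)
    from continuous_on_compose2[OF this that] show ?thesis by auto
  qed
  have cD: "continuous_on S (\<lambda>x. D a b (g x))" if "continuous_on S g" for a b S and g :: "'x::topological_space \<Rightarrow> _"
    using continuous_on_compose2[OF cont that] by auto
  have der_s: "((\<lambda>x. \<alpha> b (s *\<^sub>R x)) has_derivative (\<lambda>v. \<Sum>a\<in>UNIV. s * v $ a * D a b (s *\<^sub>R x))) (at x)" for b s x
  proof -
    have "((\<lambda>x. s *\<^sub>R x) has_derivative (\<lambda>v. s *\<^sub>R v)) (at x)" by (auto intro!: derivative_eq_intros)
    from has_derivative_compose[OF this der] show ?thesis by simp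
  qed
  have der_x: "((\<lambda>s. \<alpha> b (s *\<^sub>R x)) has_derivative (\<lambda>h. \<Sum>a\<in>UNIV. h * x $ a * D a b (s *\<^sub>R x))) (at s)" for b s x
  proof -
    have "((\<lambda>s. s *\<^sub>R x) has_derivative (\<lambda>h. h *\<^sub>R x)) (at s)" by (auto intro!: derivative_eq_intros)
    from has_derivative_compose[OF this der] show ?thesis by simp
  qed
  have 1: "((\<lambda>x. f x s) has_derivative blinfun_apply (fx x s)) (at x within UNIV)" for x s
  proof -
    have "((\<lambda>x. f x s) has_derivative (\<lambda>v. \<Sum>b\<in>UNIV. \<alpha> b (s *\<^sub>R x) * v $ b
        + (\<Sum>a\<in>UNIV. s * v $ a * D a b (s *\<^sub>R x)) * x $ b)) (at x)"
      unfolding f_def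
      by (intro has_derivative_sum has_derivative_mult der_s
          bounded_linear.has_derivative[OF bounded_linear_vec_nth] has_derivative_ident)
    moreover have "(\<Sum>b\<in>UNIV. \<alpha> b (s *\<^sub>R x) * v $ b + (\<Sum>a\<in>UNIV. s * v $ a * D a b (s *\<^sub>R x)) * x $ b)
        = blinfun_apply (fx x s) v" for v
    proof -
      \<comment> \<open>Closedness, that is the symmetry of \<open>D\<close>, turns the derivative
        of the integrand into \<open>G\<close>.\<close>
      have "(\<Sum>b\<in>UNIV. (\<Sum>a\<in>UNIV. s * v $ a * D a b (s *\<^sub>R x)) * x $ b)
          = (\<Sum>a\<in>UNIV. v $ a * (s * (\<Sum>b\<in>UNIV. x $ b * D b a (s *\<^sub>R x))))"
        unfolding sum_distrib_right sum_distrib_left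
        by (subst sum.swap) (simp add: mult_ac sym[of _ _ "s *\<^sub>R x"])
      then show ?thesis
        by (simp add: fx_def G_def blinfun.sum_left blinfun.scaleR_left B sum.distrib
            distrib_left distrib_right mult.commute)
    qed
    ultimately show ?thesis by simp
  qed
  have contf: "continuous_on S (f x)" for x S
    unfolding f_def by (intro continuous_intros c\<alpha>)
  have 2: "continuous_on (UNIV \<times> cbox 0 1) (\<lambda>(x, s). fx x s)"
    unfolding fx_def G_def split_beta by (intro continuous_intros c\<alpha> cD)
  have 3: "integral (cbox 0 1) (fx x) = (\<Sum>a\<in>UNIV. \<alpha> a x *\<^sub>R B a)" for x
  proof -
    have "((\<lambda>s. \<Sum>a\<in>UNIV. (s * \<alpha> a (s *\<^sub>R x)) *\<^sub>R B a) has_vector_derivative fx x s) (at s within S)" for s S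
    proof -
      have "((\<lambda>s. s * \<alpha> a (s *\<^sub>R x)) has_real_derivative G a x s) (at s within S)" for a
      proof -
        have "((\<lambda>s. s * \<alpha> a (s *\<^sub>R x)) has_derivative
            (\<lambda>h. s * (\<Sum>b\<in>UNIV. h * x $ b * D b a (s *\<^sub>R x)) + h * \<alpha> a (s *\<^sub>R x))) (at s)"
          by (intro has_derivative_mult has_derivative_ident der_x)
        moreover have "(\<lambda>h. s * (\<Sum>b\<in>UNIV. h * x $ b * D b a (s *\<^sub>R x)) + h * \<alpha> a (s *\<^sub>R x)) = (*) (G a x s)"
          by (auto simp: G_def algebra_simps sum_distrib_left)
        ultimately have "((\<lambda>s. s * \<alpha> a (s *\<^sub>R x)) has_real_derivative G a x s) (at s)"
          by (simp only: has_field_derivative_def)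
        then show ?thesis by (rule has_field_derivative_at_within)
      qed
      then have "((\<lambda>s. \<Sum>a\<in>UNIV. (s * \<alpha> a (s *\<^sub>R x)) *\<^sub>R B a) has_derivative
          (\<lambda>h. \<Sum>a\<in>UNIV. (G a x s * h) *\<^sub>R B a)) (at s within S)"
        unfolding has_field_derivative_def
        by (intro has_derivative_sum has_derivative_scaleR_left)
      then show ?thesis
        by (simp add: fx_def has_vector_derivative_def scaleR_sum_right mult.commute)
    qed
    then have "(fx x has_integral (\<Sum>a\<in>UNIV. (1 * \<alpha> a (1 *\<^sub>R x)) *\<^sub>R B a) - (\<Sum>a\<in>UNIV. (0 * \<alpha> a (0 *\<^sub>R x)) *\<^sub>R B a)) {0..1}"
      by (intro fundamental_theorem_of_calculus) auto
    then show ?thesis by (simp add: integral_unique)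
  qed
  have eq: "blinfun_apply (integral (cbox 0 1) (fx x)) = (\<lambda>v. \<Sum>a\<in>UNIV. v $ a * \<alpha> a x)" for x
    unfolding 3 by (simp add: fun_eq_iff blinfun.sum_left blinfun.scaleR_left B mult.commute)
  have "(H has_derivative blinfun_apply (integral (cbox 0 1) (fx x))) (at x within UNIV)" for x
    unfolding H_def
    by (rule leibniz_rule[where U=UNIV, OF 1 integrable_continuous[OF contf] 2]) auto
  then have "(H has_derivative (\<lambda>v. \<Sum>a\<in>UNIV. v $ a * \<alpha> a x)) (at x)" for x
    by (simp only: eq)
  then show thesis by (rule that)
qed

lemma int_lattice_induct:
  fixes P :: "real^'n::finite \<Rightarrow> bool"
  assumes z: "z \<in> int_lattice" and 0: "P 0"
    and add: "\<And>x y. P x \<Longrightarrow> P y \<Longrightarrow> P (x + y)" and minus: "\<And>x. P x \<Longrightarrow> P (- x)"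
    and axis: "\<And>a. P (axis a 1)"
  shows "P z"
proof -
  have n: "P (real n *\<^sub>R axis a 1)" for n a
    by (induction n) (use 0 add axis in \<open>auto simp: scaleR_add_left\<close>)
  have P: "P (z $ a *\<^sub>R axis a 1)" for a
  proof -
    have "z $ a \<in> \<int>" using z by (simp add: int_lattice_def)
    then obtain i where i: "z $ a = of_int i" by (auto elim: Ints_cases)
    show ?thesis
    proof (cases "i \<ge> 0")
      case True
      then show ?thesis using n[of "nat i" a] by (simp add: i)
    next
      case False
      then show ?thesis using minus[OF n[of "nat (- i)" a]] by (simp add: i)
    qed
  qed
  have "P (\<Sum>a\<in>A. z $ a *\<^sub>R axis a 1)" if "finite A" for A
    using that by induction (use P 0 add in auto)
  moreover have "z = (\<Sum>a\<in>UNIV. z $ a *\<^sub>R axis a 1)"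
    by (simp add: vec_eq_iff axis_def if_distrib[where f="\<lambda>x. _ * x"] cong: if_cong)
  ultimately show ?thesis by (metis finite)
qed

lemma has_derivative_linear_form:
  "((\<lambda>x. \<Sum>a\<in>UNIV. x $ a * r a) has_derivative (\<lambda>v. \<Sum>a\<in>UNIV. v $ a * r a)) (at x)"
  for r :: "'n::finite \<Rightarrow> real"
  by (rule bounded_linear_imp_has_derivative[OF bounded_linear_sum[OF
        bounded_linear_mult_const[OF bounded_linear_vec_nth]]])

text \<open>The hypothesis makes the differential only a constant two-form \<open>c\<close>. A
  linear correction gives a closed form on the cover, with primitive \<open>H\<close>. Commuting two
  unit translations shows \<open>c = 0\<close>; then \<open>H\<close> has constant periods
  \<open>d\<close>, and subtracting the linear function with these slopes leaves a periodic
  function.\<close>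

lemma torus_closed_form:
  fixes A :: "'n::finite \<Rightarrow> 'n smfun"
  assumes "\<And>a b. const_fun (partial a (A b) - partial b (A a))"
  obtains h k where "\<And>b. A b = of_real (k b) + partial b h"
proof -
  define c where "c a b = lift (partial a (A b) - partial b (A a)) 0" for a b
  have c: "partial a (A b) - partial b (A a) = of_real (c a b)" for a b
    by (rule const_funE[OF assms[of a b]]) (simp add: c_def del: lift_diff)
  have lc: "lift (partial a (A b)) x = lift (partial b (A a)) x + c a b" for a b x
    using arg_cong[OF c, of "\<lambda>f. lift f x" a b] by simp
  have anti: "c a b = - c b a" for a b
    using lc[of a b 0] lc[of b a 0] by linarith
  \<comment> \<open>The antisymmetric \<open>c\<close> is split evenly between the two mixed
    derivatives, whence the half.\<close>
  define \<alpha> where "\<alpha> b x = lift (A b) x - (\<Sum>a\<in>UNIV. x $ a * (c a b / 2))" for b x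
  have 1: "(\<alpha> b has_derivative (\<lambda>v. \<Sum>a\<in>UNIV. v $ a * (lift (partial a (A b)) x - c a b / 2))) (at x)" for b x
  proof -
    have "(\<alpha> b has_derivative (\<lambda>v. (\<Sum>a\<in>UNIV. v $ a * lift (partial a (A b)) x) - (\<Sum>a\<in>UNIV. v $ a * (c a b / 2)))) (at x)"
      unfolding \<alpha>_def
      by (intro has_derivative_diff has_derivative_lift has_derivative_linear_form)
    then show ?thesis by (simp add: right_diff_distrib sum_subtractf)
  qed
  have 2: "continuous_on UNIV (\<lambda>x. lift (partial a (A b)) x - c a b / 2)" for a b
    by (intro continuous_intros)
  have 3: "lift (partial a (A b)) x - c a b / 2 = lift (partial b (A a)) x - c b a / 2" for a b x
    using lc[of a b x] anti[of a b] by linarith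
  obtain H where H: "\<And>x. (H has_derivative (\<lambda>v. \<Sum>a\<in>UNIV. v $ a * \<alpha> a x)) (at x)"
    by (rule closed_form_primitive[OF 1 2 3]) blast
  have ss: "(\<Sum>e\<in>UNIV. axis b 1 $ e * r e) = r b" for b and r :: "'n \<Rightarrow> real"
    by (simp add: axis_def if_distrib[where f="\<lambda>x. x * _"] cong: if_cong)
  \<comment> \<open>Translation by \<open>axis a 1\<close> changes \<open>\<alpha> b\<close> by the
    constant \<open>- (c a b / 2)\<close>, so it changes \<open>H\<close> by an affine function with
    constant part \<open>d\<close>.\<close>
  have "\<exists>d. \<forall>x. H (x + axis a 1) - H x + (\<Sum>b\<in>UNIV. x $ b * (c a b / 2)) = d" for a
  proof -
    have "((\<lambda>x. H (x + axis a 1) - H x + (\<Sum>b\<in>UNIV. x $ b * (c a b / 2))) has_derivative (\<lambda>v. 0)) (at x)" for x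
    proof -
      have "((\<lambda>x. x + axis a 1) has_derivative (\<lambda>v. v)) (at x)" by (auto intro!: derivative_eq_intros)
      from has_derivative_compose[OF this H]
      have D: "((\<lambda>x. H (x + axis a 1) - H x + (\<Sum>b\<in>UNIV. x $ b * (c a b / 2))) has_derivative
          (\<lambda>v. (\<Sum>b\<in>UNIV. v $ b * \<alpha> b (x + axis a 1)) - (\<Sum>b\<in>UNIV. v $ b * \<alpha> b x) + (\<Sum>b\<in>UNIV. v $ b * (c a b / 2)))) (at x)"
        by (rule has_derivative_add[OF has_derivative_diff[OF _ H] has_derivative_linear_form])
      have 0: "\<alpha> b (x + axis a 1) - \<alpha> b x + c a b / 2 = 0" for b
        by (simp only: \<alpha>_def lift_periodic[OF axis_int_lattice] vector_add_component distrib_right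
            sum.distrib ss)
      have "(\<Sum>b\<in>UNIV. v $ b * \<alpha> b (x + axis a 1)) - (\<Sum>b\<in>UNIV. v $ b * \<alpha> b x) + (\<Sum>b\<in>UNIV. v $ b * (c a b / 2))
          = (\<Sum>b\<in>UNIV. v $ b * (\<alpha> b (x + axis a 1) - \<alpha> b x + c a b / 2))" for v :: "real^'n"
        by (simp only: distrib_left right_diff_distrib sum.distrib sum_subtractf)
      with D show ?thesis by (simp only: 0 mult_zero_right sum.neutral_const)
    qed
    from has_derivative_zero_constant[OF convex_UNIV this] show ?thesis by blast
  qed
  then obtain d where d: "\<And>a x. H (x + axis a 1) - H x + (\<Sum>b\<in>UNIV. x $ b * (c a b / 2)) = d a" by metis
  have "c a b = 0" for a b
  proof -
    have e: "H (x + axis a 1) = H x + d a - (\<Sum>b\<in>UNIV. x $ b * (c a b / 2))" for a x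
      using d[of x a] by (simp only: diff_add_eq eq_diff_eq)
    \<comment> \<open>Reaching the same point by the two orders of translation leaves
      \<open>c b a\<close> on one side and \<open>c a b\<close> on the other.\<close>
    have "H (0 + axis a 1 + axis b 1) = H (0 + axis b 1 + axis a 1)"
      by (simp only: add_0 add.commute[of "axis a 1"])
    then have "c a b = c b a"
      by (simp only: e vector_add_component distrib_right sum.distrib ss)
    with anti[of a b] show ?thesis by linarith
  qed
  then have c0: "c = (\<lambda>a b. 0)" by (intro ext)
  have \<alpha>: "\<alpha> a x = lift (A a) x" for a x by (simp add: \<alpha>_def c0)
  define h0 where "h0 x = H x - (\<Sum>a\<in>UNIV. x $ a * d a)" for x
  have "\<forall>x. h0 (x + z) = h0 x" if "z \<in> int_lattice" for z
    using that
  proof (rule int_lattice_induct)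
    show "\<forall>x. h0 (x + axis a 1) = h0 x" for a
    proof
      fix x
      have "H (x + axis a 1) = H x + d a" using d[of x a] by (simp add: c0)
      then show "h0 (x + axis a 1) = h0 x"
        by (simp only: h0_def vector_add_component distrib_right sum.distrib ss)
    qed
  next
    show "\<forall>x. h0 (x + - y) = h0 x" if *: "\<forall>x. h0 (x + y) = h0 x" for y
    proof
      fix x
      show "h0 (x + - y) = h0 x" using *[rule_format, of "x + - y"] by simp
    qed
  next
    show "\<forall>x. h0 (x + (y + z)) = h0 x" if "\<forall>x. h0 (x + y) = h0 x" "\<forall>x. h0 (x + z) = h0 x" for y z
      using that by (simp only: add.assoc[symmetric]) simp 
  qed simp
  then have per: "h0 (x + z) = h0 x" if "z \<in> int_lattice" for x z using that by blast
  have h0: "(h0 has_derivative (\<lambda>v. \<Sum>a\<in>UNIV. v $ a * lift (A a - of_real (d a)) x)) (at x)" for x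
  proof -
    have "(h0 has_derivative (\<lambda>v. (\<Sum>a\<in>UNIV. v $ a * \<alpha> a x) - (\<Sum>a\<in>UNIV. v $ a * d a))) (at x)"
      unfolding h0_def
      by (intro has_derivative_diff H has_derivative_linear_form)
    then show ?thesis by (simp add: right_diff_distrib sum_subtractf \<alpha>)
  qed
  obtain h where h: "lift h = h0"
    by (rule ex_lift[OF smooth_if_partials_lift[OF h0] per]) blast
  have "partial a h = A a - of_real (d a)" for a
    using h0 by (intro partial_unique[where p="\<lambda>a. A a - of_real (d a)"]) (simp add: h)
  then have "A a = of_real (d a) + partial a h" for a by simp
  then show thesis by (rule that)
qed

section \<open>Formal functions and formal vector fields\<close>

text \<open>Real scalars get a name of their own: coordinate derivations kill them, automorphisms
  fix them, and the matrices \<open>Om\<close> and \<open>P\<close> enter the formulas through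
  them.\<close>

definition kap :: "real \<Rightarrow> ('n::finite) ffun" where
  "kap c = fps_const (of_real c)"

lemma kap_simps [simp]: "kap 0 = 0" "kap 1 = 1"
  by (simp_all add: kap_def)
lemma kap_add: "kap (a + b) = kap a + kap b"
  by (simp add: kap_def)
lemma kap_mult: "kap (a * b) = kap a * kap b"
  by (simp add: kap_def)
lemma kap_minus: "kap (- a) = - kap a"
  by (simp add: kap_def)
lemma kap_sum: "kap (sum f A) = (\<Sum>x\<in>A. kap (f x))"
  by (induction A rule: infinite_finite_induct) (auto simp: kap_add)
lemma kap_numeral [simp]: "kap (numeral n) = numeral n"
  by (simp add: kap_def numeral_fps_const)
lemma kap_if: "kap (if b then x else y) = (if b then kap x else kap y)"
  by simp
lemma nth_kap_mult [simp]: "fps_nth (kap c * F) k = of_real c * fps_nth F k"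
  by (simp add: kap_def)
text \<open>The ring of formal functions has zero divisors, so numerical factors are cancelled
  through their real inverses.\<close>

lemma kap_cancel: "c \<noteq> 0 \<Longrightarrow> kap c * F = kap c * G \<Longrightarrow> F = G"
proof -
  assume c: "c \<noteq> 0" and eq: "kap c * F = kap c * G"
  have *: "kap (1 / c) * (kap c * H) = H" for H :: "'a ffun"
    unfolding mult.assoc[symmetric] kap_mult[symmetric] using c by simp
  have "kap (1 / c) * (kap c * F) = kap (1 / c) * (kap c * G)" by (simp only: eq)
  then show "F = G" by (simp only: *)
qed

lemma nth_fpartial [simp]: "fps_nth (fpartial a F) k = partial a (fps_nth F k)"
  by (simp add: fpartial_def)
lemma fpartial_add [simp]: "fpartial a (F + G) = fpartial a F + fpartial a G"
  by (simp add: fps_eq_iff)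
lemma fpartial_diff [simp]: "fpartial a (F - G) = fpartial a F - fpartial a G"
  by (simp add: fps_eq_iff)
lemma fpartial_mult [simp]: "fpartial a (F * G) = fpartial a F * G + F * fpartial a G"
  by (simp add: fps_eq_iff fps_mult_nth sum.distrib)
lemma fpartial_fps_const [simp]: "fpartial a (fps_const f) = fps_const (partial a f)"
  by (simp add: fps_eq_iff)
lemma fpartial_kap [simp]: "fpartial a (kap c) = 0"
  by (simp add: kap_def)
lemma fpartial_0 [simp]: "fpartial a 0 = 0" and fpartial_1 [simp]: "fpartial a 1 = 0"
  using fpartial_kap[of a 0] fpartial_kap[of a 1] by simp_all
lemma fpartial_X [simp]: "fpartial a fps_X = 0"
  by (simp add: fps_eq_iff fps_X_def)
lemma fpartial_X_power [simp]: "fpartial a (fps_X ^ m) = 0"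
  by (induction m) auto
lemma fpartial_sum [simp]: "fpartial a (sum f A) = (\<Sum>x\<in>A. fpartial a (f x))"
  by (induction A rule: infinite_finite_induct) auto
lemma fpartial_commute: "fpartial a (fpartial b F) = fpartial b (fpartial a F)"
  by (simp add: fps_eq_iff partial_commute)

lemma sum_delta_mult [simp]:
  fixes f :: "'n::finite \<Rightarrow> 'r::comm_ring_1"
  shows "(\<Sum>a\<in>UNIV. (if b = a then c else 0) * f a) = c * f b"
    "(\<Sum>a\<in>UNIV. (if a = b then c else 0) * f a) = c * f b"
    "(\<Sum>a\<in>UNIV. f a * (if b = a then c else 0)) = f b * c"
    "(\<Sum>a\<in>UNIV. f a * (if a = b then c else 0)) = f b * c"
  by (simp_all add: if_distrib[where f="\<lambda>x. x * _"] if_distrib[where f="\<lambda>x. _ * x"] cong: if_cong)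

definition fsin :: "'n::finite \<Rightarrow> 'n ffun" where "fsin a = fps_const (sinx a)"
definition fcos :: "'n::finite \<Rightarrow> 'n ffun" where "fcos a = fps_const (cosx a)"

lemma fpartial_fsin: "fpartial b (fsin a) = (if a = b then kap (2 * pi) * fcos a else 0)"
  and fpartial_fcos: "fpartial b (fcos a) = (if a = b then - (kap (2 * pi) * fsin a) else 0)"
  by (simp_all add: fsin_def fcos_def partial_sinx partial_cosx kap_def)

lemma fcos_fsin: "fcos a * fcos a + fsin a * fsin a = 1"
  using sinx_cosx[of a] by (simp add: fsin_def fcos_def add.commute)

lemma fvf_app_fsin: "fvf_app X (fsin a) = kap (2 * pi) * (X $ a * fcos a)"
  and fvf_app_fcos: "fvf_app X (fcos a) = - (kap (2 * pi) * (X $ a * fsin a))"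
  by (simp_all add: fvf_app_def fpartial_fsin fpartial_fcos mult_ac)

text \<open>On \<open>fsin a\<close> and \<open>fcos a\<close> the field gives \<open>X $ a\<close>
  times cosine and times minus sine. This combination isolates \<open>X $ a\<close> although there
  is no coordinate function to which \<open>X\<close> could be applied.\<close>

lemma fvf_component: "kap (2 * pi) * X $ a = fcos a * fvf_app X (fsin a) - fsin a * fvf_app X (fcos a)"
proof -
  have "fcos a * fvf_app X (fsin a) - fsin a * fvf_app X (fcos a)
      = kap (2 * pi) * X $ a * (fcos a * fcos a + fsin a * fsin a)"
    unfolding fvf_app_fsin fvf_app_fcos by (simp add: algebra_simps)
  then show ?thesis by (simp add: fcos_fsin)
qed

lemma fvf_ext:
  assumes "\<And>F. fvf_app X F = fvf_app Y F" shows "X = Y"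
proof -
  have "kap (2 * pi) * X $ a = kap (2 * pi) * Y $ a" for a
    unfolding fvf_component assms ..
  then have "X $ a = Y $ a" for a by (rule kap_cancel[rotated]) simp
  then show ?thesis by (simp add: vec_eq_iff)
qed

lemma fvf_app_add_left: "fvf_app (X + Y) F = fvf_app X F + fvf_app Y F"
  by (simp add: fvf_app_def distrib_right sum.distrib)
lemma fvf_app_diff_left: "fvf_app (X - Y) F = fvf_app X F - fvf_app Y F"
  by (simp add: fvf_app_def left_diff_distrib sum_subtractf)
lemma fvf_app_scale: "fvf_app (G *s X) F = G * fvf_app X F"
  by (simp add: fvf_app_def sum_distrib_left mult.assoc)
lemma fvf_app_add [simp]: "fvf_app X (F + G) = fvf_app X F + fvf_app X G"
  by (simp add: fvf_app_def distrib_left sum.distrib)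
lemma fvf_app_sum [simp]: "fvf_app X (sum f A) = (\<Sum>x\<in>A. fvf_app X (f x))"
  by (simp add: fvf_app_def sum_distrib_left) (rule sum.swap)
lemma fvf_app_mult [simp]: "fvf_app X (F * G) = fvf_app X F * G + F * fvf_app X G"
proof -
  have "fvf_app X (F * G) = (\<Sum>a\<in>UNIV. X $ a * fpartial a F * G + F * (X $ a * fpartial a G))"
    by (simp add: fvf_app_def algebra_simps)
  then show ?thesis
    by (simp add: fvf_app_def sum.distrib sum_distrib_left sum_distrib_right)
qed
lemma fvf_app_kap [simp]: "fvf_app X (kap c) = 0"
  by (simp add: fvf_app_def)
lemma fvf_app_0 [simp]: "fvf_app X 0 = 0"
  by (simp add: fvf_app_def)
lemma fvf_app_axis [simp]: "fvf_app (axis a 1) F = fpartial a F"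
  by (simp add: fvf_app_def axis_def)
lemma fvf_app_0_left [simp]: "fvf_app 0 F = 0"
  by (simp add: fvf_app_def)

text \<open>The second-order part is symmetric in \<open>X\<close> and \<open>Y\<close>, which is
  why the commutator in \<open>fvf_app_bracket\<close> is again a vector field.\<close>

lemma fvf_app_fpartial_commute:
  "fvf_app X (fvf_app Y F) = (\<Sum>a\<in>UNIV. fvf_app X (Y $ a) * fpartial a F)
     + (\<Sum>a\<in>UNIV. \<Sum>b\<in>UNIV. X $ a * (Y $ b * fpartial a (fpartial b F)))"
proof -
  have "fvf_app X (fvf_app Y F) = (\<Sum>b\<in>UNIV. fvf_app X (Y $ b) * fpartial b F)
      + (\<Sum>b\<in>UNIV. Y $ b * fvf_app X (fpartial b F))"
    by (simp add: fvf_app_def[of Y] sum.distrib)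
  also have "(\<Sum>b\<in>UNIV. Y $ b * fvf_app X (fpartial b F))
      = (\<Sum>a\<in>UNIV. \<Sum>b\<in>UNIV. X $ a * (Y $ b * fpartial a (fpartial b F)))"
    unfolding fvf_app_def sum_distrib_left by (subst sum.swap) (simp add: mult_ac)
  finally show ?thesis .
qed

lemma fvf_app_bracket: "fvf_app (fvf_bracket X Y) F = fvf_app X (fvf_app Y F) - fvf_app Y (fvf_app X F)"
proof -
  have "(\<Sum>a\<in>UNIV. \<Sum>b\<in>UNIV. X $ a * (Y $ b * fpartial a (fpartial b F)))
      = (\<Sum>a\<in>UNIV. \<Sum>b\<in>UNIV. Y $ a * (X $ b * fpartial a (fpartial b F)))"
    by (subst sum.swap) (simp add: mult_ac fpartial_commute)
  then show ?thesis
    unfolding fvf_app_fpartial_commute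
    by (simp add: fvf_bracket_def fvf_app_def[of "\<chi> a. fvf_app X (Y $ a) - fvf_app Y (X $ a)"]
        left_diff_distrib sum_subtractf)
qed

lemma fvf_basis: "X = (\<Sum>a\<in>UNIV. X $ a *s axis a 1)" for X :: "('r::comm_ring_1)^'n::finite"
  by (simp add: vec_eq_iff axis_def sum_component)

lemma fps_decomp: "F = fps_const (fps_nth F 0) + fps_X * fps_shift 1 F" for F :: "'a::comm_ring_1 fps"
  by (rule fps_ext, case_tac n) (simp_all add: fps_X_mult_nth)

subsection \<open>Extension of homomorphisms to formal functions\<close>

lemma ext_const: 
  assumes "\<psi> 0 = 0" shows "symplecto_ext \<psi> (fps_const f) = \<psi> f"
proof (rule fps_ext)
  fix m
  have "(\<Sum>i\<le>m. fps_nth (\<psi> (fps_nth (fps_const f) i)) (m - i)) = (\<Sum>i\<le>m. if i = 0 then fps_nth (\<psi> f) m else 0)"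
    by (rule sum.cong) (auto simp: assms)
  then show "fps_nth (symplecto_ext \<psi> (fps_const f)) m = fps_nth (\<psi> f) m"
    by (simp add: symplecto_ext_def)
qed

lemma ext_X: 
  assumes "\<psi> 0 = 0" shows "symplecto_ext \<psi> (fps_X * F) = fps_X * symplecto_ext \<psi> F"
proof (rule fps_ext)
  fix m show "fps_nth (symplecto_ext \<psi> (fps_X * F)) m = fps_nth (fps_X * symplecto_ext \<psi> F) m"
  proof (cases m)
    case (Suc k)
    then show ?thesis
      by (simp add: symplecto_ext_def fps_X_mult_nth sum.atMost_Suc_shift assms del: sum.atMost_Suc)
  qed (simp add: symplecto_ext_def fps_X_mult_nth assms)
qed

lemma ext_add:
  assumes "\<And>f g. \<psi> (f + g) = \<psi> f + \<psi> g"
  shows "symplecto_ext \<psi> (F + G) = symplecto_ext \<psi> F + symplecto_ext \<psi> G"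
  by (simp add: fps_eq_iff symplecto_ext_def assms sum.distrib)

text \<open>Writing a series as its constant term plus \<open>fps_X\<close> times its shift reduces
  order \<open>m + 1\<close> to order \<open>m\<close> of the shift. The induction runs in the right
  argument with a constant on the left, and then in the left argument. It serves both the product
  and the Poisson bracket.\<close>

lemma ext_bilinear:
  fixes E :: "'a::comm_ring_1 fps \<Rightarrow> 'a fps"
  assumes add: "\<And>F G. E (F + G) = E F + E G" and X: "\<And>F. E (fps_X * F) = fps_X * E F"
    and B: "\<And>F F' G. B (F + F') G = B F G + B F' G" "\<And>F G G'. B F (G + G') = B F G + B F G'"
      "\<And>F G. B (fps_X * F) G = fps_X * B F G" "\<And>F G. B F (fps_X * G) = fps_X * B F G"
    and c: "\<And>f g. E (B (fps_const f) (fps_const g)) = B (E (fps_const f)) (E (fps_const g))"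
  shows "E (B F G) = B (E F) (E G)"
proof -
  have 1: "fps_nth (E (B (fps_const f) G)) m = fps_nth (B (E (fps_const f)) (E G)) m" for f G m
  proof (induction m arbitrary: G)
    case 0
    have "E (B (fps_const f) G) = B (E (fps_const f)) (E (fps_const (fps_nth G 0)))
        + fps_X * E (B (fps_const f) (fps_shift 1 G))"
      by (subst fps_decomp[of G]) (simp only: B add X c)
    moreover have "B (E (fps_const f)) (E G) = B (E (fps_const f)) (E (fps_const (fps_nth G 0)))
        + fps_X * B (E (fps_const f)) (E (fps_shift 1 G))"
      by (subst fps_decomp[of G]) (simp only: B add X)
    ultimately show ?case by (simp only: fps_add_nth fps_X_mult_nth) simp
  next
    case (Suc m)
    have "E (B (fps_const f) G) = B (E (fps_const f)) (E (fps_const (fps_nth G 0)))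
        + fps_X * E (B (fps_const f) (fps_shift 1 G))"
      by (subst fps_decomp[of G]) (simp only: B add X c)
    moreover have "B (E (fps_const f)) (E G) = B (E (fps_const f)) (E (fps_const (fps_nth G 0)))
        + fps_X * B (E (fps_const f)) (E (fps_shift 1 G))"
      by (subst fps_decomp[of G]) (simp only: B add X)
    ultimately show ?case
      by (simp only: fps_add_nth fps_X_mult_nth) (simp add: Suc.IH)
  qed
  then have c': "E (B (fps_const f) G) = B (E (fps_const f)) (E G)" for f G
    by (simp add: fps_eq_iff)
  have "fps_nth (E (B F G)) m = fps_nth (B (E F) (E G)) m" for m
  proof (induction m arbitrary: F)
    case 0
    have "E (B F G) = B (E (fps_const (fps_nth F 0))) (E G) + fps_X * E (B (fps_shift 1 F) G)"
      by (subst fps_decomp[of F]) (simp only: B add X c')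
    moreover have "B (E F) (E G) = B (E (fps_const (fps_nth F 0))) (E G) + fps_X * B (E (fps_shift 1 F)) (E G)"
      by (subst fps_decomp[of F]) (simp only: B add X)
    ultimately show ?case by (simp only: fps_add_nth fps_X_mult_nth) simp
  next
    case (Suc m)
    have "E (B F G) = B (E (fps_const (fps_nth F 0))) (E G) + fps_X * E (B (fps_shift 1 F) G)"
      by (subst fps_decomp[of F]) (simp only: B add X c')
    moreover have "B (E F) (E G) = B (E (fps_const (fps_nth F 0))) (E G) + fps_X * B (E (fps_shift 1 F)) (E G)"
      by (subst fps_decomp[of F]) (simp only: B add X)
    ultimately show ?case
      by (simp only: fps_add_nth fps_X_mult_nth) (simp add: Suc.IH)
  qed
  then show ?thesis by (simp add: fps_eq_iff)
qed

lemma ext_unique: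
  fixes E :: "('n::finite) ffun \<Rightarrow> 'n ffun"
  assumes add: "\<And>F G. E (F + G) = E F + E G" and X: "\<And>F. E (fps_X * F) = fps_X * E F"
  shows "symplecto_ext (\<lambda>f. E (fps_const f)) = E"
proof -
  have "fps_nth (E F) m = fps_nth (symplecto_ext (\<lambda>f. E (fps_const f)) F) m" for F m
  proof (induction m arbitrary: F)
    case 0
    have "E F = E (fps_const (fps_nth F 0)) + fps_X * E (fps_shift 1 F)"
      by (subst fps_decomp[of F]) (simp only: add X)
    then show ?case by (simp add: symplecto_ext_def)
  next
    case (Suc m)
    have "E F = E (fps_const (fps_nth F 0)) + fps_X * E (fps_shift 1 F)"
      by (subst fps_decomp[of F]) (simp only: add X)
    then show ?case
      by (simp add: symplecto_ext_def sum.atMost_Suc_shift Suc.IH del: sum.atMost_Suc)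
  qed
  then show ?thesis by (simp add: fun_eq_iff fps_eq_iff)
qed

text \<open>An additive map commuting with \<open>fps_X\<close> is triangular with respect to the
  order in \<open>t\<close>, with the same diagonal entry \<open>?e\<close> at every order.\<close>

lemma ext_bij:
  fixes E :: "('n::finite) ffun \<Rightarrow> 'n ffun"
  assumes add: "\<And>F G. E (F + G) = E F + E G" and X: "\<And>F. E (fps_X * F) = fps_X * E F"
  shows "bij E \<longleftrightarrow> bij (\<lambda>f. fps_nth (E (fps_const f)) 0)" (is "_ \<longleftrightarrow> bij ?e")
proof
  have E: "E F = E (fps_const (fps_nth F 0)) + fps_X * E (fps_shift 1 F)" for F
    by (subst fps_decomp[of F]) (simp only: add X)
  have E0: "E 0 = 0" using X[of 0] by (metis add add_cancel_right_left)
  have Ediff: "E (F - G) = E F - E G" for F G using add[of "F - G" G] by simp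
  have ediff: "?e (f - g) = ?e f - ?e g" for f g
    using Ediff[of "fps_const f" "fps_const g"] by (simp flip: fps_const_sub)
  have cancel: "F = G" if "fps_X * F = fps_X * G" for F G :: "'n ffun"
  proof (rule fps_ext)
    fix n show "fps_nth F n = fps_nth G n"
      using arg_cong[OF that, of "\<lambda>F. fps_nth F (Suc n)"] by (simp add: fps_X_mult_nth)
  qed
  {
    assume bij: "bij E"
    have "inj ?e"
    proof (rule injI)
      fix f g assume "?e f = ?e g"
      then have 0: "fps_nth (E (fps_const (f - g))) 0 = 0" using ediff[of f g] by simp
      obtain H where H: "E H = fps_shift 1 (E (fps_const (f - g)))" using bij_is_surj[OF bij] by (metis surjD)
      have "E (fps_const (f - g)) = fps_X * fps_shift 1 (E (fps_const (f - g)))"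
        using fps_decomp[of "E (fps_const (f - g))"] 0 by simp
      also have "\<dots> = E (fps_X * H)" by (simp add: X H)
      finally have "fps_const (f - g) = fps_X * H" by (rule injD[OF bij_is_inj[OF bij]])
      then have "fps_nth (fps_const (f - g)) 0 = fps_nth (fps_X * H) 0" by simp
      then show "f = g" by (simp add: fps_X_mult_nth)
    qed
    moreover have "\<exists>f. g = ?e f" for g
    proof -
      obtain F where F: "E F = fps_const g" using bij_is_surj[OF bij] by (metis surjD)
      have "?e (fps_nth F 0) = g" using arg_cong[OF E[of F], of "\<lambda>F. fps_nth F 0"] by (simp add: F)
      then show ?thesis by blast
    qed
    ultimately show "bij ?e" unfolding bij_def surj_def by blast
  }
  {
    assume bij: "bij ?e"
    have "F = 0" if "E F = 0" for F
    proof -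
      have "fps_nth F m = 0" for m using that
      proof (induction m arbitrary: F)
        case 0
        have "?e (fps_nth F 0) = ?e 0" using arg_cong[OF E[of F], of "\<lambda>F. fps_nth F 0"] 0 E0 by simp
        then show ?case by (rule injD[OF bij_is_inj[OF bij]])
      next
        case (Suc m)
        have "?e (fps_nth F 0) = ?e 0" using arg_cong[OF E[of F], of "\<lambda>F. fps_nth F 0"] Suc.prems E0 by simp
        then have "fps_nth F 0 = 0" by (rule injD[OF bij_is_inj[OF bij]])
        then have "fps_X * E (fps_shift 1 F) = fps_X * 0" using E[of F] Suc.prems E0 by simp
        from Suc.IH[OF cancel[OF this]] show ?case by simp
      qed
      then show ?thesis by (simp add: fps_eq_iff)
    qed
    then have "inj E" by (intro injI) (metis Ediff right_minus_eq)
    moreover have "\<exists>F. G = E F" for G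
    proof -
      \<comment> \<open>Successive approximation: \<open>s\<close> solves for the leading
        coefficient, and \<open>r\<close> is the remaining error divided by
        \<open>fps_X\<close>.\<close>
      define s where "s G = inv ?e (fps_nth G 0)" for G
      define r where "r G = fps_shift 1 (G - E (fps_const (s G)))" for G
      have s: "fps_nth (E (fps_const (s G))) 0 = fps_nth G 0" for G
        unfolding s_def by (rule surj_f_inv_f[OF bij_is_surj[OF bij]])
      have r: "G = E (fps_const (s G)) + fps_X * r G" for G
        using fps_decomp[of "G - E (fps_const (s G))"] by (simp add: s r_def)
      \<comment> \<open>The preimage collects the leading solutions of all successive remainders.
        Its tails \<open>F n\<close> are what the recursion speaks about.\<close>
      define F where "F n = Abs_fps (\<lambda>k. s ((r ^^ (n + k)) G))" for n
      have F: "F n = fps_const (s ((r ^^ n) G)) + fps_X * F (Suc n)" for n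
        by (rule fps_ext, case_tac na) (simp_all add: F_def fps_X_mult_nth)
      have "fps_nth (E (F n)) m = fps_nth ((r ^^ n) G) m" for n m
      proof (induction m arbitrary: n)
        case 0
        have "E (F n) = E (fps_const (s ((r ^^ n) G))) + fps_X * E (F (Suc n))"
          by (subst F) (simp only: add X)
        then show ?case by (simp add: s)
      next
        case (Suc m)
        have "E (F n) = E (fps_const (s ((r ^^ n) G))) + fps_X * E (F (Suc n))"
          by (subst F) (simp only: add X)
        then have "fps_nth (E (F n)) (Suc m) = fps_nth (E (fps_const (s ((r ^^ n) G))) + fps_X * r ((r ^^ n) G)) (Suc m)"
          by (simp add: Suc.IH)
        then show ?case using r[of "(r ^^ n) G"] by simp
      qed
      then have "E (F 0) = G" by (simp add: fps_eq_iff)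
      then show ?thesis by blast
    qed
    ultimately show "bij E" unfolding bij_def surj_def by blast
  }
qed

section \<open>Automorphisms of the Poisson algebra of formal functions\<close>

text \<open>\<open>Om\<close> is the constant matrix of the form and \<open>P\<close> its inverse,
  the matrix of the Poisson tensor. \<open>constant_symplectic_ex\<close> provides both for an
  invariant symplectic form.\<close>

locale constant_symplectic =
  fixes w :: "('n::finite) form2" and Om P :: "'n \<Rightarrow> 'n \<Rightarrow> real"
  assumes w: "\<And>a b. w $ a $ b = of_real (Om a b)"
    and Om_anti: "\<And>a b. Om a b = - Om b a"
    and P_anti: "\<And>a b. P a b = - P b a"
    and Om_P: "\<And>a c. (\<Sum>b\<in>UNIV. Om a b * P b c) = (if a = c then 1 else 0)"
    and P_Om: "\<And>a c. (\<Sum>b\<in>UNIV. P a b * Om b c) = (if a = c then 1 else 0)"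
begin

lemma kOm_P: "(\<Sum>b\<in>UNIV. kap (Om a b) * kap (P b c)) = (if a = c then 1 else 0)"
  by (simp only: kap_mult[symmetric] kap_sum[symmetric] Om_P kap_if kap_simps)
lemma kP_Om: "(\<Sum>b\<in>UNIV. kap (P a b) * kap (Om b c)) = (if a = c then 1 else 0)"
  by (simp only: kap_mult[symmetric] kap_sum[symmetric] P_Om kap_if kap_simps)
lemma kOm_anti: "kap (Om a b) = - kap (Om b a)"
  by (simp only: kap_minus[symmetric] Om_anti[symmetric])
lemma kP_anti: "kap (P a b) = - kap (P b a)"
  by (simp only: kap_minus[symmetric] P_anti[symmetric])

lemma Om_P_vec: "(\<Sum>b\<in>UNIV. kap (Om a b) * (\<Sum>c\<in>UNIV. kap (P b c) * v c)) = v a"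
proof -
  have "(\<Sum>b\<in>UNIV. kap (Om a b) * (\<Sum>c\<in>UNIV. kap (P b c) * v c))
      = (\<Sum>c\<in>UNIV. (\<Sum>b\<in>UNIV. kap (Om a b) * kap (P b c)) * v c)"
    unfolding sum_distrib_left sum_distrib_right by (subst sum.swap) (simp add: mult.assoc)
  then show ?thesis by (simp add: kOm_P)
qed

lemma P_Om_vec: "(\<Sum>b\<in>UNIV. kap (P a b) * (\<Sum>c\<in>UNIV. kap (Om b c) * v c)) = v a"
proof -
  have "(\<Sum>b\<in>UNIV. kap (P a b) * (\<Sum>c\<in>UNIV. kap (Om b c) * v c))
      = (\<Sum>c\<in>UNIV. (\<Sum>b\<in>UNIV. kap (P a b) * kap (Om b c)) * v c)"
    unfolding sum_distrib_left sum_distrib_right by (subst sum.swap) (simp add: mult.assoc)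
  then show ?thesis by (simp add: kP_Om)
qed

lemma fform_eq: "fform w X Y = (\<Sum>a\<in>UNIV. \<Sum>b\<in>UNIV. kap (Om a b) * X $ a * Y $ b)"
  by (simp add: fform_def bil_def w kap_def)

lemma bil_axis: "bil w X (axis b 1) = (\<Sum>a\<in>UNIV. of_real (Om a b) * X $ a)"
  by (simp add: bil_def w axis_def)

text \<open>Discharges the description in \<open>hamiltonian_vf\<close>: contraction with
  \<open>P\<close> solves the linear system for the components and shows the solution to be
  unique.\<close>

lemma hamiltonian: "hamiltonian_vf w f = (\<chi> a. \<Sum>b\<in>UNIV. of_real (P b a) * partial b f)" (is "_ = ?X")
  unfolding hamiltonian_vf_def
proof (rule the_equality)
  have 1: "(\<Sum>a\<in>UNIV. of_real (Om a b) * ?X $ a) = partial b f" for b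
  proof -
    have "(\<Sum>a\<in>UNIV. of_real (Om a b) * ?X $ a)
        = (\<Sum>c\<in>UNIV. of_real (\<Sum>a\<in>UNIV. P c a * Om a b) * partial c f)"
      unfolding of_real_sum sum_distrib_right vec_lambda_beta sum_distrib_left
      by (subst sum.swap) (simp add: mult_ac)
    then show ?thesis by (simp add: P_Om if_distrib[where f=of_real] cong: if_cong)
  qed
  have bil: "bil w X Y = (\<Sum>b\<in>UNIV. (\<Sum>a\<in>UNIV. of_real (Om a b) * X $ a) * Y $ b)" for X Y
    unfolding bil_def w sum_distrib_right by (rule sum.swap)
  show "\<forall>Y. bil w ?X Y = vf_app Y f"
    unfolding bil 1 vf_app_def by (simp add: mult.commute)
  fix X assume X: "\<forall>Y. bil w X Y = vf_app Y f"
  have "(\<Sum>a\<in>UNIV. of_real (Om a b) * X $ a) = partial b f" for b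
    using X[rule_format, of "axis b 1"] unfolding bil_axis by (simp add: vf_app_def axis_def)
  then have 2: "(\<Sum>a\<in>UNIV. of_real (Om a b) * X $ a) = (\<Sum>a\<in>UNIV. of_real (Om a b) * ?X $ a)" for b
    unfolding 1 .
  have 3: "(\<Sum>b\<in>UNIV. of_real (P b c) * (\<Sum>a\<in>UNIV. of_real (Om a b) * Z $ a)) = Z $ c" for Z :: "'n vfield" and c
  proof -
    have "(\<Sum>b\<in>UNIV. of_real (P b c) * (\<Sum>a\<in>UNIV. of_real (Om a b) * Z $ a))
        = (\<Sum>a\<in>UNIV. of_real (\<Sum>b\<in>UNIV. Om a b * P b c) * Z $ a)"
      unfolding of_real_sum sum_distrib_right sum_distrib_left
      by (subst sum.swap) (simp add: mult_ac)
    then show ?thesis by (simp add: Om_P if_distrib[where f=of_real] cong: if_cong)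
  qed
  have "X $ c = ?X $ c" for c
  proof -
    have "X $ c = (\<Sum>b\<in>UNIV. of_real (P b c) * (\<Sum>a\<in>UNIV. of_real (Om a b) * X $ a))"
      by (rule 3[symmetric])
    also have "\<dots> = (\<Sum>b\<in>UNIV. of_real (P b c) * (\<Sum>a\<in>UNIV. of_real (Om a b) * ?X $ a))"
      by (simp only: 2)
    also have "\<dots> = ?X $ c" by (rule 3)
    finally show ?thesis .
  qed
  then show "X = ?X" by (simp only: vec_eq_iff) simp
qed

lemma poisson_eq: "poisson w f g = (\<Sum>a\<in>UNIV. \<Sum>b\<in>UNIV. of_real (P b a) * (partial b f * partial a g))"
  by (simp add: poisson_def hamiltonian vf_app_def sum_distrib_right mult.assoc)

lemma fpoisson_eq: "fpoisson w F G = (\<Sum>a\<in>UNIV. \<Sum>b\<in>UNIV. kap (P b a) * (fpartial b F * fpartial a G))"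
proof (rule fps_ext)
  fix m
  have "(\<Sum>i\<le>m. \<Sum>a\<in>UNIV. \<Sum>b\<in>UNIV. of_real (P b a) * (partial b (fps_nth F i) * partial a (fps_nth G (m - i))))
      = (\<Sum>a\<in>UNIV. \<Sum>b\<in>UNIV. of_real (P b a) * (\<Sum>i\<le>m. partial b (fps_nth F i) * partial a (fps_nth G (m - i))))"
    unfolding sum_distrib_left
    by (subst sum.swap, rule sum.cong[OF refl], rule sum.swap)
  then show "fps_nth (fpoisson w F G) m = fps_nth (\<Sum>a\<in>UNIV. \<Sum>b\<in>UNIV. kap (P b a) * (fpartial b F * fpartial a G)) m"
    unfolding fpoisson_def poisson_eq fps_sum_nth nth_kap_mult by (simp add: fps_mult_nth atLeast0AtMost)
qed

lemma fpoisson_fsin: "fpoisson w (fsin b) G = kap (2 * pi) * fcos b * (\<Sum>a\<in>UNIV. kap (P b a) * fpartial a G)"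
proof -
  have "fpoisson w (fsin b) G = (\<Sum>a\<in>UNIV. kap (P b a) * (kap (2 * pi) * fcos b * fpartial a G))"
    by (simp add: fpoisson_eq fpartial_fsin if_distrib[where f="\<lambda>x. _ * x"] if_distrib[where f="\<lambda>x. x * _"] cong: if_cong)
  then show ?thesis by (simp add: sum_distrib_left mult_ac)
qed

lemma fpoisson_fcos: "fpoisson w (fcos b) G = - (kap (2 * pi) * fsin b * (\<Sum>a\<in>UNIV. kap (P b a) * fpartial a G))"
proof -
  have "fpoisson w (fcos b) G = (\<Sum>a\<in>UNIV. - (kap (P b a) * (kap (2 * pi) * fsin b * fpartial a G)))"
    by (simp add: fpoisson_eq fpartial_fcos if_distrib[where f="\<lambda>x. _ * x"] if_distrib[where f="\<lambda>x. x * _"] cong: if_cong)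
  then show ?thesis by (simp add: sum_distrib_left sum_negf mult_ac)
qed

text \<open>The coordinate fields are combinations of Hamiltonian fields. A Poisson automorphism maps
  Hamiltonian fields to Hamiltonian fields, so it conjugates vector fields to vector fields, and no
  characterisation of the derivations of the algebra of smooth functions is needed.\<close>

lemma fpartial_via_poisson:
  "fpartial d G = kap (1 / (2 * pi)) * (\<Sum>b\<in>UNIV. kap (Om d b) *
     (fcos b * fpoisson w (fsin b) G - fsin b * fpoisson w (fcos b) G))"
proof -
  have "fcos b * fpoisson w (fsin b) G - fsin b * fpoisson w (fcos b) G
      = kap (2 * pi) * (\<Sum>a\<in>UNIV. kap (P b a) * fpartial a G)" for b
  proof -
    define s where "s = (\<Sum>a\<in>UNIV. kap (P b a) * fpartial a G)"
    have "fcos b * fpoisson w (fsin b) G - fsin b * fpoisson w (fcos b) G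
      = kap (2 * pi) * s * (fcos b * fcos b + fsin b * fsin b)"
      unfolding fpoisson_fsin fpoisson_fcos s_def[symmetric] by (simp add: algebra_simps)
    then show ?thesis by (simp add: fcos_fsin s_def)
  qed
  then have "(\<Sum>b\<in>UNIV. kap (Om d b) * (fcos b * fpoisson w (fsin b) G - fsin b * fpoisson w (fcos b) G))
      = kap (2 * pi) * (\<Sum>b\<in>UNIV. kap (Om d b) * (\<Sum>a\<in>UNIV. kap (P b a) * fpartial a G))"
    by (simp add: sum_distrib_left[of "kap (2 * pi)"] mult.left_commute)
  then show ?thesis
    by (simp add: Om_P_vec flip: mult.assoc kap_mult)
qed

text \<open>Automorphisms of the whole algebra, rather than maps out of the smooth functions, are
  closed under composition and inverses. Fixing \<open>kap c\<close> and \<open>fps_X\<close>,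
  together with multiplicativity, expresses linearity over the scalars and over
  \<open>t\<close>.\<close>

definition fauto :: "('n ffun \<Rightarrow> 'n ffun) \<Rightarrow> bool" where
  "fauto \<Psi> \<longleftrightarrow> bij \<Psi> \<and> (\<forall>F G. \<Psi> (F + G) = \<Psi> F + \<Psi> G) \<and> (\<forall>F G. \<Psi> (F * G) = \<Psi> F * \<Psi> G) \<and>
     (\<forall>c. \<Psi> (kap c) = kap c) \<and> \<Psi> fps_X = fps_X \<and>
     (\<forall>F G. \<Psi> (fpoisson w F G) = fpoisson w (\<Psi> F) (\<Psi> G))"

lemma fautoD:
  assumes "fauto \<Psi>"
  shows "bij \<Psi>" "\<Psi> (F + G) = \<Psi> F + \<Psi> G" "\<Psi> (F * G) = \<Psi> F * \<Psi> G"
    "\<Psi> (kap c) = kap c" "\<Psi> fps_X = fps_X" "\<Psi> (fpoisson w F G) = fpoisson w (\<Psi> F) (\<Psi> G)"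
    "\<Psi> 0 = 0" "\<Psi> 1 = 1" "\<Psi> (F - G) = \<Psi> F - \<Psi> G" "\<Psi> (- F) = - \<Psi> F"
    "\<Psi> (sum f A) = (\<Sum>x\<in>A. \<Psi> (f x))" "inv \<Psi> (\<Psi> F) = F" "\<Psi> (inv \<Psi> F) = F"
proof -
  show *: "bij \<Psi>" "\<Psi> (F + G) = \<Psi> F + \<Psi> G" "\<Psi> (F * G) = \<Psi> F * \<Psi> G"
    "\<Psi> (kap c) = kap c" "\<Psi> fps_X = fps_X" "\<Psi> (fpoisson w F G) = fpoisson w (\<Psi> F) (\<Psi> G)" for F G c
    using assms by (auto simp: fauto_def)
  show 0: "\<Psi> 0 = 0" and "\<Psi> 1 = 1" using *(4)[of 0] *(4)[of 1] by simp_all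
  show diff: "\<Psi> (F - G) = \<Psi> F - \<Psi> G" for F G using *(2)[of "F - G" G] by simp
  show "\<Psi> (- F) = - \<Psi> F" using diff[of 0 F] 0 by simp
  show "\<Psi> (sum f A) = (\<Sum>x\<in>A. \<Psi> (f x))"
    by (induction A rule: infinite_finite_induct) (auto simp: 0 *(2))
  show "inv \<Psi> (\<Psi> F) = F" "\<Psi> (inv \<Psi> F) = F"
    using *(1) by (auto simp: bij_is_inj bij_is_surj surj_f_inv_f)
qed

lemma fauto_id: "fauto id"
  by (simp add: fauto_def)

lemma fauto_comp: "fauto \<Psi> \<Longrightarrow> fauto \<Phi> \<Longrightarrow> fauto (\<Psi> \<circ> \<Phi>)"
  by (auto simp: fauto_def bij_comp)

lemma fauto_inv:
  assumes "fauto \<Psi>" shows "fauto (inv \<Psi>)"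
proof -
  note D = fautoD[OF assms]
  have I: "inv \<Psi> F = G" if "F = \<Psi> G" for F G using that D(12) by simp
  show ?thesis
    unfolding fauto_def
    by (intro conjI allI bij_imp_bij_inv D(1) I) (simp_all add: D)
qed

text \<open>The transposed Jacobian of the formal map of the torus that induces \<open>\<Psi>\<close>.\<close>

definition jac :: "('n ffun \<Rightarrow> 'n ffun) \<Rightarrow> 'n \<Rightarrow> 'n \<Rightarrow> 'n ffun" where
  "jac \<Psi> d a = kap (1 / (2 * pi)) *
     (\<Psi> (fcos a) * fpartial d (\<Psi> (fsin a)) - \<Psi> (fsin a) * fpartial d (\<Psi> (fcos a)))"

text \<open>By \<open>fpartial_via_poisson\<close> the operator
  \<open>inv \<Psi> \<circ> fpartial d \<circ> \<Psi>\<close> is a combination of brackets with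
  fixed functions, hence a vector field with components \<open>L d a\<close>. Its values on
  \<open>fsin a\<close> and \<open>fcos a\<close> identify \<open>\<Psi> (L d a)\<close> with
  \<open>jac \<Psi> d a\<close>.\<close>

lemma chain_rule:
  assumes "fauto \<Psi>"
  shows "fpartial d (\<Psi> F) = (\<Sum>a\<in>UNIV. jac \<Psi> d a * \<Psi> (fpartial a F))"
proof -
  note D = fautoD[OF assms]
  define \<Phi> where "\<Phi> = inv \<Psi>"
  have \<Phi>: "fauto \<Phi>" unfolding \<Phi>_def by (rule fauto_inv[OF assms])
  note E = fautoD[OF \<Phi>]
  have \<Phi>\<Psi>: "\<Phi> (\<Psi> F) = F" "\<Psi> (\<Phi> F) = F" for F by (simp_all add: \<Phi>_def D)
  define L where "L d a = kap (1 / (2 * pi)) * (\<Sum>b\<in>UNIV. kap (Om d b) *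
     (\<Phi> (fcos b) * (\<Sum>c\<in>UNIV. kap (P c a) * fpartial c (\<Phi> (fsin b)))
      - \<Phi> (fsin b) * (\<Sum>c\<in>UNIV. kap (P c a) * fpartial c (\<Phi> (fcos b)))))" for d a
  have pois: "fpoisson w H F = (\<Sum>a\<in>UNIV. (\<Sum>c\<in>UNIV. kap (P c a) * fpartial c H) * fpartial a F)" for H F
    by (simp add: fpoisson_eq sum_distrib_right mult.assoc)
  have \<Phi>d: "\<Phi> (fpartial d (\<Psi> F)) = (\<Sum>a\<in>UNIV. L d a * fpartial a F)" for d F
  proof -
    have "\<Phi> (fpartial d (\<Psi> F)) = kap (1 / (2 * pi)) * (\<Sum>b\<in>UNIV. kap (Om d b) *
     (\<Phi> (fcos b) * fpoisson w (\<Phi> (fsin b)) F - \<Phi> (fsin b) * fpoisson w (\<Phi> (fcos b)) F))"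
      by (subst fpartial_via_poisson) (simp add: E \<Phi>\<Psi>)
    also have "\<dots> = (\<Sum>a\<in>UNIV. L d a * fpartial a F)"
      unfolding pois L_def sum_distrib_left[of "\<Phi> _"] sum_subtractf[symmetric]
        sum_distrib_left[of "kap _" "\<lambda>a. _ a - _ a"] sum_distrib_right[of _ UNIV "fpartial _ F"]
        sum_distrib_left[of "kap (1 / (2 * pi))"]
      by (subst sum.swap) (simp add: algebra_simps sum_distrib_left)
    finally show ?thesis .
  qed
  have d: "fpartial d (\<Psi> F) = (\<Sum>a\<in>UNIV. \<Psi> (L d a) * \<Psi> (fpartial a F))" for d F
    using arg_cong[OF \<Phi>d[of d F], of \<Psi>] by (simp add: \<Phi>\<Psi> D)
  have "\<Psi> (L d a) = jac \<Psi> d a" for d a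
  proof -
    have s: "fpartial d (\<Psi> (fsin a)) = kap (2 * pi) * (\<Psi> (L d a) * \<Psi> (fcos a))"
      unfolding d by (simp add: fpartial_fsin if_distrib[where f=\<Psi>] if_distrib[where f="\<lambda>x. _ * x"] D mult_ac cong: if_cong)
    have c: "fpartial d (\<Psi> (fcos a)) = - (kap (2 * pi) * (\<Psi> (L d a) * \<Psi> (fsin a)))"
      unfolding d by (simp add: fpartial_fcos if_distrib[where f=\<Psi>] if_distrib[where f="\<lambda>x. _ * x"] D mult_ac cong: if_cong)
    have "\<Psi> (fcos a) * fpartial d (\<Psi> (fsin a)) - \<Psi> (fsin a) * fpartial d (\<Psi> (fcos a))
        = kap (2 * pi) * \<Psi> (L d a) * \<Psi> (fcos a * fcos a + fsin a * fsin a)"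
      unfolding s c by (simp add: D algebra_simps)
    then show ?thesis
      by (simp add: jac_def fcos_fsin D flip: mult.assoc kap_mult)
  qed
  then show ?thesis using d by simp
qed

text \<open>Existence half of the description in \<open>fvf_act\<close>, from the chain rule for
  \<open>inv \<Psi>\<close>; the uniqueness half is \<open>fvf_ext\<close>.\<close>

lemma fvf_act_ex:
  assumes "fauto \<Psi>" shows "\<exists>Y. \<forall>F. fvf_app Y F = \<Psi> (fvf_app X (inv \<Psi> F))"
proof (intro exI allI)
  fix F
  note D = fautoD[OF assms]
  have "\<Psi> (fvf_app X (inv \<Psi> F))
      = (\<Sum>d\<in>UNIV. \<Sum>a\<in>UNIV. \<Psi> (X $ d) * (\<Psi> (jac (inv \<Psi>) d a) * fpartial a F))"
    by (simp add: fvf_app_def chain_rule[OF fauto_inv[OF assms]] D sum_distrib_left)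
  also have "\<dots> = fvf_app (\<chi> a. \<Sum>d\<in>UNIV. \<Psi> (X $ d) * \<Psi> (jac (inv \<Psi>) d a)) F"
    unfolding fvf_app_def vec_lambda_beta sum_distrib_right
    by (subst sum.swap) (simp add: mult.assoc)
  finally show "fvf_app (\<chi> a. \<Sum>d\<in>UNIV. \<Psi> (X $ d) * \<Psi> (jac (inv \<Psi>) d a)) F = \<Psi> (fvf_app X (inv \<Psi> F))"
    by (rule sym)
qed

lemma fvf_act_eqI:
  assumes "\<And>F. fvf_app Y F = \<Psi> (fvf_app X (inv \<Psi> F))"
  shows "fvf_act \<Psi> X = Y"
  unfolding fvf_act_def
  by (rule the_equality) (auto simp: assms intro: fvf_ext)

lemma fvf_act_app:
  assumes "fauto \<Psi>" shows "fvf_app (fvf_act \<Psi> X) F = \<Psi> (fvf_app X (inv \<Psi> F))"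
proof -
  obtain Y where Y: "\<And>F. fvf_app Y F = \<Psi> (fvf_app X (inv \<Psi> F))" using fvf_act_ex[OF assms] by blast
  show ?thesis by (simp only: fvf_act_eqI[OF Y] Y)
qed

lemma fvf_act_id [simp]: "fvf_act id X = X"
  by (rule fvf_act_eqI) simp

lemma fvf_act_comp:
  assumes "fauto \<Psi>" "fauto \<Phi>" shows "fvf_act (\<Psi> \<circ> \<Phi>) X = fvf_act \<Psi> (fvf_act \<Phi> X)"
  by (rule fvf_act_eqI)
    (simp add: fvf_act_app assms o_inv_distrib fautoD(1)[OF assms(1)] fautoD(1)[OF assms(2)])

lemma fvf_act_inv:
  assumes "fauto \<Psi>"
  shows "fvf_act \<Psi> (fvf_act (inv \<Psi>) X) = X" "fvf_act (inv \<Psi>) (fvf_act \<Psi> X) = X"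
proof -
  have "\<Psi> \<circ> inv \<Psi> = id" "inv \<Psi> \<circ> \<Psi> = id" by (simp_all add: fun_eq_iff fautoD[OF assms])
  then show "fvf_act \<Psi> (fvf_act (inv \<Psi>) X) = X" "fvf_act (inv \<Psi>) (fvf_act \<Psi> X) = X"
    using fvf_act_comp[OF assms fauto_inv[OF assms], of X] fvf_act_comp[OF fauto_inv[OF assms] assms, of X]
    by simp_all
qed

lemma fvf_act_add:
  assumes "fauto \<Psi>" shows "fvf_act \<Psi> (X + Y) = fvf_act \<Psi> X + fvf_act \<Psi> Y"
  by (rule fvf_act_eqI) (simp add: fvf_app_add_left fvf_act_app assms fautoD[OF assms])

lemma fvf_act_diff:
  assumes "fauto \<Psi>" shows "fvf_act \<Psi> (X - Y) = fvf_act \<Psi> X - fvf_act \<Psi> Y"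
  by (rule fvf_act_eqI) (simp add: fvf_app_diff_left fvf_act_app assms fautoD[OF assms])

lemma fvf_act_scale:
  assumes "fauto \<Psi>" shows "fvf_act \<Psi> (F *s X) = \<Psi> F *s fvf_act \<Psi> X"
  by (rule fvf_act_eqI) (simp add: fvf_app_scale fvf_act_app assms fautoD[OF assms])

lemma fvf_act_bracket:
  assumes "fauto \<Psi>" shows "fvf_act \<Psi> (fvf_bracket X Y) = fvf_bracket (fvf_act \<Psi> X) (fvf_act \<Psi> Y)"
  by (rule fvf_act_eqI) (simp add: fvf_app_bracket fvf_act_app assms fautoD[OF assms])

lemma fvf_act_inv_axis:
  assumes "fauto \<Psi>" shows "fvf_act (inv \<Psi>) (axis d 1) = (\<chi> a. inv \<Psi> (jac \<Psi> d a))"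
proof (rule fvf_act_eqI)
  fix F
  note D = fautoD[OF assms] and E = fautoD[OF fauto_inv[OF assms]]
  have "inv \<Psi> (fvf_app (axis d 1) (inv (inv \<Psi>) F)) = inv \<Psi> (fpartial d (\<Psi> F))"
    by (simp only: fvf_app_axis inv_inv_eq[OF D(1)])
  also have "\<dots> = fvf_app (\<chi> a. inv \<Psi> (jac \<Psi> d a)) F"
    by (simp add: chain_rule[OF assms] E D(12) fvf_app_def)
  finally show "fvf_app (\<chi> a. inv \<Psi> (jac \<Psi> d a)) F = inv \<Psi> (fvf_app (axis d 1) (inv (inv \<Psi>) F))"
    by (rule sym)
qed

section \<open>Hamiltonian fields and invariance of the form\<close>

definition ham :: "'n ffun \<Rightarrow> 'n fvfield" where
  "ham F = (\<chi> a. \<Sum>b\<in>UNIV. kap (P b a) * fpartial b F)"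

lemma fvf_app_ham: "fvf_app (ham F) G = fpoisson w F G"
  by (simp add: ham_def fvf_app_def fpoisson_eq sum_distrib_right mult.assoc)

lemma fform_ham: "fform w (ham F) Y = fvf_app Y F"
proof -
  have 1: "(\<Sum>a\<in>UNIV. kap (Om a b) * (\<Sum>c\<in>UNIV. kap (P c a) * fpartial c F)) = fpartial b F" for b
  proof -
    have e: "kap (Om a b) * (kap (P c a) * G) = kap (Om b a) * (kap (P a c) * G)" for a c G
      unfolding kOm_anti[of a b] kP_anti[of c a] by simp
    have "(\<Sum>a\<in>UNIV. kap (Om a b) * (\<Sum>c\<in>UNIV. kap (P c a) * fpartial c F))
        = (\<Sum>a\<in>UNIV. kap (Om b a) * (\<Sum>c\<in>UNIV. kap (P a c) * fpartial c F))"
      unfolding sum_distrib_left by (intro sum.cong refl e)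
    then show ?thesis by (simp only: Om_P_vec)
  qed
  have "fform w (ham F) Y = (\<Sum>b\<in>UNIV. (\<Sum>a\<in>UNIV. kap (Om a b) * (\<Sum>c\<in>UNIV. kap (P c a) * fpartial c F)) * Y $ b)"
    unfolding fform_eq ham_def vec_lambda_beta sum_distrib_right by (rule sum.swap)
  then show ?thesis by (simp only: 1) (simp add: fvf_app_def mult.commute)
qed

lemma fform_add_left: "fform w (X + X') Y = fform w X Y + fform w X' Y"
  by (simp add: fform_eq algebra_simps sum.distrib)
lemma fform_add_right: "fform w X (Y + Y') = fform w X Y + fform w X Y'"
  by (simp add: fform_eq algebra_simps sum.distrib)
lemma fform_scale_left: "fform w (F *s X) Y = F * fform w X Y"
  by (simp add: fform_eq sum_distrib_left mult_ac)
lemma fform_0_left [simp]: "fform w 0 Y = 0"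
  by (simp add: fform_eq)
lemma fform_sum_left: "fform w (sum f A) Y = (\<Sum>x\<in>A. fform w (f x) Y)"
  by (induction A rule: infinite_finite_induct) (auto simp: fform_add_left)
lemma fform_anti: "fform w X Y = - fform w Y X"
proof -
  have "fform w X Y = (\<Sum>b\<in>UNIV. \<Sum>a\<in>UNIV. kap (Om a b) * X $ a * Y $ b)"
    unfolding fform_eq by (rule sum.swap)
  also have "\<dots> = - fform w Y X"
  proof -
    have "kap (Om a b) * X $ a * Y $ b = - (kap (Om b a) * Y $ b * X $ a)" for a b
      unfolding kOm_anti[of a b] by (simp add: mult_ac)
    then show ?thesis by (simp only: fform_eq sum_negf)
  qed
  finally show ?thesis .
qed

lemma axis_ham: "(axis d 1 :: 'n fvfield) = kap (1 / (2 * pi)) *s (\<Sum>b\<in>UNIV. kap (Om d b) *s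
   (fcos b *s ham (fsin b) + (- fsin b) *s ham (fcos b)))"
proof (rule fvf_ext)
  fix G :: "'n ffun"
  have s: "fvf_app (sum f A) G = (\<Sum>x\<in>A. fvf_app (f x) G)" for f and A :: "'n set"
    by (induction A rule: infinite_finite_induct) (auto simp: fvf_app_add_left)
  show "fvf_app (axis d 1) G = fvf_app (kap (1 / (2 * pi)) *s (\<Sum>b\<in>UNIV. kap (Om d b) *s
   (fcos b *s ham (fsin b) + (- fsin b) *s ham (fcos b)))) G"
    by (simp add: fvf_app_scale s fvf_app_add_left fvf_app_ham fpartial_via_poisson[of d]
        right_diff_distrib mult.assoc)
qed

lemma fvf_act_ham: "fauto \<Psi> \<Longrightarrow> fvf_act \<Psi> (ham F) = ham (\<Psi> F)"
  by (rule fvf_act_eqI) (simp add: fvf_app_ham fautoD)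

lemma fvf_act_sum:
  assumes "fauto \<Psi>" shows "fvf_act \<Psi> (sum f A) = (\<Sum>x\<in>A. fvf_act \<Psi> (f x))"
proof -
  have "fvf_act \<Psi> 0 = 0" by (rule fvf_act_eqI) (simp add: fautoD[OF assms])
  then show ?thesis
    by (induction A rule: infinite_finite_induct) (auto simp: fvf_act_add[OF assms])
qed

text \<open>For a Hamiltonian field in the first slot the claim is naturality of applying
  \<open>Y\<close> to a function. The coordinate fields are combinations of Hamiltonian fields by
  \<open>axis_ham\<close>, and both sides are linear in the first slot up to applying
  \<open>\<Psi>\<close> to the coefficients.\<close>

lemma fform_act:
  assumes "fauto \<Psi>" shows "fform w (fvf_act \<Psi> X) (fvf_act \<Psi> Y) = \<Psi> (fform w X Y)"
proof -
  note D = fautoD[OF assms] and A = fvf_act_add[OF assms] fvf_act_scale[OF assms] fvf_act_sum[OF assms]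
  have h: "fform w (fvf_act \<Psi> (ham F)) (fvf_act \<Psi> Y) = \<Psi> (fform w (ham F) Y)" for F
    by (simp add: fvf_act_ham[OF assms] fform_ham fvf_act_app[OF assms] D)
  have ax: "fform w (fvf_act \<Psi> (axis d 1)) (fvf_act \<Psi> Y) = \<Psi> (fform w (axis d 1) Y)" for d
    unfolding axis_ham[of d] A fform_add_left fform_scale_left fform_sum_left h D ..
  show ?thesis
    by (subst (1 2) fvf_basis[of X]) (simp only: A fform_scale_left fform_sum_left ax D)
qed

subsection \<open>Formal curves of symplectomorphisms\<close>

lemma fpoisson_const: "fpoisson w (fps_const f) (fps_const g) = fps_const (poisson w f g)"
  by (rule fps_ext) (simp only: fpoisson_eq poisson_eq fps_sum_nth nth_kap_mult fpartial_fps_const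
      fps_const_mult fps_nth_fps_const, simp)

lemma fpoisson_bilinear:
  "fpoisson w (F + F') G = fpoisson w F G + fpoisson w F' G"
  "fpoisson w F (G + G') = fpoisson w F G + fpoisson w F G'"
  "fpoisson w (fps_X * F) G = fps_X * fpoisson w F G"
  "fpoisson w F (fps_X * G) = fps_X * fpoisson w F G"
  by (simp_all add: fpoisson_eq algebra_simps sum.distrib sum_distrib_left)

lemma fps_const_scaleR: "fps_const (c *\<^sub>R f) = kap c * fps_const (f :: 'n smfun)"
  by (simp add: kap_def scaleR_smfun_conv)

lemma symplecto_curve_fauto:
  assumes "fauto \<Psi>"
  shows "symplecto_curve w (\<lambda>f. \<Psi> (fps_const f))" "symplecto_ext (\<lambda>f. \<Psi> (fps_const f)) = \<Psi>"
proof -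
  note D = fautoD[OF assms]
  have X: "\<Psi> (fps_X * F) = fps_X * \<Psi> F" for F by (simp add: D)
  show "symplecto_ext (\<lambda>f. \<Psi> (fps_const f)) = \<Psi>" by (rule ext_unique[OF D(2) X])
  have "linear (\<lambda>f. fps_nth (\<Psi> (fps_const f)) k)" for k
  proof (rule linearI)
    show "fps_nth (\<Psi> (fps_const (f + g))) k = fps_nth (\<Psi> (fps_const f)) k + fps_nth (\<Psi> (fps_const g)) k" for f g
      by (simp add: D flip: fps_const_add)
    show "fps_nth (\<Psi> (fps_const (r *\<^sub>R f))) k = r *\<^sub>R fps_nth (\<Psi> (fps_const f)) k" for r f
      unfolding fps_const_scaleR D nth_kap_mult by (simp add: scaleR_smfun_conv)
  qed
  moreover have "bij (\<lambda>f. fps_nth (\<Psi> (fps_const f)) 0)"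
    using ext_bij[OF D(2) X] D(1) by blast
  moreover have "\<Psi> (fps_const 1) = 1" by (simp add: D)
  ultimately show "symplecto_curve w (\<lambda>f. \<Psi> (fps_const f))"
    by (simp add: symplecto_curve_def D flip: fps_const_mult fpoisson_const)
qed

text \<open>Multiplicativity and the bracket law are inherited from constant series through
  \<open>ext_bilinear\<close>, bijectivity through \<open>ext_bij\<close>.\<close>

lemma fauto_symplecto_ext:
  assumes "symplecto_curve w \<psi>"
  shows "fauto (symplecto_ext \<psi>)" "symplecto_ext \<psi> (fps_const f) = \<psi> f"
proof -
  have lin: "linear (\<lambda>f. fps_nth (\<psi> f) k)" for k using assms by (simp add: symplecto_curve_def)
  have c: "\<psi> 1 = 1" "\<psi> (f * g) = \<psi> f * \<psi> g" "\<psi> (poisson w f g) = fpoisson w (\<psi> f) (\<psi> g)" 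
    "bij (\<lambda>f. fps_nth (\<psi> f) 0)" for f g
    using assms by (simp_all add: symplecto_curve_def)
  have add: "\<psi> (f + g) = \<psi> f + \<psi> g" for f g
    using linear_add[OF lin] by (simp add: fps_eq_iff)
  have 0: "\<psi> 0 = 0" using add[of 0 0] by simp
  have kap: "\<psi> (of_real c) = kap c" for c
    using linear_scale[OF lin, of c 1]
    by (simp add: fps_eq_iff c(1) kap_def of_real_def[of c])
  let ?E = "symplecto_ext \<psi>"
  show const: "?E (fps_const f) = \<psi> f" for f by (rule ext_const[of \<psi>, OF 0])
  note X = ext_X[of \<psi>, OF 0] and A = ext_add[of \<psi>, OF add]
  have "bij ?E" using ext_bij[of ?E, OF A X] c(4) by (simp add: const)
  moreover have "?E (F * G) = ?E F * ?E G" for F G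
    by (rule ext_bilinear[where B="(*)" and E="?E", OF A X])
      (simp_all add: algebra_simps const c(2))
  moreover have "?E (fpoisson w F G) = fpoisson w (?E F) (?E G)" for F G
    by (rule ext_bilinear[where B="fpoisson w" and E="?E", OF A X])
      (simp_all only: fpoisson_bilinear fpoisson_const const c(3))
  moreover have "?E fps_X = fps_X" using X[of 1] const[of 1] by (simp add: c(1))
  moreover have "?E (kap k) = kap k" for k by (simp add: kap_def const kap[unfolded kap_def])
  ultimately show "fauto ?E" using A by (simp add: fauto_def)
qed

end

section \<open>Formal connections\<close>

text \<open>The last index of \<open>\<Gamma>\<close> is the upper one:
  \<open>\<Gamma> a b c\<close> is the component along \<open>\<partial>\<^sub>c\<close> of the
  derivative of \<open>\<partial>\<^sub>b\<close> in direction
  \<open>\<partial>\<^sub>a\<close>.\<close>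

definition conn :: "('n \<Rightarrow> 'n \<Rightarrow> 'n \<Rightarrow> ('n::finite) ffun) \<Rightarrow> 'n fvfield \<Rightarrow> 'n fvfield \<Rightarrow> 'n fvfield" where
  "conn \<Gamma> X Y = (\<chi> c. fvf_app X (Y $ c) + (\<Sum>a\<in>UNIV. \<Sum>b\<in>UNIV. \<Gamma> a b c * (X $ a * Y $ b)))"

definition christoffel :: "('n::finite) fcurve \<Rightarrow> 'n \<Rightarrow> 'n \<Rightarrow> 'n \<Rightarrow> 'n ffun" where
  "christoffel D a b c = Abs_fps (\<lambda>k. fps_nth D k (axis a 1) (axis b 1) $ c)"

definition curve :: "('n \<Rightarrow> 'n \<Rightarrow> 'n \<Rightarrow> ('n::finite) ffun) \<Rightarrow> 'n fcurve" where
  "curve \<Gamma> = Abs_fps (\<lambda>k X Y. (if k = 0 then flat_connection X Y else 0)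
     + (\<chi> c. \<Sum>a\<in>UNIV. \<Sum>b\<in>UNIV. fps_nth (\<Gamma> a b c) k * (X $ a * Y $ b)))"

lemma vf_app_add [simp]: "vf_app X (f + g) = vf_app X f + vf_app X g"
  by (simp add: vf_app_def distrib_left sum.distrib)
lemma vf_app_add_left [simp]: "vf_app (X + Y) f = vf_app X f + vf_app Y f"
  by (simp add: vf_app_def distrib_right sum.distrib)
lemma vf_app_scale [simp]: "vf_app (g *s X) f = g * vf_app X f"
  by (simp add: vf_app_def sum_distrib_left mult.assoc)
lemma vf_app_mult [simp]: "vf_app X (f * g) = vf_app X f * g + f * vf_app X g"
proof -
  have "vf_app X (f * g) = (\<Sum>a\<in>UNIV. X $ a * partial a f * g + f * (X $ a * partial a g))"
    by (simp add: vf_app_def algebra_simps)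
  then show ?thesis by (simp add: vf_app_def sum.distrib sum_distrib_left sum_distrib_right)
qed
lemma vf_app_of_real [simp]: "vf_app X (of_real c) = 0"
  by (simp add: vf_app_def)
lemma vf_app_0 [simp]: "vf_app X 0 = 0" and vf_app_1 [simp]: "vf_app X 1 = 0"
  by (simp_all add: vf_app_def)
lemma vf_app_sum [simp]: "vf_app X (sum f A) = (\<Sum>x\<in>A. vf_app X (f x))"
  by (induction A rule: infinite_finite_induct) auto

lemma tensor21_components:
  assumes "tensor21 A"
  shows "A X Y $ c = (\<Sum>a\<in>UNIV. \<Sum>b\<in>UNIV. A (axis a 1) (axis b 1) $ c * (X $ a * Y $ b))"
proof -
  have t: "A (X + X') Y = A X Y + A X' Y" "A (f *s X) Y = f *s A X Y"
    "A X (Y + Y') = A X Y + A X Y'" "A X (f *s Y) = f *s A X Y" for X X' Y Y' f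
    using assms by (simp_all add: tensor21_def)
  have 0: "A 0 Y = 0" "A X 0 = 0" for X Y using t(1)[of 0 0] t(3)[of _ 0 0] by simp_all
  have s: "A (sum f S) Y = (\<Sum>x\<in>S. A (f x) Y)" "A X (sum f S) = (\<Sum>x\<in>S. A X (f x))" 
    for f and S :: "'a set" and X Y
    by (induction S rule: infinite_finite_induct) (simp_all add: t 0)
  have 1: "A X Y = (\<Sum>a\<in>UNIV. X $ a *s A (axis a 1) Y)" for X
    by (subst fvf_basis[of X]) (simp only: s t)
  have 2: "A (axis a 1) Y = (\<Sum>b\<in>UNIV. Y $ b *s A (axis a 1) (axis b 1))" for a
    by (subst fvf_basis[of Y]) (simp only: s t)
  show ?thesis
    unfolding 1[of X] 2 by (simp add: sum_component sum_distrib_left mult_ac)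
qed

lemma curve_nth: "fps_nth (curve \<Gamma>) k X Y = (if k = 0 then flat_connection X Y else 0)
     + (\<chi> c. \<Sum>a\<in>UNIV. \<Sum>b\<in>UNIV. fps_nth (\<Gamma> a b c) k * (X $ a * Y $ b))"
  by (simp add: curve_def)

text \<open>The nested Cauchy sums, over the orders of the curve and of both fields, regroup into
  products of formal series.\<close>

lemma curve_ext_curve: "curve_ext (curve \<Gamma>) = conn \<Gamma>"
proof (intro ext vec_eq_iff[THEN iffD2] allI fps_ext)
  fix X Y :: "'a fvfield" and c m
  have 1: "fps_nth (curve \<Gamma>) l (vf_coeff X i) (vf_coeff Y j) $ c
     = (if l = 0 then \<Sum>a\<in>UNIV. fps_nth (X $ a) i * partial a (fps_nth (Y $ c) j) else 0)
       + (\<Sum>a\<in>UNIV. \<Sum>b\<in>UNIV. fps_nth (\<Gamma> a b c) l * (fps_nth (X $ a) i * fps_nth (Y $ b) j))" for l i j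
    by (simp add: curve_nth flat_connection_def vf_app_def vf_coeff_def)
  have "(\<Sum>l\<le>m. \<Sum>i\<le>m - l. if l = 0 then \<Sum>a\<in>UNIV. fps_nth (X $ a) i * partial a (fps_nth (Y $ c) (m - l - i)) else 0)
      = (\<Sum>l\<le>m. if l = 0 then \<Sum>i\<le>m. \<Sum>a\<in>UNIV. fps_nth (X $ a) i * partial a (fps_nth (Y $ c) (m - i)) else 0)"
    by (intro sum.cong) auto
  also have "\<dots> = fps_nth (fvf_app X (Y $ c)) m"
    by (simp add: fvf_app_def fps_sum_nth fps_mult_nth atLeast0AtMost) (rule sum.swap)
  finally have 2: "(\<Sum>l\<le>m. \<Sum>i\<le>m - l. if l = 0 then \<Sum>a\<in>UNIV. fps_nth (X $ a) i * partial a (fps_nth (Y $ c) (m - l - i)) else 0)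
      = fps_nth (fvf_app X (Y $ c)) m" .
  have "(\<Sum>l\<le>m. \<Sum>i\<le>m - l. \<Sum>a\<in>UNIV. \<Sum>b\<in>UNIV. fps_nth (\<Gamma> a b c) l * (fps_nth (X $ a) i * fps_nth (Y $ b) (m - l - i)))
     = (\<Sum>l\<le>m. \<Sum>a\<in>UNIV. \<Sum>b\<in>UNIV. \<Sum>i\<le>m - l. fps_nth (\<Gamma> a b c) l * (fps_nth (X $ a) i * fps_nth (Y $ b) (m - l - i)))"
    by (rule sum.cong[OF refl], subst sum.swap, rule sum.cong[OF refl], rule sum.swap)
  also have "\<dots> = (\<Sum>a\<in>UNIV. \<Sum>b\<in>UNIV. \<Sum>l\<le>m. \<Sum>i\<le>m - l. fps_nth (\<Gamma> a b c) l * (fps_nth (X $ a) i * fps_nth (Y $ b) (m - l - i)))"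
    by (subst sum.swap, rule sum.cong[OF refl], rule sum.swap)
  also have "\<dots> = fps_nth (\<Sum>a\<in>UNIV. \<Sum>b\<in>UNIV. \<Gamma> a b c * (X $ a * Y $ b)) m"
    by (simp add: fps_sum_nth fps_mult_nth atLeast0AtMost sum_distrib_left)
  finally show "fps_nth (curve_ext (curve \<Gamma>) X Y $ c) m = fps_nth (conn \<Gamma> X Y $ c) m"
    by (simp add: curve_ext_def conn_def 1 sum.distrib 2[unfolded diff_diff_left])
qed

lemma flat_connection_axis [simp]: "flat_connection (axis a 1) (axis b 1) = 0"
proof -
  have "(axis b 1 :: ('a smfun)^'a) $ c = (if c = b then 1 else 0)" for c by (simp add: axis_def)
  then show ?thesis by (simp add: vec_eq_iff flat_connection_def)
qed

lemma curve_christoffel: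
  assumes "fps_nth D 0 = flat_connection" and "\<And>k. k \<ge> 1 \<Longrightarrow> tensor21 (fps_nth D k)"
  shows "curve (christoffel D) = D"
proof (rule fps_ext)
  fix k show "fps_nth (curve (christoffel D)) k = fps_nth D k"
  proof (cases "k = 0")
    case True
    then show ?thesis
      by (intro ext) (simp add: curve_nth christoffel_def assms vec_eq_iff)
  next
    case False
    then show ?thesis
      by (intro ext vec_eq_iff[THEN iffD2] allI)
        (simp add: curve_nth christoffel_def tensor21_components[OF assms(2)])
  qed
qed

lemma sum_axis [simp]:
  fixes f :: "'n::finite \<Rightarrow> 'r::comm_ring_1"
  shows "(\<Sum>a\<in>UNIV. f a * axis b 1 $ a) = f b" "(\<Sum>a\<in>UNIV. axis b 1 $ a * f a) = f b"
  by (simp_all add: axis_def)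

lemma fvf_app_1 [simp]: "fvf_app X 1 = 0"
  by (simp add: fvf_app_def)

lemma fvf_app_axis_component [simp]: "fvf_app X (axis b 1 $ c) = 0"
  by (simp add: axis_def)

lemma conn_axis: "conn \<Gamma> (axis a 1) Y $ c = fpartial a (Y $ c) + (\<Sum>b\<in>UNIV. \<Gamma> a b c * Y $ b)"
proof -
  have "(\<Sum>a'\<in>UNIV. \<Sum>b\<in>UNIV. \<Gamma> a' b c * (axis a 1 $ a' * Y $ b)) = (\<Sum>a'\<in>UNIV. (\<Sum>b\<in>UNIV. \<Gamma> a' b c * Y $ b) * axis a 1 $ a')"
    by (simp add: sum_distrib_right sum_distrib_left mult_ac)
  then show ?thesis by (simp add: conn_def)
qed

lemma conn_axis_axis: "conn \<Gamma> (axis a 1) (axis b 1) $ c = \<Gamma> a b c"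
  by (simp add: conn_axis del: fvf_app_axis) (simp flip: fvf_app_axis)

lemma conn_0_left [simp]: "conn \<Gamma> 0 Y = 0"
  by (simp add: conn_def vec_eq_iff)

lemma conn_linear:
  "conn \<Gamma> (X + X') Y = conn \<Gamma> X Y + conn \<Gamma> X' Y" "conn \<Gamma> (F *s X) Y = F *s conn \<Gamma> X Y"
  "conn \<Gamma> X (Y + Y') = conn \<Gamma> X Y + conn \<Gamma> X Y'" "conn \<Gamma> X (F *s Y) = fvf_app X F *s Y + F *s conn \<Gamma> X Y"
  by (simp_all add: conn_def vec_eq_iff algebra_simps sum.distrib sum_distrib_left fvf_app_add_left fvf_app_scale)

text \<open>Additivity and the Leibniz rules reduce both operators to the coordinate frame, where
  they agree by construction. Hence every operator obeying these laws has Christoffel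
  symbols.\<close>

lemma conn_unique:
  assumes G: "\<And>X X' Y. G (X + X') Y = G X Y + G X' Y" "\<And>F X Y. G (F *s X) Y = F *s G X Y"
    "\<And>X Y Y'. G X (Y + Y') = G X Y + G X Y'" "\<And>F X Y. G X (F *s Y) = fvf_app X F *s Y + F *s G X Y"
  shows "G = conn (\<lambda>a b c. G (axis a 1) (axis b 1) $ c)"
proof (intro ext)
  fix X Y
  let ?C = "conn (\<lambda>a b c. G (axis a 1) (axis b 1) $ c)"
  have 0: "G 0 Y = 0" "G X 0 = 0" for X Y using G(1)[of 0 0] G(3)[of _ 0 0] by simp_all
  have s: "G (sum f S) Y = (\<Sum>x\<in>S. G (f x) Y)" "G X (sum f S) = (\<Sum>x\<in>S. G X (f x))" 
    for f and S :: "'a set" and X Y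
    by (induction S rule: infinite_finite_induct) (simp_all add: G 0)
  have c0: "?C X 0 = 0" for X using conn_linear(3)[of _ X 0 0] by simp
  have cs: "?C (sum f S) Y = (\<Sum>x\<in>S. ?C (f x) Y)" "?C X (sum f S) = (\<Sum>x\<in>S. ?C X (f x))" 
    for f and S :: "'a set" and X Y
    by (induction S rule: infinite_finite_induct) (simp_all add: conn_linear c0)
  have ax: "?C (axis a 1) (axis b 1) = G (axis a 1) (axis b 1)" for a b
    by (simp add: vec_eq_iff conn_axis_axis)
  have ax': "?C (axis a 1) Y = G (axis a 1) Y" for a
    by (subst (1 2) fvf_basis[of Y]) (simp only: s cs G conn_linear ax)
  show "G X Y = ?C X Y"
    by (subst (1 2) fvf_basis[of X]) (simp only: s cs G conn_linear ax')
qed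

section \<open>Symplectic connections as totally symmetric tensors\<close>

context constant_symplectic
begin

text \<open>In invariant terms
  \<open>w(\<nabla>\<^sub>a \<partial>\<^sub>b, \<partial>\<^sub>c)\<close>.\<close>

definition low :: "('n \<Rightarrow> 'n \<Rightarrow> 'n \<Rightarrow> 'n ffun) \<Rightarrow> 'n \<Rightarrow> 'n \<Rightarrow> 'n \<Rightarrow> 'n ffun" where
  "low \<Gamma> a b c = (\<Sum>d\<in>UNIV. kap (Om d c) * \<Gamma> a b d)"

lemma low_raise: "\<Gamma> a b d = (\<Sum>c\<in>UNIV. kap (P c d) * low \<Gamma> a b c)"
proof -
  have "kap (P c d) * low \<Gamma> a b c = kap (P d c) * (\<Sum>e\<in>UNIV. kap (Om c e) * \<Gamma> a b e)" for c
    unfolding low_def sum_distrib_left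
    by (intro sum.cong refl) (simp add: kOm_anti[of _ c] kP_anti[of c d])
  then show ?thesis by (simp only: P_Om_vec)
qed

text \<open>As \<open>w\<close> is constant, this is torsion-freeness together with parallelism of
  the form: see \<open>conn_torsion\<close>, \<open>conn_compat\<close> and
  \<open>sym_low_if_compat\<close>.\<close>

definition sym_low :: "('n \<Rightarrow> 'n \<Rightarrow> 'n \<Rightarrow> 'n ffun) \<Rightarrow> bool" where
  "sym_low \<Gamma> \<longleftrightarrow> (\<forall>a b c. low \<Gamma> a b c = low \<Gamma> b a c \<and> low \<Gamma> a b c = low \<Gamma> a c b)"

lemma sym_low_sym: "sym_low \<Gamma> \<Longrightarrow> \<Gamma> a b c = \<Gamma> b a c"
  by (subst (1 2) low_raise) (simp add: sym_low_def)

definition admissible :: "('n \<Rightarrow> 'n \<Rightarrow> 'n \<Rightarrow> 'n ffun) \<Rightarrow> bool" where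
  "admissible \<Gamma> \<longleftrightarrow> sym_low \<Gamma> \<and> (\<forall>a b c. fps_nth (\<Gamma> a b c) 0 = 0)"

lemma bil_tensor:
  "bil w (\<chi> c. \<Sum>a\<in>UNIV. \<Sum>b\<in>UNIV. fps_nth (\<Gamma> a b c) k * (X $ a * Y $ b)) Z
    = (\<Sum>a\<in>UNIV. \<Sum>b\<in>UNIV. \<Sum>c\<in>UNIV. fps_nth (low \<Gamma> a b c) k * (X $ a * (Y $ b * Z $ c)))"
proof -
  have "bil w (\<chi> c. \<Sum>a\<in>UNIV. \<Sum>b\<in>UNIV. fps_nth (\<Gamma> a b c) k * (X $ a * Y $ b)) Z
    = (\<Sum>d\<in>UNIV. \<Sum>c\<in>UNIV. \<Sum>a\<in>UNIV. \<Sum>b\<in>UNIV. of_real (Om d c) * (fps_nth (\<Gamma> a b d) k * (X $ a * (Y $ b * Z $ c))))"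
    by (simp add: bil_def w sum_distrib_left sum_distrib_right mult_ac)
  also have "\<dots> = (\<Sum>c\<in>UNIV. \<Sum>d\<in>UNIV. \<Sum>a\<in>UNIV. \<Sum>b\<in>UNIV. of_real (Om d c) * (fps_nth (\<Gamma> a b d) k * (X $ a * (Y $ b * Z $ c))))"
    by (rule sum.swap)
  also have "\<dots> = (\<Sum>c\<in>UNIV. \<Sum>a\<in>UNIV. \<Sum>d\<in>UNIV. \<Sum>b\<in>UNIV. of_real (Om d c) * (fps_nth (\<Gamma> a b d) k * (X $ a * (Y $ b * Z $ c))))"
    by (rule sum.cong[OF refl], rule sum.swap)
  also have "\<dots> = (\<Sum>c\<in>UNIV. \<Sum>a\<in>UNIV. \<Sum>b\<in>UNIV. \<Sum>d\<in>UNIV. of_real (Om d c) * (fps_nth (\<Gamma> a b d) k * (X $ a * (Y $ b * Z $ c))))"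
    by (rule sum.cong[OF refl], rule sum.cong[OF refl], rule sum.swap)
  also have "\<dots> = (\<Sum>c\<in>UNIV. \<Sum>a\<in>UNIV. \<Sum>b\<in>UNIV. fps_nth (low \<Gamma> a b c) k * (X $ a * (Y $ b * Z $ c)))"
    by (simp add: low_def fps_sum_nth sum_distrib_right mult.assoc)
  also have "\<dots> = (\<Sum>a\<in>UNIV. \<Sum>b\<in>UNIV. \<Sum>c\<in>UNIV. fps_nth (low \<Gamma> a b c) k * (X $ a * (Y $ b * Z $ c)))"
    by (subst sum.swap, rule sum.cong[OF refl], rule sum.swap)
  finally show ?thesis .
qed

lemma symplectic_flat: "symplectic_connection w flat_connection"
proof -
  have "linear_connection (flat_connection :: 'n vfield \<Rightarrow> _)"
    by (simp add: linear_connection_def flat_connection_def vec_eq_iff algebra_simps)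
  moreover have "flat_connection X Y - flat_connection Y X = vf_bracket X Y" for X Y :: "'n vfield"
    by (simp add: flat_connection_def vf_bracket_def vec_eq_iff)
  moreover have "vf_app X (bil w Y Z) = bil w (flat_connection X Y) Z + bil w Y (flat_connection X Z)" for X Y Z
    by (simp add: bil_def w flat_connection_def algebra_simps sum.distrib)
  ultimately show ?thesis by (simp add: symplectic_connection_def)
qed

lemma symplectic_curve_curve:
  assumes "admissible \<Gamma>" shows "symplectic_curve w (curve \<Gamma>)" "fps_nth (curve \<Gamma>) 0 = flat_connection"
proof -
  show flat: "fps_nth (curve \<Gamma>) 0 = flat_connection"
    using assms by (intro ext) (simp add: curve_nth admissible_def vec_eq_iff)
  have "tensor21 (fps_nth (curve \<Gamma>) k) \<and> totally_symmetric w (fps_nth (curve \<Gamma>) k)" if "k \<ge> 1" for k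
  proof
    have nth: "fps_nth (curve \<Gamma>) k = (\<lambda>X Y. \<chi> c. \<Sum>a\<in>UNIV. \<Sum>b\<in>UNIV. fps_nth (\<Gamma> a b c) k * (X $ a * Y $ b))"
      using that by (intro ext) (simp add: curve_nth)
    show "tensor21 (fps_nth (curve \<Gamma>) k)"
      unfolding nth tensor21_def by (simp add: vec_eq_iff algebra_simps sum.distrib sum_distrib_left)
    have s: "low \<Gamma> a b c = low \<Gamma> b a c" "low \<Gamma> a b c = low \<Gamma> a c b" for a b c
      using assms unfolding admissible_def sym_low_def by blast+
    have "(\<Sum>a\<in>UNIV. \<Sum>b\<in>UNIV. \<Sum>c\<in>UNIV. fps_nth (low \<Gamma> a b c) k * (X $ a * (Y $ b * Z $ c)))
       = (\<Sum>a\<in>UNIV. \<Sum>b\<in>UNIV. \<Sum>c\<in>UNIV. fps_nth (low \<Gamma> a b c) k * (Y $ a * (X $ b * Z $ c)))" for X Y Z :: "'n vfield"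
      by (subst sum.swap, subst s(1)) (simp only: mult_ac)
    moreover have "(\<Sum>a\<in>UNIV. \<Sum>b\<in>UNIV. \<Sum>c\<in>UNIV. fps_nth (low \<Gamma> a b c) k * (X $ a * (Y $ b * Z $ c)))
       = (\<Sum>a\<in>UNIV. \<Sum>b\<in>UNIV. \<Sum>c\<in>UNIV. fps_nth (low \<Gamma> a b c) k * (X $ a * (Z $ b * Y $ c)))" for X Y Z :: "'n vfield"
      by (rule sum.cong[OF refl], subst sum.swap, subst s(2)) (simp only: mult_ac)
    ultimately show "totally_symmetric w (fps_nth (curve \<Gamma>) k)"
      unfolding totally_symmetric_def nth bil_tensor by blast
  qed
  then show "symplectic_curve w (curve \<Gamma>)"
    by (simp add: symplectic_curve_def flat symplectic_flat)
qed

lemma admissible_christoffel: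
  assumes "symplectic_curve w D" and "fps_nth D 0 = flat_connection"
  shows "admissible (christoffel D)" "curve (christoffel D) = D"
proof -
  show eq: "curve (christoffel D) = D"
    using assms by (intro curve_christoffel) (auto simp: symplectic_curve_def)
  have 0: "fps_nth (christoffel D a b c) 0 = 0" for a b c
    by (simp add: christoffel_def assms(2))
  have low: "fps_nth (low (christoffel D) a b c) k = bil w (fps_nth D k (axis a 1) (axis b 1)) (axis c 1)" for a b c k
    by (simp add: low_def bil_axis fps_sum_nth christoffel_def)
  have "fps_nth (low (christoffel D) a b c) k = fps_nth (low (christoffel D) b a c) k
      \<and> fps_nth (low (christoffel D) a b c) k = fps_nth (low (christoffel D) a c b) k" for a b c k
  proof (cases "k = 0")
    case True
    then show ?thesis by (simp add: low_def fps_sum_nth 0)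
  next
    case False
    then have "totally_symmetric w (fps_nth D k)" using assms(1) by (simp add: symplectic_curve_def)
    then show ?thesis unfolding low totally_symmetric_def by blast
  qed
  then have "sym_low (christoffel D)" unfolding sym_low_def fps_eq_iff by blast
  with 0 show "admissible (christoffel D)" by (simp add: admissible_def)
qed

lemma ricci_curves_iff:
  "D \<in> ricci_curves w \<longleftrightarrow> (\<exists>\<Gamma>. admissible \<Gamma> \<and> D = curve \<Gamma> \<and> ricci_type w D)"
  unfolding ricci_curves_def
  using admissible_christoffel symplectic_curve_curve by (metis (mono_tags, lifting) mem_Collect_eq)

lemma fvf_app_fform: "fvf_app X (fform w Y Z) = fform w (\<chi> a. fvf_app X (Y $ a)) Z + fform w Y (\<chi> a. fvf_app X (Z $ a))"
  by (simp add: fform_eq algebra_simps sum.distrib)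

lemma fform_axis: "fform w X (axis c 1) = (\<Sum>a\<in>UNIV. kap (Om a c) * X $ a)"
  by (simp add: fform_eq)

lemma fform_axis_axis: "fform w (axis a 1) (axis b 1) = kap (Om a b)"
  by (simp add: fform_axis)

lemma fform_tensor:
  "fform w (\<chi> c. \<Sum>a\<in>UNIV. \<Sum>b\<in>UNIV. \<Gamma> a b c * (X $ a * Y $ b)) Z
    = (\<Sum>a\<in>UNIV. \<Sum>b\<in>UNIV. \<Sum>c\<in>UNIV. low \<Gamma> a b c * (X $ a * (Y $ b * Z $ c)))"
proof -
  have "fform w (\<chi> c. \<Sum>a\<in>UNIV. \<Sum>b\<in>UNIV. \<Gamma> a b c * (X $ a * Y $ b)) Z
    = (\<Sum>d\<in>UNIV. \<Sum>c\<in>UNIV. \<Sum>a\<in>UNIV. \<Sum>b\<in>UNIV. kap (Om d c) * (\<Gamma> a b d * (X $ a * (Y $ b * Z $ c))))"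
    by (simp add: fform_eq sum_distrib_left sum_distrib_right mult_ac)
  also have "\<dots> = (\<Sum>c\<in>UNIV. \<Sum>d\<in>UNIV. \<Sum>a\<in>UNIV. \<Sum>b\<in>UNIV. kap (Om d c) * (\<Gamma> a b d * (X $ a * (Y $ b * Z $ c))))"
    by (rule sum.swap)
  also have "\<dots> = (\<Sum>c\<in>UNIV. \<Sum>a\<in>UNIV. \<Sum>d\<in>UNIV. \<Sum>b\<in>UNIV. kap (Om d c) * (\<Gamma> a b d * (X $ a * (Y $ b * Z $ c))))"
    by (rule sum.cong[OF refl], rule sum.swap)
  also have "\<dots> = (\<Sum>c\<in>UNIV. \<Sum>a\<in>UNIV. \<Sum>b\<in>UNIV. \<Sum>d\<in>UNIV. kap (Om d c) * (\<Gamma> a b d * (X $ a * (Y $ b * Z $ c))))"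
    by (rule sum.cong[OF refl], rule sum.cong[OF refl], rule sum.swap)
  also have "\<dots> = (\<Sum>c\<in>UNIV. \<Sum>a\<in>UNIV. \<Sum>b\<in>UNIV. low \<Gamma> a b c * (X $ a * (Y $ b * Z $ c)))"
    by (simp add: low_def sum_distrib_right mult.assoc)
  also have "\<dots> = (\<Sum>a\<in>UNIV. \<Sum>b\<in>UNIV. \<Sum>c\<in>UNIV. low \<Gamma> a b c * (X $ a * (Y $ b * Z $ c)))"
    by (subst sum.swap, rule sum.cong[OF refl], rule sum.swap)
  finally show ?thesis .
qed

lemma conn_torsion:
  assumes "sym_low \<Gamma>" shows "conn \<Gamma> X Y - conn \<Gamma> Y X = fvf_bracket X Y"
proof -
  have "(\<Sum>a\<in>UNIV. \<Sum>b\<in>UNIV. \<Gamma> a b c * (X $ a * Y $ b)) = (\<Sum>a\<in>UNIV. \<Sum>b\<in>UNIV. \<Gamma> a b c * (Y $ a * X $ b))" for c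
    by (subst sum.swap, subst sym_low_sym[OF assms]) (simp only: mult_ac)
  then show ?thesis by (simp add: conn_def fvf_bracket_def vec_eq_iff)
qed

text \<open>The form is constant, so differentiating the components of the fields already yields the
  left side. The two Christoffel terms cancel: symmetry of \<open>low\<close> in its last indices
  meets antisymmetry of the form.\<close>

lemma conn_compat:
  assumes "sym_low \<Gamma>" shows "fvf_app X (fform w Y Z) = fform w (conn \<Gamma> X Y) Z + fform w Y (conn \<Gamma> X Z)"
proof -
  have c: "conn \<Gamma> X Y = (\<chi> c. fvf_app X (Y $ c)) + (\<chi> c. \<Sum>a\<in>UNIV. \<Sum>b\<in>UNIV. \<Gamma> a b c * (X $ a * Y $ b))" for Y
    by (simp add: conn_def vec_eq_iff)
  have s: "low \<Gamma> a b c = low \<Gamma> a c b" for a b c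
    using assms unfolding sym_low_def by blast
  have "(\<Sum>a\<in>UNIV. \<Sum>b\<in>UNIV. \<Sum>c\<in>UNIV. low \<Gamma> a b c * (X $ a * (Y $ b * Z $ c)))
       = (\<Sum>a\<in>UNIV. \<Sum>b\<in>UNIV. \<Sum>c\<in>UNIV. low \<Gamma> a b c * (X $ a * (Z $ b * Y $ c)))"
      by (rule sum.cong[OF refl], subst sum.swap, subst s) (simp only: mult_ac)
  then have "fform w (\<chi> c. \<Sum>a\<in>UNIV. \<Sum>b\<in>UNIV. \<Gamma> a b c * (X $ a * Y $ b)) Z
      + fform w Y (\<chi> c. \<Sum>a\<in>UNIV. \<Sum>b\<in>UNIV. \<Gamma> a b c * (X $ a * Z $ b)) = 0"
    by (subst fform_anti[of Y]) (simp only: fform_tensor, simp)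
  then show ?thesis
    unfolding c fform_add_left fform_add_right fvf_app_fform by (simp add: algebra_simps)
qed

text \<open>Evaluation on the coordinate frame, where the brackets vanish and the form has constant
  values.\<close>

lemma sym_low_if_compat:
  assumes t: "\<And>X Y. conn \<Gamma> X Y - conn \<Gamma> Y X = fvf_bracket X Y"
    and c: "\<And>X Y Z. fvf_app X (fform w Y Z) = fform w (conn \<Gamma> X Y) Z + fform w Y (conn \<Gamma> X Z)"
  shows "sym_low \<Gamma>"
proof -
  have low: "fform w (conn \<Gamma> (axis a 1) (axis b 1)) (axis c 1) = low \<Gamma> a b c" for a b c
    by (simp add: fform_axis low_def conn_axis_axis)
  have "fvf_bracket (axis a 1) (axis b 1) = 0" for a b :: 'n
    by (simp add: fvf_bracket_def vec_eq_iff del: fvf_app_axis)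
  then have "conn \<Gamma> (axis a 1) (axis b 1) = conn \<Gamma> (axis b 1) (axis a 1)" for a b
    using t[of "axis a 1" "axis b 1"] by simp
  then have 1: "low \<Gamma> a b c = low \<Gamma> b a c" for a b c by (simp flip: low)
  have 2: "low \<Gamma> a b c = low \<Gamma> a c b" for a b c
    using c[of "axis a 1" "axis b 1" "axis c 1"] fform_anti[of "axis b 1"]
    by (simp add: fform_axis_axis low)
  show ?thesis unfolding sym_low_def using 1 2 by blast
qed

section \<open>Transport of connections by automorphisms\<close>

lemma conn_act_laws:
  assumes "fauto \<Psi>"
  shows "conn_act \<Psi> (conn \<Gamma>) (X + X') Y = conn_act \<Psi> (conn \<Gamma>) X Y + conn_act \<Psi> (conn \<Gamma>) X' Y"
    "conn_act \<Psi> (conn \<Gamma>) (F *s X) Y = F *s conn_act \<Psi> (conn \<Gamma>) X Y"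
    "conn_act \<Psi> (conn \<Gamma>) X (Y + Y') = conn_act \<Psi> (conn \<Gamma>) X Y + conn_act \<Psi> (conn \<Gamma>) X Y'"
    "conn_act \<Psi> (conn \<Gamma>) X (F *s Y) = fvf_app X F *s Y + F *s conn_act \<Psi> (conn \<Gamma>) X Y"
proof -
  note D = fautoD[OF assms]
  note A = fvf_act_add[OF assms] fvf_act_scale[OF assms] fvf_act_add[OF fauto_inv[OF assms]]
    fvf_act_scale[OF fauto_inv[OF assms]] conn_linear fvf_act_inv[OF assms] D
    fvf_act_app[OF fauto_inv[OF assms]] inv_inv_eq[OF D(1)]
  show "conn_act \<Psi> (conn \<Gamma>) (X + X') Y = conn_act \<Psi> (conn \<Gamma>) X Y + conn_act \<Psi> (conn \<Gamma>) X' Y"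
    "conn_act \<Psi> (conn \<Gamma>) (F *s X) Y = F *s conn_act \<Psi> (conn \<Gamma>) X Y"
    "conn_act \<Psi> (conn \<Gamma>) X (Y + Y') = conn_act \<Psi> (conn \<Gamma>) X Y + conn_act \<Psi> (conn \<Gamma>) X Y'"
    "conn_act \<Psi> (conn \<Gamma>) X (F *s Y) = fvf_app X F *s Y + F *s conn_act \<Psi> (conn \<Gamma>) X Y"
    unfolding conn_act_def by (simp_all only: A)
qed

text \<open>Torsion and compatibility are expressed by brackets and the form, both respected by
  \<open>\<Psi>\<close>, so they survive transport; \<open>conn_unique\<close> supplies the
  symbols.\<close>

lemma conn_act_ex:
  assumes \<Psi>: "fauto \<Psi>" and \<Gamma>: "sym_low \<Gamma>"
  obtains \<Gamma>' where "sym_low \<Gamma>'" "conn_act \<Psi> (conn \<Gamma>) = conn \<Gamma>'"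
proof -
  note D = fautoD[OF \<Psi>] and A = fvf_act_diff[OF \<Psi>] fvf_act_inv[OF \<Psi>]
  define \<Gamma>' where "\<Gamma>' a b c = conn_act \<Psi> (conn \<Gamma>) (axis a 1) (axis b 1) $ c" for a b c
  have eq: "conn_act \<Psi> (conn \<Gamma>) = conn \<Gamma>'"
    unfolding \<Gamma>'_def[abs_def] by (rule conn_unique) (rule conn_act_laws[OF \<Psi>])+
  have "sym_low \<Gamma>'"
  proof (rule sym_low_if_compat; unfold eq[symmetric] conn_act_def)
    fix X Y Z
    show "fvf_act \<Psi> (conn \<Gamma> (fvf_act (inv \<Psi>) X) (fvf_act (inv \<Psi>) Y))
        - fvf_act \<Psi> (conn \<Gamma> (fvf_act (inv \<Psi>) Y) (fvf_act (inv \<Psi>) X)) = fvf_bracket X Y"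
      by (simp only: A(1)[symmetric] conn_torsion[OF \<Gamma>] fvf_act_bracket[OF \<Psi>] A(2))
    have 1: "fform w (fvf_act \<Psi> U) Z = \<Psi> (fform w U (fvf_act (inv \<Psi>) Z))" for U Z
      using fform_act[OF \<Psi>, of U "fvf_act (inv \<Psi>) Z"] by (simp only: A)
    have 2: "fform w Z (fvf_act \<Psi> U) = \<Psi> (fform w (fvf_act (inv \<Psi>) Z) U)" for U Z
      using fform_act[OF \<Psi>, of "fvf_act (inv \<Psi>) Z" U] by (simp only: A)
    have 3: "inv \<Psi> (fform w Y Z) = fform w (fvf_act (inv \<Psi>) Y) (fvf_act (inv \<Psi>) Z)"
      by (simp only: fform_act[OF fauto_inv[OF \<Psi>]])
    have "fvf_app X (fform w Y Z) = \<Psi> (inv \<Psi> (fvf_app X (inv (inv \<Psi>) (inv \<Psi> (fform w Y Z)))))"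
      by (simp only: inv_inv_eq[OF D(1)] D)
    also have "\<dots> = \<Psi> (fvf_app (fvf_act (inv \<Psi>) X) (fform w (fvf_act (inv \<Psi>) Y) (fvf_act (inv \<Psi>) Z)))"
      by (simp only: fvf_act_app[OF fauto_inv[OF \<Psi>]] 3)
    finally show "fvf_app X (fform w Y Z) = fform w (fvf_act \<Psi> (conn \<Gamma> (fvf_act (inv \<Psi>) X) (fvf_act (inv \<Psi>) Y))) Z
        + fform w Y (fvf_act \<Psi> (conn \<Gamma> (fvf_act (inv \<Psi>) X) (fvf_act (inv \<Psi>) Z)))"
      by (simp only: 1 2 conn_compat[OF \<Gamma>] D)
  qed
  with eq show thesis using that by blast
qed

text \<open>The Jacobian is invertible: up to \<open>inv \<Psi>\<close> its rows are the images of
  the coordinate frame under the injective map \<open>fvf_act (inv \<Psi>)\<close>.\<close>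

lemma jac_cancel:
  assumes "fauto \<Psi>" and "\<And>f. (\<Sum>c\<in>UNIV. u c * jac \<Psi> c f) = (\<Sum>c\<in>UNIV. v c * jac \<Psi> c f)"
  shows "u c = v c"
proof -
  note D = fautoD[OF assms(1)] and E = fautoD[OF fauto_inv[OF assms(1)]]
  have act: "fvf_act (inv \<Psi>) (\<chi> c. u c) = (\<chi> f. inv \<Psi> (\<Sum>c\<in>UNIV. u c * jac \<Psi> c f))" for u
  proof -
    have "(\<chi> c. u c) = (\<Sum>c\<in>UNIV. u c *s axis c 1 :: 'n fvfield)" by (subst fvf_basis) simp
    then have "fvf_act (inv \<Psi>) (\<chi> c. u c) = (\<Sum>c\<in>UNIV. inv \<Psi> (u c) *s (\<chi> f. inv \<Psi> (jac \<Psi> c f)))"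
      by (simp only: fvf_act_sum[OF fauto_inv[OF assms(1)]] fvf_act_scale[OF fauto_inv[OF assms(1)]]
          fvf_act_inv_axis[OF assms(1)])
    also have "\<dots> = (\<chi> f. inv \<Psi> (\<Sum>c\<in>UNIV. u c * jac \<Psi> c f))"
      by (simp add: vec_eq_iff E(3,11))
    finally show ?thesis .
  qed
  have "fvf_act (inv \<Psi>) (\<chi> c. u c) = fvf_act (inv \<Psi>) (\<chi> c. v c)"
    unfolding act assms(2) ..
  then have "fvf_act \<Psi> (fvf_act (inv \<Psi>) (\<chi> c. u c)) = fvf_act \<Psi> (fvf_act (inv \<Psi>) (\<chi> c. v c))" by (rule arg_cong)
  then have "(\<chi> c. u c) = (\<chi> c. v c)" by (simp only: fvf_act_inv(1)[OF assms(1)])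
  then have "(\<chi> c. u c) $ c = (\<chi> c. v c) $ c" by (rule arg_cong)
  then show ?thesis by simp
qed

text \<open>The classical transformation law of Christoffel symbols, multiplied through by the
  Jacobian so that no inverse matrix occurs and orders in \<open>t\<close> can be compared. For the
  converse, \<open>conn_act_ex\<close> yields symbols obeying the same law and
  \<open>jac_cancel\<close> identifies them with the given ones.\<close>

lemma conn_act_iff:
  assumes \<Psi>: "fauto \<Psi>" and \<Gamma>: "sym_low \<Gamma>"
  shows "conn_act \<Psi> (conn \<Gamma>) = conn \<Gamma>' \<longleftrightarrow>
    (\<forall>a b f. (\<Sum>c\<in>UNIV. \<Gamma>' a b c * jac \<Psi> c f) = fpartial a (jac \<Psi> b f)
       + (\<Sum>d\<in>UNIV. \<Sum>e\<in>UNIV. jac \<Psi> a d * jac \<Psi> b e * \<Psi> (\<Gamma> d e f)))"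
proof -
  note D = fautoD[OF \<Psi>] and E = fautoD[OF fauto_inv[OF \<Psi>]]
  have main: "(\<Sum>c\<in>UNIV. \<Gamma>' a b c * jac \<Psi> c f) = fpartial a (jac \<Psi> b f)
       + (\<Sum>d\<in>UNIV. \<Sum>e\<in>UNIV. jac \<Psi> a d * jac \<Psi> b e * \<Psi> (\<Gamma> d e f))"
    if eq: "conn_act \<Psi> (conn \<Gamma>) = conn \<Gamma>'" for a b f \<Gamma>'
  proof -
    have "conn \<Gamma>' (axis a 1) (axis b 1) = (\<Sum>c\<in>UNIV. \<Gamma>' a b c *s axis c 1)"
      by (subst fvf_basis) (simp only: conn_axis_axis)
    then have "fvf_act (inv \<Psi>) (conn \<Gamma>' (axis a 1) (axis b 1))
        = (\<Sum>c\<in>UNIV. inv \<Psi> (\<Gamma>' a b c) *s (\<chi> f. inv \<Psi> (jac \<Psi> c f)))"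
      by (simp only: fvf_act_sum[OF fauto_inv[OF \<Psi>]] fvf_act_scale[OF fauto_inv[OF \<Psi>]]
          fvf_act_inv_axis[OF \<Psi>])
    then have "fvf_act (inv \<Psi>) (conn \<Gamma>' (axis a 1) (axis b 1)) $ f = (\<Sum>c\<in>UNIV. inv \<Psi> (\<Gamma>' a b c) * inv \<Psi> (jac \<Psi> c f))"
      by simp
    moreover have "fvf_act (inv \<Psi>) (conn \<Gamma>' (axis a 1) (axis b 1))
        = conn \<Gamma> (fvf_act (inv \<Psi>) (axis a 1)) (fvf_act (inv \<Psi>) (axis b 1))"
      by (simp only: eq[symmetric] conn_act_def fvf_act_inv[OF \<Psi>])
    ultimately have "\<Psi> (conn \<Gamma> (fvf_act (inv \<Psi>) (axis a 1)) (fvf_act (inv \<Psi>) (axis b 1)) $ f)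
        = (\<Sum>c\<in>UNIV. \<Gamma>' a b c * jac \<Psi> c f)"
      by (simp add: D)
    moreover have "conn \<Gamma> (fvf_act (inv \<Psi>) (axis a 1)) (fvf_act (inv \<Psi>) (axis b 1)) $ f
        = fvf_app (fvf_act (inv \<Psi>) (axis a 1)) (inv \<Psi> (jac \<Psi> b f))
          + (\<Sum>d\<in>UNIV. \<Sum>e\<in>UNIV. \<Gamma> d e f * (inv \<Psi> (jac \<Psi> a d) * inv \<Psi> (jac \<Psi> b e)))"
      by (simp add: conn_def fvf_act_inv_axis[OF \<Psi>])
    moreover have "fvf_app (fvf_act (inv \<Psi>) (axis a 1)) (inv \<Psi> (jac \<Psi> b f)) = inv \<Psi> (fpartial a (jac \<Psi> b f))"
      by (simp add: fvf_act_app[OF fauto_inv[OF \<Psi>]] inv_inv_eq[OF D(1)] D)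
    ultimately show ?thesis by (simp add: D mult_ac)
  qed
  show ?thesis
  proof
    assume eq: "conn_act \<Psi> (conn \<Gamma>) = conn \<Gamma>'"
    show "\<forall>a b f. (\<Sum>c\<in>UNIV. \<Gamma>' a b c * jac \<Psi> c f) = fpartial a (jac \<Psi> b f)
       + (\<Sum>d\<in>UNIV. \<Sum>e\<in>UNIV. jac \<Psi> a d * jac \<Psi> b e * \<Psi> (\<Gamma> d e f))"
      by (intro allI main[OF eq])
  next
    assume *: "\<forall>a b f. (\<Sum>c\<in>UNIV. \<Gamma>' a b c * jac \<Psi> c f) = fpartial a (jac \<Psi> b f)
       + (\<Sum>d\<in>UNIV. \<Sum>e\<in>UNIV. jac \<Psi> a d * jac \<Psi> b e * \<Psi> (\<Gamma> d e f))"
    obtain \<Gamma>2 where "sym_low \<Gamma>2" and eq: "conn_act \<Psi> (conn \<Gamma>) = conn \<Gamma>2"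
      using conn_act_ex[OF \<Psi> \<Gamma>] by blast
    have "\<Gamma>' a b c = \<Gamma>2 a b c" for a b c
      by (rule jac_cancel[OF \<Psi>]) (simp only: main[OF eq] *[rule_format])
    then have "\<Gamma>' = \<Gamma>2" by (intro ext)
    with eq show "conn_act \<Psi> (conn \<Gamma>) = conn \<Gamma>'" by simp
  qed
qed

section \<open>Naturality of the curvature, and its components\<close>

lemma curvature_act:
  assumes \<Psi>: "fauto \<Psi>" and eq: "curve_ext D' = conn_act \<Psi> (curve_ext D)"
  shows "curvature D' (fvf_act \<Psi> X) (fvf_act \<Psi> Y) (fvf_act \<Psi> Z) = fvf_act \<Psi> (curvature D X Y Z)"
  unfolding curvature_def eq conn_act_def
  by (simp only: fvf_act_inv[OF \<Psi>] fvf_act_diff[OF \<Psi>] fvf_act_bracket[OF \<Psi>, symmetric])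

text \<open>Leaving the bilinear map \<open>r\<close> unspecified instead of asking for the Ricci trace makes the
  condition visibly invariant under automorphisms.\<close>

definition wricci :: "'n fcurve \<Rightarrow> bool" where
  "wricci D \<longleftrightarrow> (\<exists>r. \<forall>X Y Z T. curvature4 w D X Y Z T =
     kap (- 1 / (real CARD('n) + 2)) * (2 * fform w X Y * r Z T
        + fform w X Z * r Y T + fform w X T * r Y Z - fform w Y Z * r X T - fform w Y T * r X Z))"

lemma ricci_type_wricci: "ricci_type w D \<Longrightarrow> wricci D"
  unfolding ricci_type_def wricci_def kap_def by blast

lemma wricci_act:
  assumes \<Psi>: "fauto \<Psi>" and eq: "curve_ext D' = conn_act \<Psi> (curve_ext D)" and D: "wricci D"
  shows "wricci D'"
proof -
  note \<Psi>D = fautoD[OF \<Psi>]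
  let ?\<Phi> = "fvf_act (inv \<Psi>)"
  have 2: "\<Psi> 2 = 2" using \<Psi>D(4)[of 2] by simp
  obtain r where r: "\<And>X Y Z T. curvature4 w D X Y Z T =
     kap (- 1 / (real CARD('n) + 2)) * (2 * fform w X Y * r Z T
        + fform w X Z * r Y T + fform w X T * r Y Z - fform w Y Z * r X T - fform w Y T * r X Z)"
    using D unfolding wricci_def by blast
  have c: "curvature4 w D' X Y Z T = \<Psi> (curvature4 w D (?\<Phi> X) (?\<Phi> Y) (?\<Phi> Z) (?\<Phi> T))" for X Y Z T
    using curvature_act[OF \<Psi> eq, of "?\<Phi> X" "?\<Phi> Y" "?\<Phi> Z"]
      fform_act[OF \<Psi>, of "curvature D (?\<Phi> X) (?\<Phi> Y) (?\<Phi> Z)" "?\<Phi> T"]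
    by (simp only: curvature4_def fvf_act_inv[OF \<Psi>])
  have f: "\<Psi> (fform w (?\<Phi> X) (?\<Phi> Y)) = fform w X Y" for X Y
    using fform_act[OF \<Psi>, of "?\<Phi> X" "?\<Phi> Y"] by (simp only: fvf_act_inv[OF \<Psi>])
  show ?thesis
    unfolding wricci_def
    by (rule exI[of _ "\<lambda>X Y. \<Psi> (r (?\<Phi> X) (?\<Phi> Y))"], unfold c r, simp only: \<Psi>D f 2 simp_thms)
qed

lemma curvature_axis:
  fixes a b c d :: 'n
  shows "curvature (curve \<Gamma>) (axis a 1) (axis b 1) (axis c 1) $ d =
    fpartial a (\<Gamma> b c d) - fpartial b (\<Gamma> a c d)
    + (\<Sum>e\<in>UNIV. \<Gamma> a e d * \<Gamma> b c e) - (\<Sum>e\<in>UNIV. \<Gamma> b e d * \<Gamma> a c e)"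
proof -
  have 0: "fvf_bracket (axis a 1) (axis b 1) = (0 :: 'n fvfield)"
    by (simp add: fvf_bracket_def vec_eq_iff del: fvf_app_axis)
  show ?thesis
    unfolding curvature_def curve_ext_curve
    by (simp only: 0 conn_0_left vector_minus_component conn_axis[of _ _ "conn _ _ _"] conn_axis_axis) simp
qed

end

section \<open>Tensor algebra of Ricci-type curvature\<close>

text \<open>Once the coefficients below \<open>n\<close> vanish, coefficient \<open>2 * n\<close> of
  \<open>F * F\<close> is the square of coefficient \<open>n\<close>, and a real function with zero
  square is zero.\<close>

lemma ffun_reduced:
  assumes "F * F = 0" shows "F = (0 :: ('n::finite) ffun)"
proof -
  have "fps_nth F n = 0" for n
  proof (induction n rule: less_induct)
    case (less n)
    have "fps_nth (F * F) (2 * n) = (\<Sum>i\<in>{0..2 * n}. if i = n then fps_nth F n * fps_nth F n else 0)"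
      unfolding fps_mult_nth
    proof (rule sum.cong[OF refl])
      fix i assume "i \<in> {0..2 * n}"
      show "fps_nth F i * fps_nth F (2 * n - i) = (if i = n then fps_nth F n * fps_nth F n else 0)"
      proof (cases i n rule: linorder_cases)
        case greater
        then have "2 * n - i < n" using \<open>i \<in> {0..2 * n}\<close> by auto
        with greater show ?thesis by (simp add: less)
      qed (simp_all add: less)
    qed
    then have 0: "fps_nth F n * fps_nth F n = 0" using assms by simp
    have "lift (fps_nth F n) x = 0" for x
      using arg_cong[OF 0, of "\<lambda>f. lift f x"] by simp
    then show ?case by (intro lift_ext) simp
  qed
  then show ?thesis by (simp add: fps_eq_iff)
qed

lemma kap_diff: "kap (a - b) = kap a - kap b"
  by (simp add: kap_def)

lemma kap_of_nat: "kap (of_nat n) = of_nat n"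
  by (induction n) (simp_all add: kap_add)

lemma kap_mult_eq_0: "kap c * F = 0 \<Longrightarrow> c \<noteq> 0 \<Longrightarrow> F = 0"
  using kap_cancel[of c F 0] by simp

lemma fpartial_eq_0_if_const:
  assumes "\<And>b. fpartial b (fpartial a F) = 0" shows "fpartial a F = 0"
proof -
  have "const_fun (partial a (fps_nth F k))" for k
    using assms unfolding const_fun_def fps_eq_iff by simp
  from partial_eq_0_if_const[OF this] show ?thesis by (simp add: fps_eq_iff)
qed

context constant_symplectic
begin

section \<open>Contraction with the Poisson tensor\<close>

abbreviation om where "om a b \<equiv> kap (Om a b)"
abbreviation pv where "pv a b \<equiv> kap (P a b)"

text \<open>The order of the indices of \<open>pv\<close> is chosen so that \<open>om\<close> itself
  contracts to plus the dimension.\<close>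

definition ctr :: "('n \<Rightarrow> 'n \<Rightarrow> 'n ffun) \<Rightarrow> 'n ffun" where
  "ctr f = (\<Sum>y\<in>UNIV. \<Sum>x\<in>UNIV. pv y x * f x y)"

lemma ctr_add: "ctr (\<lambda>x y. f x y + g x y) = ctr f + ctr g"
  by (simp add: ctr_def distrib_left sum.distrib)
lemma ctr_diff: "ctr (\<lambda>x y. f x y - g x y) = ctr f - ctr g"
  by (simp add: ctr_def right_diff_distrib sum_subtractf)
lemma ctr_uminus: "ctr (\<lambda>x y. - f x y) = - ctr f"
  by (simp add: ctr_def sum_negf)
lemma ctr_mult: "ctr (\<lambda>x y. c * f x y) = c * ctr f"
  by (simp add: ctr_def sum_distrib_left mult.left_commute)
lemma ctr_0: "ctr (\<lambda>x y. 0) = 0"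
  by (simp add: ctr_def)
lemma ctr_swap: "ctr (\<lambda>x y. f y x) = - ctr f"
proof -
  have "ctr (\<lambda>x y. f y x) = (\<Sum>x\<in>UNIV. \<Sum>y\<in>UNIV. pv y x * f y x)"
    unfolding ctr_def by (rule sum.swap)
  also have "\<dots> = (\<Sum>x\<in>UNIV. \<Sum>y\<in>UNIV. - (pv x y * f y x))"
    by (intro sum.cong refl) (subst kP_anti, simp)
  finally show ?thesis by (simp add: ctr_def sum_negf)
qed
lemma ctr_sym: "(\<And>x y. f x y = f y x) \<Longrightarrow> ctr f = 0"
proof -
  assume s: "\<And>x y. f x y = f y x"
  have "(\<lambda>x y. f y x) = f" by (intro ext) (rule s)
  then have "ctr f = - ctr f" using ctr_swap[of f] by simp
  then have "ctr f + ctr f = 0" by (metis add.right_inverse)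
  then have "kap 2 * ctr f = 0" by simp
  then show "ctr f = 0" by (rule kap_mult_eq_0) simp
qed
lemma ctr_o: "ctr (\<lambda>x y. om x y) = kap (real CARD('n))"
  by (simp add: ctr_def kP_Om kap_of_nat)
text \<open>Contracting with \<open>om\<close> renames an index. The four variants differ in the
  slot of \<open>om\<close> and in the contracted argument, which together fix the sign.\<close>

lemma ctr_o1: "ctr (\<lambda>x y. om x z * g y) = g z"
proof -
  have "ctr (\<lambda>x y. om x z * g y) = (\<Sum>y\<in>UNIV. (\<Sum>x\<in>UNIV. pv y x * om x z) * g y)"
    by (simp add: ctr_def sum_distrib_right mult.assoc)
  then show ?thesis by (simp add: kP_Om)
qed
lemma ctr_o2: "ctr (\<lambda>x y. om z x * g y) = - g z"
proof -
  have "(\<lambda>x y. om z x * g y) = (\<lambda>x y. - (om x z * g y))"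
    by (intro ext) (subst kOm_anti, simp)
  then show ?thesis by (simp add: ctr_uminus ctr_o1)
qed
lemma ctr_o3: "ctr (\<lambda>x y. om y z * g x) = - g z"
  using ctr_swap[of "\<lambda>x y. om x z * g y"] by (simp add: ctr_o1)
lemma ctr_o4: "ctr (\<lambda>x y. om z y * g x) = g z"
  using ctr_swap[of "\<lambda>x y. om z x * g y"] by (simp add: ctr_o2)

text \<open>With \<open>A(a)\<close> for the matrix of symbols in direction \<open>a\<close>, this
  is \<open>w(A(a) f, A(b) c)\<close>. Under \<open>sym_low\<close> it equals
  \<open>w(A(a) A(b) c, f)\<close>, the product of two such matrices with the upper index
  lowered.\<close>

definition quad :: "('n \<Rightarrow> 'n \<Rightarrow> 'n \<Rightarrow> 'n ffun) \<Rightarrow> 'n \<Rightarrow> 'n \<Rightarrow> 'n \<Rightarrow> 'n \<Rightarrow> 'n ffun" where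
  "quad \<Gamma> a f b c = (\<Sum>e\<in>UNIV. low \<Gamma> a f e * \<Gamma> b c e)"

lemma quad_anti: "quad \<Gamma> a f b c = - quad \<Gamma> b c a f"
proof -
  have "quad \<Gamma> a f b c = (\<Sum>e\<in>UNIV. \<Sum>d\<in>UNIV. om d e * (\<Gamma> a f d * \<Gamma> b c e))"
    by (simp add: quad_def low_def sum_distrib_right mult.assoc)
  also have "\<dots> = (\<Sum>d\<in>UNIV. \<Sum>e\<in>UNIV. om d e * (\<Gamma> a f d * \<Gamma> b c e))"
    by (rule sum.swap)
  also have "\<dots> = (\<Sum>d\<in>UNIV. \<Sum>e\<in>UNIV. - (om e d * (\<Gamma> b c e * \<Gamma> a f d)))"
    by (intro sum.cong refl) (subst kOm_anti, simp add: mult_ac)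
  also have "\<dots> = - quad \<Gamma> b c a f"
    by (simp add: quad_def low_def sum_distrib_right mult.assoc sum_negf)
  finally show ?thesis .
qed

lemma low_sym: "sym_low \<Gamma> \<Longrightarrow> low \<Gamma> a b c = low \<Gamma> b a c" "sym_low \<Gamma> \<Longrightarrow> low \<Gamma> a b c = low \<Gamma> a c b"
  unfolding sym_low_def by blast+

lemma curvature4_axis:
  assumes "sym_low \<Gamma>"
  shows "curvature4 w (curve \<Gamma>) (axis a 1) (axis b 1) (axis c 1) (axis f 1)
    = fpartial a (low \<Gamma> b c f) - fpartial b (low \<Gamma> a c f) + quad \<Gamma> a f b c - quad \<Gamma> b f a c"
proof -
  have s: "(\<Sum>d\<in>UNIV. om d f * (\<Sum>e\<in>UNIV. \<Gamma> a e d * V e)) = (\<Sum>e\<in>UNIV. low \<Gamma> a f e * V e)" for a V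
  proof -
    have "(\<Sum>d\<in>UNIV. om d f * (\<Sum>e\<in>UNIV. \<Gamma> a e d * V e)) = (\<Sum>e\<in>UNIV. low \<Gamma> a e f * V e)"
      unfolding sum_distrib_left low_def sum_distrib_right by (subst sum.swap) (simp add: mult_ac)
    then show ?thesis by (simp only: low_sym(2)[OF assms, of a _ f])
  qed
  show ?thesis
    unfolding curvature4_def fform_axis curvature_axis distrib_left right_diff_distrib sum.distrib sum_subtractf s
    by (simp add: quad_def low_def)
qed

text \<open>The factor \<open>- 1 / (CARD('n) + 2)\<close> is absorbed into \<open>r\<close>. The
  curvature is symmetric in its last two slots, so the antisymmetric part of \<open>r\<close>
  survives only in the term with \<open>om a b\<close>, and a nonzero entry of \<open>Om\<close>
  makes it vanish.\<close>

lemma wricciD: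
  assumes "wricci (curve \<Gamma>)" and \<Gamma>: "sym_low \<Gamma>"
  obtains r where "\<And>a b. r a b = r b a"
    "\<And>a b c f. fpartial a (low \<Gamma> b c f) - fpartial b (low \<Gamma> a c f) + quad \<Gamma> a f b c - quad \<Gamma> b f a c
      = 2 * om a b * r c f + om a c * r b f + om a f * r b c - om b c * r a f - om b f * r a c"
proof -
  obtain r0 where r0: "\<And>X Y Z T. curvature4 w (curve \<Gamma>) X Y Z T =
     kap (- 1 / (real CARD('n) + 2)) * (2 * fform w X Y * r0 Z T
        + fform w X Z * r0 Y T + fform w X T * r0 Y Z - fform w Y Z * r0 X T - fform w Y T * r0 X Z)"
    using assms(1) unfolding wricci_def by blast
  define k :: "'n ffun" where "k = kap (- 1 / (real CARD('n) + 2))"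
  define r where "r a b = k * r0 (axis a 1) (axis b 1)" for a b :: 'n
  have eq: "fpartial a (low \<Gamma> b c f) - fpartial b (low \<Gamma> a c f) + quad \<Gamma> a f b c - quad \<Gamma> b f a c
      = 2 * om a b * r c f + om a c * r b f + om a f * r b c - om b c * r a f - om b f * r a c" for a b c f
    using r0[of "axis a 1" "axis b 1" "axis c 1" "axis f 1"]
    unfolding curvature4_axis[OF \<Gamma>] fform_axis_axis k_def[symmetric]
    by (simp only: r_def) (simp add: algebra_simps)
  have "\<exists>a b. Om a b \<noteq> 0"
  proof (rule ccontr)
    assume "\<not> ?thesis"
    then show False using Om_P[of undefined undefined] by simp
  qed
  then obtain a b where ab: "Om a b \<noteq> 0" by blast
  have "r c f = r f c" for c f
  proof -
    have "quad \<Gamma> a f b c - quad \<Gamma> b f a c = quad \<Gamma> a c b f - quad \<Gamma> b c a f"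
      using quad_anti[of \<Gamma> a f b c] quad_anti[of \<Gamma> b f a c] by simp
    then have "2 * om a b * r c f + om a c * r b f + om a f * r b c - om b c * r a f - om b f * r a c
        = 2 * om a b * r f c + om a f * r b c + om a c * r b f - om b f * r a c - om b c * r a f"
      unfolding eq[symmetric] by (simp add: low_sym(2)[OF \<Gamma>, of _ c f] add_diff_eq[symmetric])
    then have "2 * om a b * r c f = 2 * om a b * r f c" by simp
    then have "kap (2 * Om a b) * r c f = kap (2 * Om a b) * r f c" by (simp add: kap_mult)
    then show ?thesis by (rule kap_cancel[rotated]) (use ab in simp)
  qed
  then show thesis using eq by (rule that)
qed

text \<open>The quadratic part of the curvature determines, and is determined by, the products
  \<open>A(X) A(Y)\<close>; the Ricci-type condition therefore fixes these products, and associativity of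
  \<open>A(W) A(X) A(Y)\<close> then annihilates the Ricci tensor.\<close>

lemma quad_eq_0:
  assumes \<Gamma>: "sym_low \<Gamma>" and N: "CARD('n) > 2" and rs: "\<And>a b. r a b = r b a"
    and R: "\<And>a b c f. quad \<Gamma> a f b c - quad \<Gamma> b f a c
      = 2 * om a b * r c f + om a c * r b f + om a f * r b c - om b c * r a f - om b f * r a c"
  shows "quad \<Gamma> x z y t = 0"
proof -
  let ?N = "real CARD('n)"
  note ls = low_sym[OF \<Gamma>]
  have gs: "\<Gamma> a b c = \<Gamma> b a c" for a b c by (rule sym_low_sym[OF \<Gamma>])
  have F1: "quad \<Gamma> a f b c = quad \<Gamma> f a b c" for a f b c by (simp only: quad_def ls(1)[of a f])
  have F2: "quad \<Gamma> a f b c = quad \<Gamma> a f c b" for a f b c by (simp only: quad_def gs[of b c])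
  \<comment> \<open>Four instances of \<open>R\<close>, chosen so that the other products cancel in
    pairs and four times the wanted one is left.\<close>
  have F: "quad \<Gamma> x z y t = om x y * r z t + om x t * r z y + om z y * r x t + om z t * r x y" for x z y t
  proof -
    have 1: "quad \<Gamma> x t y z + quad \<Gamma> x z y t = 2 * om x y * r z t + om x z * r y t + om x t * r y z - om y z * r x t - om y t * r x z"
      using R[of x t y z] quad_anti[of \<Gamma> y t x z] by simp
    have 2: "quad \<Gamma> x y t z + quad \<Gamma> x z y t = 2 * om x t * r z y + om x z * r t y + om x y * r t z - om t z * r x y - om t y * r x z"
      using R[of x y t z] quad_anti[of \<Gamma> t y x z] F2[of x z t y] by simp
    have 3: "- quad \<Gamma> x y t z + quad \<Gamma> x z y t = 2 * om z y * r x t + om z x * r y t + om z t * r y x - om y x * r z t - om y t * r z x"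
      using R[of z t y x] quad_anti[of \<Gamma> y t z x] quad_anti[of \<Gamma> z t y x] F1[of z x y t] F1[of y x z t] F2[of x y z t] by simp
    have 4: "- quad \<Gamma> x t y z + quad \<Gamma> x z y t = 2 * om z t * r x y + om z x * r t y + om z y * r t x - om t x * r z y - om t y * r z x"
      using R[of z y t x] quad_anti[of \<Gamma> t y z x] quad_anti[of \<Gamma> z y t x] F1[of z x t y] F2[of x z t y] F1[of t x z y] F2[of x t z y] by simp
    have "4 * quad \<Gamma> x z y t = (quad \<Gamma> x t y z + quad \<Gamma> x z y t) + (quad \<Gamma> x y t z + quad \<Gamma> x z y t)
        + (- quad \<Gamma> x y t z + quad \<Gamma> x z y t) + (- quad \<Gamma> x t y z + quad \<Gamma> x z y t)" by simp
    also have "\<dots> = 4 * (om x y * r z t + om x t * r z y + om z y * r x t + om z t * r x y)"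
      unfolding 1 2 3 4 rs[of y t] rs[of z t] rs[of y z] rs[of z x] rs[of t x] rs[of y x]
        kOm_anti[of y z] kOm_anti[of t z] kOm_anti[of t y] kOm_anti[of z x] kOm_anti[of y x] kOm_anti[of t x]
      by (simp add: algebra_simps)
    finally have "kap 4 * quad \<Gamma> x z y t = kap 4 * (om x y * r z t + om x t * r z y + om z y * r x t + om z t * r x y)"
      by simp
    then show ?thesis by (rule kap_cancel[rotated]) simp
  qed
  \<comment> \<open>In invariant terms \<open>r(A(w) t, z)\<close>.\<close>
  define T where "T w t z = (\<Sum>g\<in>UNIV. \<Gamma> w t g * r g z)" for w t z
  have Ts: "T w t z = T t w z" for w t z by (simp only: T_def gs[of w t])
  have lo: "(\<Sum>g\<in>UNIV. \<Gamma> w t g * om y g) = - low \<Gamma> w t y" for w t y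
    unfolding low_def sum_negf[symmetric] by (intro sum.cong refl) (subst kOm_anti, simp)
  define LH where "LH y z w t x = om y x * T w t z - low \<Gamma> w t y * r z x + om z x * T w t y - low \<Gamma> w t z * r y x"
    for y z w t x
  have LH: "(\<Sum>g\<in>UNIV. \<Gamma> w t g * quad \<Gamma> y z x g) = LH y z w t x" for w t y z x
  proof -
    have "(\<Sum>g\<in>UNIV. \<Gamma> w t g * quad \<Gamma> y z x g) = (\<Sum>g\<in>UNIV. om y x * (\<Gamma> w t g * r g z) + (\<Gamma> w t g * om y g) * r z x
       + om z x * (\<Gamma> w t g * r g y) + (\<Gamma> w t g * om z g) * r y x)"
      unfolding F by (intro sum.cong refl) (simp only: rs[of z] rs[of y], simp add: algebra_simps)
    also have "\<dots> = om y x * T w t z + - low \<Gamma> w t y * r z x + om z x * T w t y + - low \<Gamma> w t z * r y x"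
      by (simp only: sum.distrib sum_distrib_left[symmetric] sum_distrib_right[symmetric] lo T_def[symmetric])
    finally show ?thesis by (simp add: LH_def)
  qed
  \<comment> \<open>Associativity: up to sign the contraction is \<open>low \<Gamma> x\<close>
    evaluated on the vectors \<open>A(w) t\<close> and \<open>A(y) z\<close>, hence symmetric in
    them.\<close>
  have LH_sym: "LH y z w t x = LH w t y z x" for y z w t x
  proof -
    have H: "(\<Sum>g\<in>UNIV. \<Gamma> w t g * quad \<Gamma> y z x g) = - (\<Sum>g\<in>UNIV. \<Sum>e\<in>UNIV. low \<Gamma> x g e * (\<Gamma> w t g * \<Gamma> y z e))" for w t y z
      by (subst quad_anti) (simp add: quad_def sum_negf sum_distrib_left mult_ac)
    have "(\<Sum>g\<in>UNIV. \<Sum>e\<in>UNIV. low \<Gamma> x g e * (\<Gamma> w t g * \<Gamma> y z e)) = (\<Sum>e\<in>UNIV. \<Sum>g\<in>UNIV. low \<Gamma> x e g * (\<Gamma> y z e * \<Gamma> w t g))"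
      by (subst sum.swap, intro sum.cong refl) (subst ls(2), simp add: mult_ac)
    then show ?thesis unfolding LH[symmetric] H by simp
  qed
  have pl: "(\<Sum>t\<in>UNIV. pv x t * low \<Gamma> w y t) = - \<Gamma> w y x" for x w y
    by (subst (3) low_raise) (simp add: kP_anti[of x] sum_negf)
  have cl: "ctr (\<lambda>t x. low \<Gamma> w y t * g x) = - (\<Sum>x\<in>UNIV. \<Gamma> w y x * g x)" for w y g
  proof -
    have "ctr (\<lambda>t x. low \<Gamma> w y t * g x) = (\<Sum>x\<in>UNIV. (\<Sum>t\<in>UNIV. pv x t * low \<Gamma> w y t) * g x)"
      by (simp add: ctr_def sum_distrib_right mult.assoc)
    then show ?thesis by (simp add: pl sum_negf)
  qed
  have c1: "ctr (\<lambda>t x. LH y z w t x) = 2 * T w y z + 2 * T w z y" for y z w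
  proof -
    have "ctr (\<lambda>t x. low \<Gamma> w t y * r z x) = - T w y z" for y z
      unfolding ls(2)[of w _ y] cl by (simp only: T_def rs[of z])
    then show ?thesis
      unfolding LH_def ctr_add ctr_diff ctr_o4 by simp
  qed
  have c2: "ctr (\<lambda>t x. LH w t y z x) = kap (?N + 2) * T y z w" for y z w
  proof -
    have "ctr (\<lambda>t x. low \<Gamma> y z w * r t x) = 0" unfolding ctr_mult by (simp add: ctr_sym[of r] rs)
    moreover have "ctr (\<lambda>t x. low \<Gamma> y z t * r w x) = - T y z w" unfolding cl by (simp only: T_def rs[of w])
    moreover have "ctr (\<lambda>t x. om t x * T y z w) = kap ?N * T y z w"
      using ctr_mult[of "T y z w" "\<lambda>t x. om t x"] by (simp add: ctr_o mult.commute)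
    ultimately show ?thesis
      unfolding LH_def ctr_add ctr_diff ctr_o4 by (simp add: kap_add algebra_simps)
  qed
  \<comment> \<open>Trace of both sides of \<open>LH_sym\<close> over \<open>t\<close> and
    \<open>x\<close>.\<close>
  have T1: "2 * T w y z + 2 * T w z y = kap (?N + 2) * T y z w" for w y z
  proof -
    have "ctr (\<lambda>t x. LH y z w t x) = ctr (\<lambda>t x. LH w t y z x)"
      by (rule arg_cong[of _ _ ctr]) (intro ext LH_sym)
    then show ?thesis by (simp only: c1 c2)
  qed
  \<comment> \<open>From three cyclic instances of \<open>T1\<close>: differences of cyclic values
    are killed by the dimension plus four, and the common value by the dimension minus two.\<close>
  have T0: "T w y z = 0" for w y z
  proof -
    have i: "2 * T w y z + 2 * T z w y = kap (?N + 2) * T y z w" using T1[of w y z] by (simp only: Ts[of w z])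
    have ii: "2 * T y z w + 2 * T w y z = kap (?N + 2) * T z w y" using T1[of y z w] by (simp only: Ts[of y w])
    have iii: "2 * T z w y + 2 * T y z w = kap (?N + 2) * T w y z" using T1[of z w y] by (simp only: Ts[of z y])
    have n4: "kap (?N + 4) = kap (?N + 2) + 2" by (simp add: kap_add)
    have "kap (?N + 4) * (T y z w - T w y z) = (kap (?N + 2) * T y z w) - (kap (?N + 2) * T w y z) + 2 * T y z w - 2 * T w y z"
      by (simp add: n4 algebra_simps)
    also have "\<dots> = 0" unfolding i[symmetric] iii[symmetric] by simp
    finally have "T y z w - T w y z = 0" by (rule kap_mult_eq_0) simp
    then have a: "T y z w = T w y z" by simp
    have "kap (?N + 4) * (T z w y - T w y z) = (kap (?N + 2) * T z w y) - (kap (?N + 2) * T w y z) + 2 * T z w y - 2 * T w y z"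
      by (simp add: n4 algebra_simps)
    also have "\<dots> = 0" unfolding ii[symmetric] iii[symmetric] by simp
    finally have "T z w y - T w y z = 0" by (rule kap_mult_eq_0) simp
    then have b: "T z w y = T w y z" by simp
    have n2: "kap (?N - 2) = kap (?N + 2) - 4" by (simp add: kap_diff kap_add)
    have "kap (?N - 2) * T w y z = kap (?N + 2) * T w y z - 4 * T w y z" by (simp add: n2 algebra_simps)
    also have "\<dots> = 0" unfolding iii[symmetric] a b by simp
    finally show ?thesis by (rule kap_mult_eq_0) (use N in simp)
  qed
  \<comment> \<open>\<open>q\<close> is \<open>r\<close> with an index raised, and \<open>R2\<close>
    is the square of the Ricci endomorphism with its index lowered.\<close>
  define q where "q u t = (\<Sum>s\<in>UNIV. r u s * pv s t)" for u t
  define R2 where "R2 u z = (\<Sum>t\<in>UNIV. q u t * r t z)" for u z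
  \<comment> \<open>Contracting a product with \<open>q\<close> produces \<open>T\<close>, which is
    zero. The same contraction of the right side of \<open>F\<close> gives the identity
    \<open>six\<close> between \<open>R2\<close> and products of \<open>r\<close>.\<close>
  have qF: "(\<Sum>t\<in>UNIV. q u t * quad \<Gamma> x z y t) = 0" for u x z y
  proof -
    have "(\<Sum>t\<in>UNIV. q u t * low \<Gamma> y t e) = - T y e u" for e
    proof -
      have "(\<Sum>t\<in>UNIV. q u t * low \<Gamma> y t e) = (\<Sum>s\<in>UNIV. r u s * (\<Sum>t\<in>UNIV. pv s t * low \<Gamma> y e t))"
        unfolding q_def sum_distrib_left sum_distrib_right
        by (subst sum.swap) (simp only: ls(2)[of y _ e] mult_ac)
      then show ?thesis by (simp add: pl T_def sum_negf rs[of u] mult.commute)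
    qed
    then have 0: "(\<Sum>t\<in>UNIV. q u t * low \<Gamma> y t e) = 0" for e by (simp add: T0)
    have "(\<Sum>t\<in>UNIV. q u t * quad \<Gamma> x z y t) = - (\<Sum>t\<in>UNIV. \<Sum>e\<in>UNIV. q u t * low \<Gamma> y t e * \<Gamma> x z e)"
      by (subst quad_anti) (simp add: quad_def sum_negf sum_distrib_left mult.assoc)
    also have "\<dots> = - (\<Sum>e\<in>UNIV. (\<Sum>t\<in>UNIV. q u t * low \<Gamma> y t e) * \<Gamma> x z e)"
      unfolding sum_distrib_right by (subst sum.swap) simp
    finally show ?thesis by (simp add: 0)
  qed
  have qo: "(\<Sum>t\<in>UNIV. q u t * om x t) = - r u x" for u x
  proof -
    have "(\<Sum>t\<in>UNIV. q u t * om x t) = (\<Sum>s\<in>UNIV. r u s * (\<Sum>t\<in>UNIV. pv s t * om x t))"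
      unfolding q_def sum_distrib_left sum_distrib_right by (subst sum.swap) (simp only: mult_ac)
    also have "\<dots> = - (\<Sum>s\<in>UNIV. r u s * (\<Sum>t\<in>UNIV. pv s t * om t x))"
      unfolding sum_negf[symmetric] by (simp add: kOm_anti[of x] sum_negf)
    finally show ?thesis by (simp add: kP_Om)
  qed
  have six: "om x y * R2 u z - r u x * r z y + om z y * R2 u x - r u z * r x y = 0" for x y z u
  proof -
    have "(\<Sum>t\<in>UNIV. q u t * quad \<Gamma> x z y t) = (\<Sum>t\<in>UNIV. om x y * (q u t * r t z) + (q u t * om x t) * r z y
        + om z y * (q u t * r t x) + (q u t * om z t) * r x y)"
      unfolding F by (intro sum.cong refl) (simp only: rs[of z] rs[of x], simp add: algebra_simps)
    also have "\<dots> = om x y * R2 u z - r u x * r z y + om z y * R2 u x - r u z * r x y"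
      by (simp only: sum.distrib sum_distrib_left[symmetric] sum_distrib_right[symmetric] qo R2_def[symmetric])
        (simp add: rs[of z y] rs[of x y])
    finally show ?thesis by (simp add: qF)
  qed
  have R2': "R2 u z = ctr (\<lambda>x y. r u y * r x z)" for u z
    unfolding R2_def q_def ctr_def sum_distrib_right
    by (subst sum.swap) (simp add: mult_ac)
  have anti: "R2 z u = - R2 u z" for z u
  proof -
    have "(\<lambda>x y. r z y * r x u) = (\<lambda>x y. r u x * r y z)"
      by (intro ext) (simp only: rs[of _ u] rs[of z] mult.commute)
    then show ?thesis using ctr_swap[of "\<lambda>x y. r u y * r x z"] by (simp add: R2')
  qed
  \<comment> \<open>The trace of \<open>six\<close> over \<open>x\<close> and \<open>y\<close> is
    the dimension plus two, times \<open>R2\<close>; the antisymmetry of \<open>R2\<close> fixes the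
    sign of the second term.\<close>
  have R20: "R2 u z = 0" for u z
  proof -
    have "ctr (\<lambda>x y. om x y * R2 u z - r u x * r z y + om z y * R2 u x - r u z * r x y) = 0"
      unfolding six by (rule ctr_0)
    moreover have "ctr (\<lambda>x y. om x y * R2 u z) = kap ?N * R2 u z"
      using ctr_mult[of "R2 u z" "\<lambda>t x. om t x"] by (simp add: ctr_o mult.commute)
    moreover have "ctr (\<lambda>x y. r u x * r z y) = - R2 u z"
    proof -
      have "(\<lambda>x y. r u x * r z y) = (\<lambda>x y. r z y * r x u)"
        by (intro ext) (simp only: rs[of u], rule mult.commute)
      then have "ctr (\<lambda>x y. r u x * r z y) = R2 z u" unfolding R2' by (rule arg_cong)
      then show ?thesis by (simp only: anti[of z u])
    qed
    moreover have "ctr (\<lambda>x y. r u z * r x y) = 0" unfolding ctr_mult by (simp add: ctr_sym[of r] rs)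
    ultimately have "kap (?N + 2) * R2 u z = 0"
      unfolding ctr_add ctr_diff ctr_o4 by (simp add: kap_add algebra_simps)
    then show ?thesis by (rule kap_mult_eq_0) simp
  qed
  \<comment> \<open>With \<open>R2\<close> gone, the instance of \<open>six\<close> with
    \<open>u = y\<close> and \<open>z = x\<close> is a multiple of a square, and the ring is
    reduced.\<close>
  have r0: "r x y = 0" for x y
  proof -
    have "r y x * r x y + r y x * r x y = 0" using six[of x y y x] by (simp add: R20)
    then have "kap 2 * (r x y * r x y) = 0" by (simp add: rs[of y x])
    then have "r x y * r x y = 0" by (rule kap_mult_eq_0) simp
    then show ?thesis by (rule ffun_reduced)
  qed
  show ?thesis by (simp add: F r0)
qed

text \<open>An overdetermined system of finite type: prolonging it twice makes all derivatives constant, hence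
  zero on the torus.\<close>

lemma closed_ricci_curvature_const:
  assumes N: "CARD('n) > 2" and rs: "\<And>a b. r a b = r b a"
    and cyc: "\<And>u x y z t.
      fpartial u (2 * om x y * r z t + om x z * r y t + om x t * r y z - om y z * r x t - om y t * r x z)
      + fpartial x (2 * om y u * r z t + om y z * r u t + om y t * r u z - om u z * r y t - om u t * r y z)
      + fpartial y (2 * om u x * r z t + om u z * r x t + om u t * r x z - om x z * r u t - om x t * r u z) = 0"
  shows "fpartial u (r z t) = 0"
proof -
  let ?N = "real CARD('n)"
  define d where "d u z t = fpartial u (r z t)" for u z t
  have ds: "d u z t = d u t z" for u z t by (simp only: d_def rs[of z t])
  define v where "v z = ctr (\<lambda>x y. d x y z)" for z
  have two: "fpartial u 2 = 0" for u :: 'n using fpartial_kap[of u 2] by simp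
  \<comment> \<open>Trace of the cyclic identity over \<open>x\<close> and \<open>y\<close>;
    \<open>v\<close> is the divergence of \<open>r\<close>.\<close>
  have 1: "kap ?N * d u z t - d z u t - d t u z = om u z * v t + om u t * v z" for u z t
  proof -
    have "ctr (\<lambda>x y. (2 * (om x y * d u z t) + om x z * d u y t + om x t * d u y z - om y z * d u x t - om y t * d u x z)
      + (2 * (om y u * d x z t) + om y z * d x u t + om y t * d x u z - om u z * d x y t - om u t * d x y z)
      + (2 * (om u x * d y z t) + om u z * d y x t + om u t * d y x z - om x z * d y u t - om x t * d y u z)) = 0"
    proof -
      have "(2 * (om x y * d u z t) + om x z * d u y t + om x t * d u y z - om y z * d u x t - om y t * d u x z)
      + (2 * (om y u * d x z t) + om y z * d x u t + om y t * d x u z - om u z * d x y t - om u t * d x y z)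
      + (2 * (om u x * d y z t) + om u z * d y x t + om u t * d y x z - om x z * d y u t - om x t * d y u z) = 0" for x y
        using cyc[of u x y z t] by (simp add: two d_def mult.assoc)
      then show ?thesis by (simp only: ctr_0)
    qed
    moreover have "ctr (\<lambda>x y. om x y * d u z t) = kap ?N * d u z t"
      using ctr_mult[of "d u z t" "\<lambda>t x. om t x"] by (simp add: ctr_o mult.commute)
    moreover have "ctr (\<lambda>x y. d y x t) = - v t" for t
      using ctr_swap[of "\<lambda>x y. d x y t"] by (simp add: v_def)
    ultimately have "2 * (kap ?N * d u z t - d z u t - d t u z) = 2 * (om u z * v t + om u t * v z)"
      unfolding ctr_add ctr_diff ctr_mult ctr_o1 ctr_o2 ctr_o3 ctr_o4
      by (simp add: v_def[symmetric] ds[of u t z] algebra_simps)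
    then have "kap 2 * (kap ?N * d u z t - d z u t - d t u z) = kap 2 * (om u z * v t + om u t * v z)" by simp
    then show ?thesis by (rule kap_cancel[rotated]) simp
  qed
  \<comment> \<open>Summed cyclically in \<open>u\<close>, \<open>z\<close>, \<open>t\<close>, the
    right sides of \<open>1\<close> cancel and the left sides give the dimension minus two times the
    cyclic sum of \<open>d\<close>. That sum is therefore zero, and \<open>1\<close> then expresses
    every derivative of \<open>r\<close> through \<open>v\<close>.\<close>
  have 2: "kap (?N + 1) * d u z t = om u z * v t + om u t * v z" for u z t
  proof -
    have k: "kap ?N = 2 + kap (?N - 2)" using kap_add[of 2 "?N - 2"] by simp
    have "kap (?N - 2) * (d u z t + d z u t + d t u z)
        = (kap ?N * d u z t - d z u t - d t u z) + (kap ?N * d z t u - d t z u - d u z t)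
          + (kap ?N * d t u z - d u t z - d z t u)"
      unfolding k ds[of z t u] ds[of t z u] ds[of u t z] by (simp add: algebra_simps)
    also have "\<dots> = 0"
      unfolding 1 kOm_anti[of z u] kOm_anti[of t u] kOm_anti[of t z] by simp
    finally have "d u z t + d z u t + d t u z = 0" by (rule kap_mult_eq_0) (use N in simp)
    moreover have "kap ?N * d u z t - d z u t - d t u z = kap ?N * d u z t + d u z t - (d u z t + d z u t + d t u z)"
      by (simp add: algebra_simps)
    ultimately have "kap ?N * d u z t - d z u t - d t u z = kap ?N * d u z t + d u z t"
      by (simp only: diff_0_right)
    then show ?thesis using 1[of u z t] by (simp add: kap_add distrib_right)
  qed
  define e where "e x t = fpartial x (v t)" for x t
  define \<phi> where "\<phi> = ctr e"
  \<comment> \<open>Second derivatives of \<open>r\<close> commute. Traced in \<open>4\<close>, this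
    leaves a single unknown function \<open>\<phi>\<close>.\<close>
  have 3: "om u z * e x t + om u t * e x z = om x z * e u t + om x t * e u z" for u z t x
  proof -
    have "fpartial x (kap (?N + 1) * d u z t) = fpartial u (kap (?N + 1) * d x z t)"
      by (simp add: d_def fpartial_commute)
    then show ?thesis unfolding 2 by (simp add: e_def)
  qed
  have 4: "kap ?N * e x t = om x t * \<phi>" for x t
  proof -
    have "ctr (\<lambda>u z. om u z * e x t + om u t * e x z) = ctr (\<lambda>u z. om x z * e u t + om x t * e u z)"
      by (simp only: 3)
    moreover have "ctr (\<lambda>u z. om u z * e x t) = kap ?N * e x t"
      using ctr_mult[of "e x t" "\<lambda>t x. om t x"] by (simp add: ctr_o mult.commute)
    ultimately show ?thesis unfolding ctr_add ctr_o1 ctr_o4 ctr_mult by (simp add: \<phi>_def)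
  qed
  \<comment> \<open>The same for second derivatives of \<open>v\<close>; the trace in
    \<open>6\<close> makes \<open>\<phi>\<close> constant.\<close>
  have 5: "om x t * fpartial y \<phi> = om y t * fpartial x \<phi>" for x y t
  proof -
    have "fpartial y (kap ?N * e x t) = fpartial x (kap ?N * e y t)"
      by (simp add: e_def fpartial_commute)
    then show ?thesis unfolding 4 by simp
  qed
  have 6: "fpartial y \<phi> = 0" for y
  proof -
    have "ctr (\<lambda>x t. om x t * fpartial y \<phi>) = ctr (\<lambda>x t. om y t * fpartial x \<phi>)" by (simp only: 5)
    moreover have "ctr (\<lambda>x t. om x t * fpartial y \<phi>) = kap ?N * fpartial y \<phi>"
      using ctr_mult[of "fpartial y \<phi>" "\<lambda>t x. om t x"] by (simp add: ctr_o mult.commute)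
    ultimately have "kap ?N * fpartial y \<phi> = fpartial y \<phi>" unfolding ctr_o4 by simp
    then have "kap (?N - 1) * fpartial y \<phi> = 0"
      by (simp add: kap_diff left_diff_distrib)
    then show ?thesis by (rule kap_mult_eq_0) (use N in simp)
  qed
  have N0: "?N \<noteq> 0" "?N + 1 \<noteq> 0" by simp_all
  \<comment> \<open>Going back up: \<open>e\<close> has zero derivatives, hence is constant, and
    being itself a derivative on the torus it vanishes. The same argument then applies to
    \<open>d\<close>.\<close>
  have "kap ?N * fpartial y (e x t) = fpartial y (kap ?N * e x t)" for x y t by simp
  then have "kap ?N * fpartial y (e x t) = 0" for x y t unfolding 4 by (simp add: 6)
  then have "fpartial y (e x t) = 0" for x y t by (rule kap_mult_eq_0[OF _ N0(1)])
  then have e0: "fpartial x (v t) = 0" for x t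
    unfolding e_def by (rule fpartial_eq_0_if_const)
  have "kap (?N + 1) * fpartial y (d u z t) = fpartial y (kap (?N + 1) * d u z t)" for y u z t by simp
  then have "kap (?N + 1) * fpartial y (d u z t) = 0" for y u z t unfolding 2 by (simp add: e0)
  then have "fpartial y (d u z t) = 0" for y u z t by (rule kap_mult_eq_0[OF _ N0(2)])
  then show ?thesis unfolding d_def by (rule fpartial_eq_0_if_const)
qed

end

section \<open>Invariant tensors\<close>

text \<open>Elements of \<open>\<real>[[t]]\<close>; by \<open>fcst_lift\<close> these are the
  formal functions with vanishing coordinate derivatives.\<close>

definition fcst :: "(nat \<Rightarrow> real) \<Rightarrow> ('n::finite) ffun" where
  "fcst c = Abs_fps (\<lambda>k. of_real (c k))"

lemma nth_fcst [simp]: "fps_nth (fcst c) k = of_real (c k)"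
  by (simp add: fcst_def)
lemma fpartial_fcst [simp]: "fpartial a (fcst c) = 0"
  by (simp add: fps_eq_iff)

lemma fcst_lift:
  assumes "\<And>a. fpartial a F = 0" shows "F = fcst (\<lambda>k. lift (fps_nth F k) 0)"
proof (rule fps_ext)
  fix k
  have "const_fun (fps_nth F k)" using assms unfolding const_fun_def fps_eq_iff by simp
  then obtain c where "fps_nth F k = of_real c" by (rule const_funE)
  then show "fps_nth F k = fps_nth (fcst (\<lambda>k. lift (fps_nth F k) 0)) k" by simp
qed

lemma of_real_smfun_eq_iff [simp]: "(of_real c :: ('n::finite) smfun) = of_real d \<longleftrightarrow> c = d"
  using lift_of_real[of c 0] lift_of_real[of d 0] by metis

definition mat_comp :: "(real^'n \<Rightarrow> (real^'n^'n) fps) \<Rightarrow> 'n \<Rightarrow> 'n \<Rightarrow> 'n \<Rightarrow> nat \<Rightarrow> real" where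
  "mat_comp A a b c k = (fps_nth (A (axis a 1)) k *v axis b 1) $ c"

lemma vec_basis: "(\<Sum>a\<in>UNIV. x $ a *\<^sub>R axis a 1) = (x :: real^'n::finite)"
  by (simp add: vec_eq_iff axis_def if_distrib[where f="\<lambda>x. _ * x"] cong: if_cong)

lemma mat_comp:
  fixes A :: "real^'n \<Rightarrow> (real^'n^'n::finite) fps"
  assumes "\<And>k. linear (\<lambda>x. fps_nth (A x) k)"
  shows "(fps_nth (A x) k *v y) $ c = (\<Sum>a\<in>UNIV. \<Sum>b\<in>UNIV. x $ a * (y $ b * mat_comp A a b c k))"
proof -
  have "linear (\<lambda>x. fps_nth (A x) k *v y)" for y
    using assms[of k] by (auto simp: linear_iff matrix_vector_mult_add_rdistrib scaleR_matrix_vector_assoc)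
  note L = this
  have 1: "fps_nth (A x) k *v y = (\<Sum>a\<in>UNIV. x $ a *\<^sub>R (fps_nth (A (axis a 1)) k *v y))" for y
    using linear_sum[OF L, of "\<lambda>a. x $ a *\<^sub>R axis a 1" UNIV y]
    by (simp only: vec_basis linear_scale[OF L])
  have 2: "fps_nth (A (axis a 1)) k *v y = (\<Sum>b\<in>UNIV. y $ b *\<^sub>R (fps_nth (A (axis a 1)) k *v axis b 1))" for a
    by (subst vec_basis[of y, symmetric])
      (simp only: linear_sum[OF matrix_vector_mul_linear] linear_scale[OF matrix_vector_mul_linear])
  show ?thesis
    unfolding 1[of y] by (subst 2) (simp add: mat_comp_def sum_distrib_left)
qed

lemma mat_entry: "M $ c $ b = (M *v axis b 1) $ c" for M :: "real^'n^'m::finite"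
  by (simp add: matrix_vector_mult_def axis_def if_distrib[where f="\<lambda>x. _ * x"] cong: if_cong)

context constant_symplectic
begin

definition chr :: "(real^'n \<Rightarrow> (real^'n^'n) fps) \<Rightarrow> 'n \<Rightarrow> 'n \<Rightarrow> 'n \<Rightarrow> 'n ffun" where
  "chr A a b c = fcst (mat_comp A a b c)"

lemma linear_form: "linear_form w x y = (\<Sum>a\<in>UNIV. \<Sum>b\<in>UNIV. Om a b * x $ a * y $ b)"
proof -
  have "Rep_smfun (of_real c :: 'n smfun) (proj 0) = c" for c using lift_of_real[of c "0 :: real^'n"] by (simp only: lift_def)
  then show ?thesis by (simp add: linear_form_def form_at_def bil_def w)
qed

lemma linear_form_anti: "linear_form w x y = - linear_form w y x"
proof -
  have "linear_form w x y = (\<Sum>b\<in>UNIV. \<Sum>a\<in>UNIV. Om a b * x $ a * y $ b)"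
    unfolding linear_form by (rule sum.swap)
  also have "\<dots> = (\<Sum>b\<in>UNIV. \<Sum>a\<in>UNIV. - (Om b a * y $ b * x $ a))"
    by (intro sum.cong refl) (subst Om_anti, simp)
  finally show ?thesis by (simp add: linear_form sum_negf)
qed

lemma linear_form_axis: "linear_form w x (axis c 1) = (\<Sum>a\<in>UNIV. Om a c * x $ a)"
  by (simp add: linear_form axis_def if_distrib[where f="\<lambda>x. _ * x"] cong: if_cong)

lemma low_chr: "fps_nth (low (chr A) a b c) k = of_real (linear_form w (fps_nth (A (axis a 1)) k *v axis b 1) (axis c 1))"
  by (simp add: low_def chr_def fps_sum_nth linear_form_axis mat_comp_def)

lemma linear_curvesD:
  assumes "A \<in> linear_curves w"
  shows "linear (\<lambda>x. fps_nth (A x) k)" "fps_nth (A x) 0 = 0"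
    "(\<Sum>i\<le>m. fps_nth (A x) i ** fps_nth (A y) (m - i)) = 0"
    "fps_nth (A x) k *v y = fps_nth (A y) k *v x"
    "linear_form w (fps_nth (A x) k *v y) z = - linear_form w y (fps_nth (A x) k *v z)"
  using assms by (auto simp: linear_curves_def sp_def eq_neg_iff_add_eq_0)

lemma flat_plus_curve:
  assumes "A \<in> linear_curves w" shows "flat_plus A = curve (chr A)"
proof (rule fps_ext)
  fix k
  show "fps_nth (flat_plus A) k = fps_nth (curve (chr A)) k"
    by (intro ext)
      (simp add: flat_plus_def curve_nth invariant_tensor_def chr_def mat_comp_def mult.assoc)
qed

lemma admissible_chr:
  assumes "A \<in> linear_curves w" shows "admissible (chr A)"
proof -
  note L = linear_curvesD[OF assms]
  have "linear_form w (fps_nth (A (axis a 1)) k *v axis b 1) (axis c 1)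
      = linear_form w (fps_nth (A (axis a 1)) k *v axis c 1) (axis b 1)" for a b c k
    unfolding L(5)[of _ _ "axis b 1"] by (subst linear_form_anti) simp
  then have "sym_low (chr A)"
    unfolding sym_low_def fps_eq_iff low_chr by (simp add: L(4)[of "axis _ 1" _ "axis _ 1"])
  then show ?thesis by (simp add: admissible_def chr_def mat_comp_def L(2))
qed

lemma chr_product:
  "fps_nth (\<Sum>e\<in>UNIV. chr A a e d * chr A b c e) m
    = of_real ((\<Sum>i\<le>m. fps_nth (A (axis a 1)) i ** fps_nth (A (axis b 1)) (m - i)) $ d $ c)"
proof -
  have "fps_nth (\<Sum>e\<in>UNIV. chr A a e d * chr A b c e) m
      = (\<Sum>e\<in>UNIV. \<Sum>i\<le>m. of_real (fps_nth (A (axis a 1)) i $ d $ e * fps_nth (A (axis b 1)) (m - i) $ e $ c))"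
    by (simp add: fps_sum_nth fps_mult_nth chr_def mat_comp_def mat_entry atLeast0AtMost)
  also have "\<dots> = of_real ((\<Sum>i\<le>m. fps_nth (A (axis a 1)) i ** fps_nth (A (axis b 1)) (m - i)) $ d $ c)"
    by (subst sum.swap) (simp add: matrix_matrix_mult_def)
  finally show ?thesis .
qed

text \<open>Split the connection into the flat part \<open>D\<close> and the tensor
  \<open>T\<close>. The flat part has no curvature, the mixed terms cancel because constant symbols
  make \<open>D\<close> a derivation of \<open>T\<close>, and the terms quadratic in
  \<open>T\<close> vanish by hypothesis.\<close>

lemma curvature_const_0:
  fixes \<Gamma> :: "'n \<Rightarrow> 'n \<Rightarrow> 'n \<Rightarrow> 'n ffun"
  assumes const: "\<And>a b c e. fpartial e (\<Gamma> a b c) = 0"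
    and prod: "\<And>a b c d. (\<Sum>e\<in>UNIV. \<Gamma> a e d * \<Gamma> b c e) = 0"
  shows "curvature (curve \<Gamma>) X Y Z = 0"
proof -
  define D where "D X Y = (\<chi> c. fvf_app X (Y $ c))" for X Y :: "'n fvfield"
  define T where "T X Y = (\<chi> c. \<Sum>a\<in>UNIV. \<Sum>b\<in>UNIV. \<Gamma> a b c * (X $ a * Y $ b))" for X Y :: "'n fvfield"
  have conn: "conn \<Gamma> X Y = D X Y + T X Y" for X Y by (simp add: conn_def D_def T_def vec_eq_iff)
  have fc: "fvf_app X (\<Gamma> a b c) = 0" for X a b c by (simp add: fvf_app_def const)
  have DT: "D X (T Y Z) = T (D X Y) Z + T Y (D X Z)" for X Y Z
    by (simp add: D_def T_def vec_eq_iff fc algebra_simps sum.distrib)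
  have TT: "T X (T Y Z) = 0" for X Y Z
  proof -
    have "T X (T Y Z) $ d = 0" for d
    proof -
      have "T X (T Y Z) $ d = (\<Sum>a\<in>UNIV. \<Sum>e\<in>UNIV. \<Sum>b\<in>UNIV. \<Sum>c\<in>UNIV. X $ a * (Y $ b * Z $ c) * (\<Gamma> a e d * \<Gamma> b c e))"
        by (simp add: T_def sum_distrib_left mult_ac)
      also have "\<dots> = (\<Sum>a\<in>UNIV. \<Sum>b\<in>UNIV. \<Sum>e\<in>UNIV. \<Sum>c\<in>UNIV. X $ a * (Y $ b * Z $ c) * (\<Gamma> a e d * \<Gamma> b c e))"
        by (rule sum.cong[OF refl], rule sum.swap)
      also have "\<dots> = (\<Sum>a\<in>UNIV. \<Sum>b\<in>UNIV. \<Sum>c\<in>UNIV. \<Sum>e\<in>UNIV. X $ a * (Y $ b * Z $ c) * (\<Gamma> a e d * \<Gamma> b c e))"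
        by (rule sum.cong[OF refl], rule sum.cong[OF refl], rule sum.swap)
      also have "\<dots> = 0" unfolding sum_distrib_left[symmetric] prod by simp
      finally show ?thesis .
    qed
    then show ?thesis by (simp add: vec_eq_iff)
  qed
  have add: "T (X + X') Y = T X Y + T X' Y" "T X (Y + Y') = T X Y + T X Y'" "T (X - X') Y = T X Y - T X' Y"
    "D X (Y + Y') = D X Y + D X Y'" for X X' Y Y'
    by (simp_all add: T_def D_def vec_eq_iff algebra_simps sum.distrib sum_subtractf)
  have br: "fvf_bracket X Y = D X Y - D Y X" by (simp add: fvf_bracket_def D_def vec_eq_iff)
  have DD: "D (fvf_bracket X Y) Z = D X (D Y Z) - D Y (D X Z)"
    by (simp add: D_def vec_eq_iff fvf_app_bracket)
  show ?thesis
    unfolding curvature_def curve_ext_curve conn DD br add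
    by (simp add: DT TT add DD[unfolded br])
qed

text \<open>The curvature is zero, so both sides of the Ricci-type identity are zero.\<close>

lemma flat_plus_ricci:
  assumes "A \<in> linear_curves w" shows "flat_plus A \<in> ricci_curves w"
proof -
  have "(\<Sum>e\<in>UNIV. chr A a e d * chr A b c e) = 0" for a b c d
    by (rule fps_ext) (simp only: chr_product linear_curvesD(3)[OF assms], simp)
  moreover have "fpartial e (chr A a b c) = 0" for a b c e by (simp add: chr_def)
  ultimately have "curvature (curve (chr A)) X Y Z = 0" for X Y Z
    by (intro curvature_const_0)
  then have "ricci_type w (curve (chr A))"
    by (simp add: ricci_type_def curvature4_def ricci_def)
  then show ?thesis
    unfolding ricci_curves_iff flat_plus_curve[OF assms] using admissible_chr[OF assms] by blast
qed

text \<open>With constant symbols the derivative terms of the curvature disappear and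
  \<open>quad_eq_0\<close> applies. The matrices of \<open>A\<close> are read off from the values of
  the symbols at one point.\<close>

lemma const_ricci_flat_plus:
  assumes N: "CARD('n) > 2" and \<Gamma>: "admissible \<Gamma>" and R: "wricci (curve \<Gamma>)"
    and const: "\<And>a b c e. fpartial e (\<Gamma> a b c) = 0"
  obtains A where "A \<in> linear_curves w" "curve \<Gamma> = flat_plus A"
proof -
  have s: "sym_low \<Gamma>" using \<Gamma> by (simp add: admissible_def)
  have low0: "fpartial e (low \<Gamma> a b c) = 0" for a b c e by (simp add: low_def const)
  obtain r where r: "\<And>a b. r a b = r b a"
    "\<And>a b c f. quad \<Gamma> a f b c - quad \<Gamma> b f a c
      = 2 * om a b * r c f + om a c * r b f + om a f * r b c - om b c * r a f - om b f * r a c"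
    by (rule wricciD[OF R s]) (auto simp: low0)
  have FF0: "quad \<Gamma> a f b c = 0" for a f b c by (rule quad_eq_0[OF s N r])
  \<comment> \<open>Raising the free index turns the vanishing of \<open>quad\<close> into the
    vanishing of matrix products.\<close>
  have prod: "(\<Sum>e\<in>UNIV. \<Gamma> a e d * \<Gamma> b c e) = 0" for a b c d
  proof -
    have "(\<Sum>e\<in>UNIV. \<Gamma> a e d * \<Gamma> b c e) = (\<Sum>e\<in>UNIV. \<Sum>f\<in>UNIV. pv f d * (low \<Gamma> a f e * \<Gamma> b c e))"
      by (subst low_raise) (simp add: sum_distrib_right mult.assoc low_sym(2)[OF s, of a])
    also have "\<dots> = (\<Sum>f\<in>UNIV. pv f d * quad \<Gamma> a f b c)"
      unfolding quad_def sum_distrib_left by (rule sum.swap)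
    finally show ?thesis by (simp add: FF0)
  qed
  define g where "g a b c k = lift (fps_nth (\<Gamma> a b c) k) 0" for a b c k
  have g: "\<Gamma> a b c = fcst (g a b c)" for a b c
    unfolding g_def[abs_def] by (rule fcst_lift[OF const])
  define A where "A x = Abs_fps (\<lambda>k. \<chi> c b. \<Sum>a\<in>UNIV. x $ a * g a b c k)" for x :: "real^'n"
  have ent: "fps_nth (A x) k $ c $ b = (\<Sum>a\<in>UNIV. x $ a * g a b c k)" for x k c b
    by (simp add: A_def)
  have app: "(fps_nth (A x) k *v y) $ c = (\<Sum>a\<in>UNIV. \<Sum>b\<in>UNIV. x $ a * (y $ b * g a b c k))" for x k y c
    unfolding matrix_vector_mult_def vec_lambda_beta ent sum_distrib_right
    by (subst sum.swap) (simp add: mult_ac)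
  have mc: "mat_comp A a b c k = g a b c k" for a b c k
    unfolding mat_comp_def mat_entry[symmetric] ent by simp
  have chr: "chr A = \<Gamma>" by (intro ext) (simp add: chr_def mc[abs_def] g[symmetric])
  have gs: "g a b c k = g b a c k" for a b c k by (simp add: g_def sym_low_sym[OF s, of a b])
  have "A \<in> linear_curves w"
    unfolding linear_curves_def
  proof (intro CollectI conjI allI)
    show lin: "linear (\<lambda>x. fps_nth (A x) k)" for k
      by (rule linearI) (simp_all add: vec_eq_iff ent distrib_right sum.distrib sum_distrib_left mult.assoc)
    have "linear_form w (fps_nth (A x) k *v y) z
        = (\<Sum>a\<in>UNIV. \<Sum>b\<in>UNIV. \<Sum>c\<in>UNIV. (\<Sum>d\<in>UNIV. Om d c * g a b d k) * (x $ a * (y $ b * z $ c)))" for x y z k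
    proof -
      have "linear_form w (fps_nth (A x) k *v y) z
        = (\<Sum>d\<in>UNIV. \<Sum>c\<in>UNIV. \<Sum>a\<in>UNIV. \<Sum>b\<in>UNIV. Om d c * (g a b d k * (x $ a * (y $ b * z $ c))))"
        by (simp add: linear_form app sum_distrib_left sum_distrib_right mult_ac)
      also have "\<dots> = (\<Sum>c\<in>UNIV. \<Sum>d\<in>UNIV. \<Sum>a\<in>UNIV. \<Sum>b\<in>UNIV. Om d c * (g a b d k * (x $ a * (y $ b * z $ c))))"
        by (rule sum.swap)
      also have "\<dots> = (\<Sum>c\<in>UNIV. \<Sum>a\<in>UNIV. \<Sum>d\<in>UNIV. \<Sum>b\<in>UNIV. Om d c * (g a b d k * (x $ a * (y $ b * z $ c))))"
        by (rule sum.cong[OF refl], rule sum.swap)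
      also have "\<dots> = (\<Sum>c\<in>UNIV. \<Sum>a\<in>UNIV. \<Sum>b\<in>UNIV. \<Sum>d\<in>UNIV. Om d c * (g a b d k * (x $ a * (y $ b * z $ c))))"
        by (rule sum.cong[OF refl], rule sum.cong[OF refl], rule sum.swap)
      also have "\<dots> = (\<Sum>a\<in>UNIV. \<Sum>c\<in>UNIV. \<Sum>b\<in>UNIV. \<Sum>d\<in>UNIV. Om d c * (g a b d k * (x $ a * (y $ b * z $ c))))"
        by (rule sum.swap)
      also have "\<dots> = (\<Sum>a\<in>UNIV. \<Sum>b\<in>UNIV. \<Sum>c\<in>UNIV. \<Sum>d\<in>UNIV. Om d c * (g a b d k * (x $ a * (y $ b * z $ c))))"
        by (rule sum.cong[OF refl], rule sum.swap)
      finally show ?thesis by (simp add: sum_distrib_right mult.assoc)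
    qed
    moreover have ls: "(\<Sum>d\<in>UNIV. Om d c * g a b d k) = (\<Sum>d\<in>UNIV. Om d b * g a c d k)" for a b c k
    proof -
      have "fps_nth (low \<Gamma> a b c) k = of_real (\<Sum>d\<in>UNIV. Om d c * g a b d k)" for a b c
        by (simp add: low_def fps_sum_nth g)
      then show ?thesis using low_sym(2)[OF s, of a b c] of_real_smfun_eq_iff by metis
    qed
    ultimately have "linear_form w (fps_nth (A x) k *v y) z = linear_form w (fps_nth (A x) k *v z) y" for x y z k
      by (simp only:) (rule sum.cong[OF refl], subst sum.swap, simp only: ls[of _ _ _ k] mult_ac)
    \<comment> \<open>Symmetry of the lowered tensor in its last two slots, combined with
      antisymmetry of the form, is the infinitesimally symplectic condition.\<close>
    then show "fps_nth (A x) k \<in> sp w" for x k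
      unfolding sp_def by (subst linear_form_anti[of _ "_ *v _"]) simp
    show "fps_nth (A x) 0 = 0" for x
      using \<Gamma> by (simp add: vec_eq_iff ent g_def admissible_def)
    show "fps_nth (A x) k *v y = fps_nth (A y) k *v x" for x y k
    proof -
      have "(\<Sum>a\<in>UNIV. \<Sum>b\<in>UNIV. x $ a * (y $ b * g a b c k)) = (\<Sum>b\<in>UNIV. \<Sum>a\<in>UNIV. y $ b * (x $ a * g b a c k))" for c
        by (subst sum.swap) (simp add: gs[of _ _ c k] mult.left_commute)
      then show ?thesis unfolding vec_eq_iff app by blast
    qed
    show "(\<Sum>i\<le>m. fps_nth (A x) i ** fps_nth (A y) (m - i)) = 0" for x y m
    proof -
      have 0: "(\<Sum>i\<le>m. fps_nth (A (axis a 1)) i ** fps_nth (A (axis b 1)) (m - i)) $ d $ c = 0" for a b c d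
      proof -
        have "(of_real 0 :: 'n smfun) = of_real ((\<Sum>i\<le>m. fps_nth (A (axis a 1)) i ** fps_nth (A (axis b 1)) (m - i)) $ d $ c)"
          using chr_product[of A a d b c m] unfolding chr prod by (simp only: fps_zero_nth of_real_0)
        then show ?thesis by (simp only: of_real_smfun_eq_iff)
      qed
      have "(\<Sum>i\<le>m. fps_nth (A x) i ** fps_nth (A y) (m - i)) $ d $ c = 0" for c d
      proof -
        have "(\<Sum>i\<le>m. fps_nth (A x) i ** fps_nth (A y) (m - i)) $ d $ c
            = (\<Sum>i\<le>m. \<Sum>e\<in>UNIV. \<Sum>a\<in>UNIV. \<Sum>b\<in>UNIV. x $ a * y $ b * (g a e d i * g b c e (m - i)))"
          by (simp add: matrix_matrix_mult_def ent sum_product mult_ac)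
        also have "\<dots> = (\<Sum>i\<le>m. \<Sum>a\<in>UNIV. \<Sum>e\<in>UNIV. \<Sum>b\<in>UNIV. x $ a * y $ b * (g a e d i * g b c e (m - i)))"
          by (rule sum.cong[OF refl], rule sum.swap)
        also have "\<dots> = (\<Sum>a\<in>UNIV. \<Sum>i\<le>m. \<Sum>b\<in>UNIV. \<Sum>e\<in>UNIV. x $ a * y $ b * (g a e d i * g b c e (m - i)))"
          by (subst sum.swap, rule sum.cong[OF refl], rule sum.cong[OF refl], rule sum.swap)
        also have "\<dots> = (\<Sum>a\<in>UNIV. \<Sum>b\<in>UNIV. \<Sum>i\<le>m. \<Sum>e\<in>UNIV. x $ a * y $ b * (g a e d i * g b c e (m - i)))"
          by (rule sum.cong[OF refl], rule sum.swap)
        also have "\<dots> = (\<Sum>a\<in>UNIV. \<Sum>b\<in>UNIV. x $ a * y $ b *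
            (\<Sum>i\<le>m. fps_nth (A (axis a 1)) i ** fps_nth (A (axis b 1)) (m - i)) $ d $ c)"
          by (simp add: matrix_matrix_mult_def ent sum_distrib_left)
        also have "\<dots> = 0" by (simp only: 0 mult_zero_right sum.neutral_const)
        finally show ?thesis .
      qed
      then show ?thesis by (simp only: vec_eq_iff zero_index) simp
    qed
  qed
  moreover from this have "curve \<Gamma> = flat_plus A" by (simp only: flat_plus_curve chr)
  ultimately show thesis by (rule that)
qed

end

section \<open>Integral symplectic matrices\<close>

lemma matrix_inv_eqI:
  fixes B C :: "real^'n^'n::finite"
  assumes "C ** B = mat 1" shows "matrix_inv C = B"
proof -
  have BC: "B ** C = mat 1" using assms by (simp only: matrix_left_right_inverse)
  have "C ** matrix_inv C = mat 1 \<and> matrix_inv C ** C = mat 1"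
    unfolding matrix_inv_def by (rule someI[of _ B]) (simp add: assms BC)
  then have "matrix_inv C = matrix_inv C ** (C ** B)" "matrix_inv C ** C = mat 1" by (simp_all add: assms)
  then show ?thesis by (simp add: matrix_mul_assoc)
qed

lemma bilinear_eq_axis:
  fixes f g :: "real^'n::finite \<Rightarrow> real^'n \<Rightarrow> 'b::euclidean_space"
  assumes "bilinear f" "bilinear g" "\<And>a b. f (axis a 1) (axis b 1) = g (axis a 1) (axis b 1)"
  shows "f x y = g x y"
  by (rule fun_cong[OF fun_cong[OF bilinear_eq_stdbasis[OF assms(1,2)]]])
    (auto simp: Basis_vec_def assms(3))

lemma linear_matrix_vector_left: "linear (\<lambda>M. M *v y)" for y :: "real^'n::finite"
  by (rule linearI) (simp_all add: matrix_vector_mult_add_rdistrib scaleR_matrix_vector_assoc)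

lemma bilinear_curve:
  fixes A :: "real^'n \<Rightarrow> (real^'n^'n::finite) fps" and B M :: "real^'n^'n"
  assumes "\<And>k. linear (\<lambda>x. fps_nth (A x) k)"
  shows "bilinear (\<lambda>x y. M *v (fps_nth (A (B *v x)) k *v (B *v y)))"
proof -
  have "linear (\<lambda>y. M *v (fps_nth (A (B *v x)) k *v (B *v y)))" for x
    using linear_compose[OF matrix_vector_mul_linear[of B]
        linear_compose[OF matrix_vector_mul_linear[of "fps_nth (A (B *v x)) k"] matrix_vector_mul_linear[of M]]]
    by (simp add: comp_def)
  moreover have "linear (\<lambda>x. M *v (fps_nth (A (B *v x)) k *v (B *v y)))" for y
    using linear_compose[OF matrix_vector_mul_linear[of B]
        linear_compose[OF assms[of k] linear_compose[OF linear_matrix_vector_left[of "B *v y"] matrix_vector_mul_linear[of M]]]]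
    by (simp add: comp_def)
  ultimately show ?thesis by (simp add: bilinear_def)
qed

text \<open>The action becomes an intertwining relation with \<open>B\<close>, the inverse of
  \<open>C\<close>: the form in which the transformation law of Christoffel symbols delivers
  it.\<close>

lemma Sp_act_iff:
  fixes B C :: "real^'n^'n::finite"
  assumes "C ** B = mat 1"
  shows "A' = Sp_act C A \<longleftrightarrow>
    (\<forall>x y k. B *v (fps_nth (A' x) k *v y) = fps_nth (A (B *v x)) k *v (B *v y))"
proof -
  have BC: "B ** C = mat 1" using assms by (simp only: matrix_left_right_inverse)
  have "fps_nth (A' x) k = C ** fps_nth (A (B *v x)) k ** B \<longleftrightarrow>
      (\<forall>y. B *v (fps_nth (A' x) k *v y) = fps_nth (A (B *v x)) k *v (B *v y))" for x k
  proof
    assume "fps_nth (A' x) k = C ** fps_nth (A (B *v x)) k ** B"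
    then have "B ** fps_nth (A' x) k = (B ** C) ** fps_nth (A (B *v x)) k ** B"
      by (simp only: matrix_mul_assoc)
    then show "\<forall>y. B *v (fps_nth (A' x) k *v y) = fps_nth (A (B *v x)) k *v (B *v y)"
      by (simp add: BC matrix_vector_mul_assoc)
  next
    assume "\<forall>y. B *v (fps_nth (A' x) k *v y) = fps_nth (A (B *v x)) k *v (B *v y)"
    then have "B ** fps_nth (A' x) k = fps_nth (A (B *v x)) k ** B"
      by (simp add: matrix_eq matrix_vector_mul_assoc)
    then have "(C ** B) ** fps_nth (A' x) k = C ** fps_nth (A (B *v x)) k ** B"
      by (simp only: matrix_mul_assoc[symmetric])
    then show "fps_nth (A' x) k = C ** fps_nth (A (B *v x)) k ** B" by (simp add: assms)
  qed
  then show ?thesis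
    by (simp add: Sp_act_def fun_eq_iff fps_eq_iff matrix_inv_eqI[OF assms]) blast
qed

lemma int_matrix_lattice:
  fixes B :: "real^'n^'n::finite"
  shows "(\<forall>a b. B $ a $ b \<in> \<int>) \<longleftrightarrow> (\<forall>z\<in>int_lattice. B *v z \<in> int_lattice)"
proof
  assume "\<forall>a b. B $ a $ b \<in> \<int>"
  then show "\<forall>z\<in>int_lattice. B *v z \<in> int_lattice"
    by (auto simp: int_lattice_def matrix_vector_mult_def intro!: Ints_sum Ints_mult)
next
  assume "\<forall>z\<in>int_lattice. B *v z \<in> int_lattice"
  then have "B *v axis b 1 \<in> int_lattice" for b using axis_int_lattice by blast
  then show "\<forall>a b. B $ a $ b \<in> \<int>" unfolding mat_entry by (simp add: int_lattice_def)
qed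

lemma Ck_compose_linear:
  fixes f :: "'b::real_normed_vector \<Rightarrow> real" and L :: "'a::real_normed_vector \<Rightarrow> 'b"
  assumes L: "bounded_linear L" shows "Ck k f \<Longrightarrow> Ck k (\<lambda>x. f (L x))"
proof (induction k arbitrary: f)
  case 0
  then show ?case
    using continuous_on_compose2[of UNIV f UNIV L] linear_continuous_on[OF L] by simp
next
  case (Suc k)
  have "((\<lambda>x. f (L x)) has_derivative (\<lambda>v. frechet_derivative f (at (L x)) (L v))) (at x)" for x
    using has_derivative_compose[OF bounded_linear_imp_has_derivative[OF L], of f "frechet_derivative f (at (L x))" x] Suc.prems
    by (simp add: frechet_derivative_works)
  note D = this
  have "frechet_derivative (\<lambda>x. f (L x)) (at x) = (\<lambda>v. frechet_derivative f (at (L x)) (L v))" for x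
    by (rule frechet_derivative_at[OF D, symmetric])
  moreover have "Ck k (\<lambda>x. frechet_derivative f (at (L x)) (L v))" for v
    using Suc.IH[of "\<lambda>y. frechet_derivative f (at y) (L v)"] Suc.prems by simp
  moreover have "(\<lambda>x. f (L x)) differentiable (at x)" for x
    using D unfolding differentiable_def by blast
  ultimately show ?case by (simp only: Ck.simps) simp
qed

text \<open>The choice is meaningful for integer matrices, since these preserve the lattice; see
  \<open>lift_pullback\<close>.\<close>

definition pullback :: "real^'n^'n \<Rightarrow> ('n::finite) smfun \<Rightarrow> 'n smfun" where
  "pullback B f = (SOME g. lift g = (\<lambda>x. lift f (B *v x)))"

lemma lift_pullback:
  assumes "\<And>a b. B $ a $ b \<in> \<int>" shows "lift (pullback B f) x = lift f (B *v x)"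
proof -
  have "smooth (\<lambda>x. lift f (B *v x))"
    using smooth_lift[of f] Ck_compose_linear[OF matrix_vector_mul_bounded_linear[of B], of _ "lift f"]
    by (simp add: smooth_def)
  moreover have "lift f (B *v (x + z)) = lift f (B *v x)" if "z \<in> int_lattice" for x z
    using assms int_matrix_lattice[of B] that by (simp add: matrix_vector_right_distrib lift_periodic)
  ultimately obtain g where "lift g = (\<lambda>x. lift f (B *v x))" by (rule ex_lift)
  then have "lift (pullback B f) = (\<lambda>x. lift f (B *v x))" unfolding pullback_def by (rule someI)
  then show ?thesis by simp
qed

lemma partial_pullback:
  assumes B: "\<And>a b. B $ a $ b \<in> \<int>"
  shows "partial d (pullback B f) = (\<Sum>a\<in>UNIV. of_real (B $ a $ d) * pullback B (partial a f))"
proof (rule partial_unique[where p="\<lambda>d. \<Sum>a\<in>UNIV. of_real (B $ a $ d) * pullback B (partial a f)"])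
  fix x
  have "((\<lambda>x. lift f (B *v x)) has_derivative (\<lambda>v. \<Sum>a\<in>UNIV. (B *v v) $ a * lift (partial a f) (B *v x))) (at x)"
    by (rule has_derivative_compose[OF bounded_linear_imp_has_derivative[OF matrix_vector_mul_bounded_linear] has_derivative_lift])
  moreover have "(\<lambda>x. lift f (B *v x)) = lift (pullback B f)" by (simp add: fun_eq_iff lift_pullback[OF B])
  moreover have "(\<Sum>a\<in>UNIV. (B *v v) $ a * lift (partial a f) (B *v x))
      = (\<Sum>d\<in>UNIV. v $ d * lift (\<Sum>a\<in>UNIV. of_real (B $ a $ d) * pullback B (partial a f)) x)" for v
    unfolding matrix_vector_mult_def[of B v] vec_lambda_beta sum_distrib_right lift_sum sum_distrib_left
    by (subst sum.swap) (simp add: lift_pullback[OF B] mult_ac)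
  ultimately show "(lift (pullback B f) has_derivative
      (\<lambda>v. \<Sum>d\<in>UNIV. v $ d * lift (\<Sum>a\<in>UNIV. of_real (B $ a $ d) * pullback B (partial a f)) x)) (at x)"
    by simp
qed

text \<open>A function \<open>v + i u\<close> of modulus one with logarithmic derivative \<open>2 \<pi> i k\<close> in a coordinate direction
  is periodic only if \<open>k\<close> is an integer.\<close>

lemma frequency_integral:
  fixes u v :: "'n::finite smfun"
  assumes u: "partial d u = of_real (2 * pi * k) * v" and v: "partial d v = - (of_real (2 * pi * k) * u)"
    and uv: "u * u + v * v = 1"
  shows "k \<in> \<int>"
proof -
  define \<theta> where "\<theta> = 2 * pi * k"
  define U where "U s = lift u (0 + s *\<^sub>R axis d 1)" for s
  define V where "V s = lift v (0 + s *\<^sub>R axis d 1)" for s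
  have dU: "(U has_real_derivative \<theta> * V s) (at s)" and dV: "(V has_real_derivative - (\<theta> * U s)) (at s)" for s
    using DERIV_lift[of u 0 d s] DERIV_lift[of v 0 d s]
    unfolding u v U_def[abs_def] V_def[abs_def] \<theta>_def[symmetric] by simp_all
  have dc: "((\<lambda>s. cos (\<theta> * s)) has_real_derivative - (\<theta> * sin (\<theta> * s))) (at s)"
    and ds: "((\<lambda>s. sin (\<theta> * s)) has_real_derivative \<theta> * cos (\<theta> * s)) (at s)" for s
    by (auto intro!: derivative_eq_intros)
  \<comment> \<open>This expression and its companion below are the real and imaginary parts of
    \<open>V + i U\<close> rotated back by the angle \<open>\<theta> * s\<close>, so both are
    constant.\<close>
  have "((\<lambda>s. V s * cos (\<theta> * s) + U s * sin (\<theta> * s)) has_real_derivative 0) (at s)" for s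
    by (rule DERIV_cong[OF DERIV_add[OF DERIV_mult[OF dV dc] DERIV_mult[OF dU ds]]]) (simp add: algebra_simps)
  from DERIV_isconst_all[of "\<lambda>s. V s * cos (\<theta> * s) + U s * sin (\<theta> * s)" 1 0] this
  have 1: "V 1 * cos \<theta> + U 1 * sin \<theta> = V 0" by simp
  have "((\<lambda>s. U s * cos (\<theta> * s) - V s * sin (\<theta> * s)) has_real_derivative 0) (at s)" for s
    by (rule DERIV_cong[OF DERIV_diff[OF DERIV_mult[OF dU dc] DERIV_mult[OF dV ds]]]) (simp add: algebra_simps)
  from DERIV_isconst_all[of "\<lambda>s. U s * cos (\<theta> * s) - V s * sin (\<theta> * s)" 1 0] this
  have 2: "U 1 * cos \<theta> - V 1 * sin \<theta> = U 0" by simp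
  have p: "U 1 = U 0" "V 1 = V 0"
    using lift_periodic[OF axis_int_lattice, of u 0 d] lift_periodic[OF axis_int_lattice, of v 0 d]
    by (simp_all add: U_def V_def)
  have n: "U 0 * U 0 + V 0 * V 0 = 1"
    using arg_cong[OF uv, of "\<lambda>f. lift f 0"] by (simp add: U_def V_def)
  \<comment> \<open>By periodicity the values at \<open>1\<close> and \<open>0\<close> agree; since
    the modulus is one, rotation by \<open>\<theta>\<close> must be trivial.\<close>
  have "cos \<theta> = (U 0 * U 0 + V 0 * V 0) * cos \<theta>" by (simp add: n)
  also have "\<dots> = V 0 * (V 0 * cos \<theta> + U 0 * sin \<theta>) + U 0 * (U 0 * cos \<theta> - V 0 * sin \<theta>)"
    by (simp add: algebra_simps)
  also have "\<dots> = 1" using 1 2 n unfolding p by simp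
  finally obtain m :: int where "\<theta> = real_of_int m * 2 * pi" unfolding cos_one_2pi_int by blast
  then have "k = m" by (simp add: \<theta>_def)
  then show ?thesis by simp
qed

context constant_symplectic
begin

text \<open>By definition \<open>\<Psi>\<close> fixes \<open>kap c\<close> and \<open>fps_X\<close>.
  The formula of \<open>symplecto_ext\<close>, which holds for \<open>\<Psi>\<close> by
  \<open>ext_unique\<close>, extends this to infinite series.\<close>

lemma fauto_fcst:
  assumes "fauto \<Psi>" shows "\<Psi> (fcst c) = fcst c"
proof (rule fps_ext)
  fix m
  have "\<Psi> (fcst c) = symplecto_ext (\<lambda>f. \<Psi> (fps_const f)) (fcst c)"
    by (simp only: symplecto_curve_fauto(2)[OF assms])
  then have "fps_nth (\<Psi> (fcst c)) m = (\<Sum>i\<le>m. fps_nth (kap (c i)) (m - i))"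
    using fautoD(4)[OF assms] by (simp add: symplecto_ext_def kap_def)
  also have "\<dots> = (\<Sum>i\<le>m. if i = m then of_real (c i) else 0)"
    by (rule sum.cong) (auto simp: kap_def)
  finally show "fps_nth (\<Psi> (fcst c)) m = fps_nth (fcst c) m" by simp
qed

lemma jac_eqI:
  assumes \<Psi>: "fauto \<Psi>" and M: "\<And>F. fpartial d (\<Psi> F) = (\<Sum>a\<in>UNIV. M a * \<Psi> (fpartial a F))"
  shows "jac \<Psi> d a = M a"
proof -
  note D = fautoD[OF \<Psi>]
  have s: "fpartial d (\<Psi> (fsin a)) = kap (2 * pi) * (M a * \<Psi> (fcos a))"
    unfolding M by (simp add: fpartial_fsin if_distrib[where f=\<Psi>] if_distrib[where f="\<lambda>x. _ * x"] D mult_ac cong: if_cong)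
  have c: "fpartial d (\<Psi> (fcos a)) = - (kap (2 * pi) * (M a * \<Psi> (fsin a)))"
    unfolding M by (simp add: fpartial_fcos if_distrib[where f=\<Psi>] if_distrib[where f="\<lambda>x. _ * x"] D mult_ac cong: if_cong)
  have "\<Psi> (fcos a) * fpartial d (\<Psi> (fsin a)) - \<Psi> (fsin a) * fpartial d (\<Psi> (fcos a))
      = kap (2 * pi) * M a * \<Psi> (fcos a * fcos a + fsin a * fsin a)"
    unfolding s c by (simp add: D algebra_simps)
  then show ?thesis by (simp add: jac_def fcos_fsin D flip: mult.assoc kap_mult)
qed

text \<open>A constant Jacobian removes the derivative term from \<open>conn_act_iff\<close>, and
  \<open>\<Psi>\<close> fixes the constant symbols, so the transformation law becomes the
  intertwining relation of \<open>Sp_act_iff\<close>.\<close>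

lemma const_jac_iff:
  assumes \<Psi>: "fauto \<Psi>" and jac: "\<And>d a. jac \<Psi> d a = kap (B $ a $ d)"
    and A: "A \<in> linear_curves w" and A': "A' \<in> linear_curves w"
  shows "conn_act \<Psi> (conn (chr A)) = conn (chr A') \<longleftrightarrow>
    (\<forall>x y k. B *v (fps_nth (A' x) k *v y) = fps_nth (A (B *v x)) k *v (B *v y))"
proof -
  have sym: "sym_low (chr A)" using admissible_chr[OF A] by (simp add: admissible_def)
  have fixed: "\<Psi> (chr A d e f) = chr A d e f" for d e f
    unfolding chr_def by (rule fauto_fcst[OF \<Psi>])
  have l: "fps_nth (\<Sum>c\<in>UNIV. chr A' a b c * kap (B $ f $ c)) k
      = of_real ((B *v (fps_nth (A' (axis a 1)) k *v axis b 1)) $ f)" for a b f k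
    unfolding fps_sum_nth mult.commute[of "chr _ _ _ _"]
    by (simp add: chr_def mat_comp_def matrix_vector_mult_def[of B])
  have r: "fps_nth (\<Sum>d\<in>UNIV. \<Sum>e\<in>UNIV. kap (B $ d $ a) * kap (B $ e $ b) * chr A d e f) k
      = of_real ((fps_nth (A (B *v axis a 1)) k *v (B *v axis b 1)) $ f)" for a b f k
    by (simp add: fps_sum_nth mult.assoc chr_def mat_comp[OF linear_curvesD(1)[OF A]] flip: mat_entry)
  have "conn_act \<Psi> (conn (chr A)) = conn (chr A') \<longleftrightarrow>
      (\<forall>a b f k. (B *v (fps_nth (A' (axis a 1)) k *v axis b 1)) $ f = (fps_nth (A (B *v axis a 1)) k *v (B *v axis b 1)) $ f)"
    unfolding conn_act_iff[OF \<Psi> sym] jac fpartial_kap add_0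
      fixed fps_eq_iff l r by simp
  also have "\<dots> \<longleftrightarrow> (\<forall>x y k. B *v (fps_nth (A' x) k *v y) = fps_nth (A (B *v x)) k *v (B *v y))"
  proof (intro iffI allI)
    fix x y k
    assume "\<forall>a b f k. (B *v (fps_nth (A' (axis a 1)) k *v axis b 1)) $ f = (fps_nth (A (B *v axis a 1)) k *v (B *v axis b 1)) $ f"
    then have e: "B *v (fps_nth (A' (axis a 1)) k *v axis b 1) = fps_nth (A (B *v axis a 1)) k *v (B *v axis b 1)" for a b
      by (simp add: vec_eq_iff)
    have b1: "bilinear (\<lambda>x y. B *v (fps_nth (A' x) k *v y))"
      using bilinear_curve[of A' B "mat 1" k, OF linear_curvesD(1)[OF A']] by simp
    have b2: "bilinear (\<lambda>x y. fps_nth (A (B *v x)) k *v (B *v y))"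
      using bilinear_curve[of A "mat 1" B k, OF linear_curvesD(1)[OF A]] by simp
    show "B *v (fps_nth (A' x) k *v y) = fps_nth (A (B *v x)) k *v (B *v y)"
      by (rule bilinear_eq_axis[OF b1 b2 e])
  qed simp
  finally show ?thesis .
qed

section \<open>Linear symplectic maps, their inverses and integrality\<close>

definition symp_mat :: "real^'n^'n \<Rightarrow> bool" where
  "symp_mat B \<longleftrightarrow> (\<forall>x y. linear_form w (B *v x) (B *v y) = linear_form w x y)"

lemma bilinear_linear_form: "bilinear (\<lambda>x y. linear_form w (B *v x) (B *v y))"
proof -
  have *: "linear_form w (x + x') y = linear_form w x y + linear_form w x' y"
    "linear_form w x (y + y') = linear_form w x y + linear_form w x y'"
    "linear_form w (c *\<^sub>R x) y = c * linear_form w x y" "linear_form w x (c *\<^sub>R y) = c * linear_form w x y" for x x' y y' c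
    by (simp_all add: linear_form algebra_simps sum.distrib sum_distrib_left)
  show ?thesis
    unfolding bilinear_def
    by (intro conjI allI linearI) (simp_all add: matrix_vector_right_distrib matrix_vector_mult_scaleR *)
qed

lemma symp_mat_axis:
  "symp_mat B \<longleftrightarrow> (\<forall>a b. (\<Sum>c\<in>UNIV. \<Sum>e\<in>UNIV. Om c e * B $ c $ a * B $ e $ b) = Om a b)"
proof -
  have 1: "linear_form w (B *v axis a 1) (B *v axis b 1) = (\<Sum>c\<in>UNIV. \<Sum>e\<in>UNIV. Om c e * B $ c $ a * B $ e $ b)" for a b
    by (simp add: linear_form flip: mat_entry)
  have 2: "linear_form w (axis a 1) (axis b 1) = Om a b" for a b
    by (simp only: linear_form_axis) (simp add: axis_def if_distrib[where f="\<lambda>x. _ * x"] cong: if_cong)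
  have b: "bilinear (\<lambda>x y. linear_form w x y)"
    using bilinear_linear_form[of "mat 1"] by simp
  show ?thesis
  proof
    assume "symp_mat B"
    then have "linear_form w (B *v axis a 1) (B *v axis b 1) = linear_form w (axis a 1) (axis b 1)" for a b
      by (simp only: symp_mat_def)
    then show "\<forall>a b. (\<Sum>c\<in>UNIV. \<Sum>e\<in>UNIV. Om c e * B $ c $ a * B $ e $ b) = Om a b"
      by (simp only: 1 2) blast
  next
    assume "\<forall>a b. (\<Sum>c\<in>UNIV. \<Sum>e\<in>UNIV. Om c e * B $ c $ a * B $ e $ b) = Om a b"
    then have "linear_form w (B *v axis a 1) (B *v axis b 1) = linear_form w (axis a 1) (axis b 1)" for a b
      by (simp only: 1 2)
    from bilinear_eq_axis[OF bilinear_linear_form b this] show "symp_mat B"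
      unfolding symp_mat_def by blast
  qed
qed

text \<open>Write \<open>W\<close> and \<open>Q\<close> for the matrices of \<open>Om\<close> and
  \<open>P\<close>. From \<open>B\<^sup>T W B = W\<close> the inverse of \<open>B\<close> is
  \<open>Q B\<^sup>T W\<close>, and rearranging gives \<open>B Q B\<^sup>T = Q\<close>, the
  invariance of the Poisson tensor.\<close>

lemma symp_mat_inverse:
  assumes "symp_mat B"
  obtains C where "C ** B = mat 1" "B ** C = mat 1" "symp_mat C"
    "\<And>a b. (\<Sum>c\<in>UNIV. \<Sum>e\<in>UNIV. P c e * B $ a $ c * B $ b $ e) = P a b"
proof -
  define W where "W = (\<chi> a b. Om a b)"
  define Q where "Q = (\<chi> a b. P a b)"
  have OQ: "W ** Q = mat 1" "Q ** W = mat 1"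
    by (simp_all add: vec_eq_iff W_def Q_def matrix_matrix_mult_def Om_P P_Om mat_def)
  have "transpose B ** W ** B = W"
  proof -
    have "(transpose B ** W ** B) $ a $ b = W $ a $ b" for a b
    proof -
      have "(transpose B ** W ** B) $ a $ b = (\<Sum>e\<in>UNIV. \<Sum>c\<in>UNIV. Om c e * B $ c $ a * B $ e $ b)"
        by (simp add: matrix_matrix_mult_def transpose_def W_def sum_distrib_left sum_distrib_right mult_ac)
      also have "\<dots> = (\<Sum>c\<in>UNIV. \<Sum>e\<in>UNIV. Om c e * B $ c $ a * B $ e $ b)" by (rule sum.swap)
      also have "\<dots> = W $ a $ b" using assms unfolding symp_mat_axis by (simp add: W_def)
      finally show ?thesis .
    qed
    then show ?thesis by (simp add: vec_eq_iff)
  qed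
  then have "(Q ** transpose B ** W) ** B = Q ** W" by (simp only: matrix_mul_assoc[symmetric])
  then have C1: "(Q ** transpose B ** W) ** B = mat 1" by (simp add: OQ)
  then have C2: "B ** (Q ** transpose B ** W) = mat 1" by (simp only: matrix_left_right_inverse)
  have "B ** Q ** transpose B = B ** (Q ** transpose B ** W) ** Q"
    by (simp only: matrix_mul_assoc[symmetric] OQ matrix_mul_rid)
  then have BQB: "B ** Q ** transpose B = Q" by (simp add: C2)
  have P: "(\<Sum>c\<in>UNIV. \<Sum>e\<in>UNIV. P c e * B $ a $ c * B $ b $ e) = P a b" for a b
  proof -
    have "P a b = (B ** Q ** transpose B) $ a $ b" unfolding BQB by (simp add: Q_def)
    also have "\<dots> = (\<Sum>e\<in>UNIV. \<Sum>c\<in>UNIV. P c e * B $ a $ c * B $ b $ e)"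
      by (simp add: matrix_matrix_mult_def transpose_def Q_def sum_distrib_left sum_distrib_right mult_ac)
    finally show ?thesis by (subst sum.swap) simp
  qed
  let ?C = "Q ** transpose B ** W"
  have "linear_form w (?C *v x) (?C *v y) = linear_form w (B *v (?C *v x)) (B *v (?C *v y))" for x y
    using assms by (simp only: symp_mat_def)
  then have "symp_mat ?C" by (simp add: symp_mat_def matrix_vector_mul_assoc C2)
  from that[OF C1 C2 this P] show thesis .
qed

lemma Sp_Z_iff:
  "C \<in> Sp_Z w \<longleftrightarrow> symp_mat C \<and> (\<exists>B. C ** B = mat 1 \<and> B ** C = mat 1 \<and>
    (\<forall>a b. C $ a $ b \<in> \<int>) \<and> (\<forall>a b. B $ a $ b \<in> \<int>))"
proof
  assume C: "C \<in> Sp_Z w"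
  then have s: "symp_mat C" and l: "(\<lambda>x. C *v x) ` int_lattice = int_lattice"
    by (simp_all add: Sp_Z_def symp_mat_def)
  obtain B where B: "B ** C = mat 1" "C ** B = mat 1" by (rule symp_mat_inverse[OF s]) (rule that)
  have "\<forall>z\<in>int_lattice. C *v z \<in> int_lattice" using l by blast
  moreover have "\<forall>z\<in>int_lattice. B *v z \<in> int_lattice"
  proof
    fix z :: "real^'n" assume "z \<in> int_lattice"
    then obtain y where y: "y \<in> int_lattice" "z = C *v y" using l by blast
    then show "B *v z \<in> int_lattice" by (simp add: matrix_vector_mul_assoc B)
  qed
  ultimately show "symp_mat C \<and> (\<exists>B. C ** B = mat 1 \<and> B ** C = mat 1 \<and>
    (\<forall>a b. C $ a $ b \<in> \<int>) \<and> (\<forall>a b. B $ a $ b \<in> \<int>))"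
    using s B unfolding int_matrix_lattice by blast
next
  assume "symp_mat C \<and> (\<exists>B. C ** B = mat 1 \<and> B ** C = mat 1 \<and>
    (\<forall>a b. C $ a $ b \<in> \<int>) \<and> (\<forall>a b. B $ a $ b \<in> \<int>))"
  then obtain B where s: "symp_mat C" and B: "C ** B = mat 1" "B ** C = mat 1"
    and C: "\<forall>z\<in>int_lattice. C *v z \<in> int_lattice" and Bz: "\<forall>z\<in>int_lattice. B *v z \<in> int_lattice"
    unfolding int_matrix_lattice by blast
  have "z \<in> (\<lambda>x. C *v x) ` int_lattice" if "z \<in> int_lattice" for z
    using Bz that by (intro image_eqI[of _ _ "B *v z"]) (simp_all add: matrix_vector_mul_assoc B)
  then have "(\<lambda>x. C *v x) ` int_lattice = int_lattice" using C by blast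
  with s show "C \<in> Sp_Z w" by (simp add: Sp_Z_def symp_mat_def)
qed

text \<open>Pulling functions back along \<open>x \<mapsto> B x\<close> pushes vector fields forward by \<open>B\<^sup>-\<^sup>1\<close>, so an
  element \<open>C\<close> of the symplectic group acts through \<open>B = C\<^sup>-\<^sup>1\<close>.\<close>

definition fpullback :: "real^'n^'n \<Rightarrow> 'n ffun \<Rightarrow> 'n ffun" where
  "fpullback B F = Abs_fps (\<lambda>k. pullback B (fps_nth F k))"

text \<open>Integrality of \<open>B\<close> and of its inverse makes pullback a bijection of the
  smooth functions. The bracket is respected because a symplectic matrix preserves \<open>P\<close>
  as well as \<open>Om\<close>.\<close>

lemma fauto_fpullback:
  assumes s: "symp_mat B" and B: "\<And>a b. B $ a $ b \<in> \<int>" and C: "\<And>a b. C $ a $ b \<in> \<int>"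
    and CB: "C ** B = mat 1"
  shows "fauto (fpullback B)" "jac (fpullback B) d a = kap (B $ a $ d)"
proof -
  let ?\<Psi> = "fpullback B"
  have BC: "B ** C = mat 1" using CB by (simp only: matrix_left_right_inverse)
  note l = lift_pullback[of B, OF B] and lC = lift_pullback[of C, OF C]
  have add: "pullback B (f + g) = pullback B f + pullback B g" for f g by (rule lift_ext) (simp add: l)
  have mult: "pullback B (f * g) = pullback B f * pullback B g" for f g by (rule lift_ext) (simp add: l)
  have of_real: "pullback B (of_real c) = of_real c" for c by (rule lift_ext) (simp add: l)
  have z: "pullback B 0 = 0" "pullback B 1 = 1" using of_real[of 0] of_real[of 1] by simp_all
  have sum: "pullback B (sum f S) = (\<Sum>x\<in>S. pullback B (f x))" for f and S :: "nat set"
    by (induction S rule: infinite_finite_induct) (simp_all add: add z)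
  have inv: "pullback C (pullback B f) = f" "pullback B (pullback C f) = f" for f
    by (rule lift_ext; simp add: l lC matrix_vector_mul_assoc BC CB)+
  have F_add: "?\<Psi> (F + G) = ?\<Psi> F + ?\<Psi> G" for F G by (simp add: fpullback_def fps_eq_iff add)
  have F_mult: "?\<Psi> (F * G) = ?\<Psi> F * ?\<Psi> G" for F G
    by (simp add: fpullback_def fps_eq_iff fps_mult_nth sum mult)
  have F_kap: "?\<Psi> (kap c) = kap c" for c by (simp add: fpullback_def fps_eq_iff kap_def of_real z)
  have F_X: "?\<Psi> fps_X = fps_X" by (simp add: fpullback_def fps_eq_iff fps_X_def z)
  have F_sum: "?\<Psi> (sum f S) = (\<Sum>x\<in>S. ?\<Psi> (f x))" for f and S :: "'n set"
    using F_kap[of 0] by (induction S rule: infinite_finite_induct) (simp_all add: F_add)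
  have d: "fpartial d (?\<Psi> F) = (\<Sum>a\<in>UNIV. kap (B $ a $ d) * ?\<Psi> (fpartial a F))" for d F
    by (simp add: fpullback_def fps_eq_iff partial_pullback[OF B] fps_sum_nth)
  have F_pois: "?\<Psi> (fpoisson w F G) = fpoisson w (?\<Psi> F) (?\<Psi> G)" for F G
  proof -
    have P: "(\<Sum>c\<in>UNIV. \<Sum>e\<in>UNIV. P c e * B $ a $ c * B $ b $ e) = P a b" for a b
      by (rule symp_mat_inverse[OF s])
    have kP: "(\<Sum>b\<in>UNIV. \<Sum>a\<in>UNIV. kap (P b a) * kap (B $ c $ b) * kap (B $ e $ a)) = kap (P c e)" for c e
      by (simp only: kap_mult[symmetric] kap_sum[symmetric] P)
    have "fpoisson w (?\<Psi> F) (?\<Psi> G) = (\<Sum>a\<in>UNIV. \<Sum>b\<in>UNIV. \<Sum>c\<in>UNIV. \<Sum>e\<in>UNIV.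
        (kap (P b a) * kap (B $ c $ b) * kap (B $ e $ a)) * (?\<Psi> (fpartial c F) * ?\<Psi> (fpartial e G)))"
      unfolding fpoisson_eq d sum_product by (simp add: sum_distrib_left mult_ac)
    also have "\<dots> = (\<Sum>b\<in>UNIV. \<Sum>a\<in>UNIV. \<Sum>c\<in>UNIV. \<Sum>e\<in>UNIV.
        (kap (P b a) * kap (B $ c $ b) * kap (B $ e $ a)) * (?\<Psi> (fpartial c F) * ?\<Psi> (fpartial e G)))"
      by (rule sum.swap)
    also have "\<dots> = (\<Sum>b\<in>UNIV. \<Sum>c\<in>UNIV. \<Sum>a\<in>UNIV. \<Sum>e\<in>UNIV.
        (kap (P b a) * kap (B $ c $ b) * kap (B $ e $ a)) * (?\<Psi> (fpartial c F) * ?\<Psi> (fpartial e G)))"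
      by (rule sum.cong[OF refl], rule sum.swap)
    also have "\<dots> = (\<Sum>c\<in>UNIV. \<Sum>b\<in>UNIV. \<Sum>e\<in>UNIV. \<Sum>a\<in>UNIV.
        (kap (P b a) * kap (B $ c $ b) * kap (B $ e $ a)) * (?\<Psi> (fpartial c F) * ?\<Psi> (fpartial e G)))"
      by (subst sum.swap, rule sum.cong[OF refl], rule sum.cong[OF refl], rule sum.swap)
    also have "\<dots> = (\<Sum>c\<in>UNIV. \<Sum>e\<in>UNIV. \<Sum>b\<in>UNIV. \<Sum>a\<in>UNIV.
        (kap (P b a) * kap (B $ c $ b) * kap (B $ e $ a)) * (?\<Psi> (fpartial c F) * ?\<Psi> (fpartial e G)))"
      by (rule sum.cong[OF refl], rule sum.swap)
    also have "\<dots> = (\<Sum>c\<in>UNIV. \<Sum>e\<in>UNIV. kap (P c e) * (?\<Psi> (fpartial c F) * ?\<Psi> (fpartial e G)))"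
      unfolding sum_distrib_right[symmetric] kP ..
    also have "\<dots> = ?\<Psi> (\<Sum>c\<in>UNIV. \<Sum>e\<in>UNIV. kap (P c e) * (fpartial c F * fpartial e G))"
      by (simp only: F_sum F_mult F_kap)
    also have "\<dots> = ?\<Psi> (fpoisson w F G)"
      unfolding fpoisson_eq by (rule arg_cong[of _ _ ?\<Psi>], rule sum.swap)
    finally show ?thesis by (rule sym)
  qed
  have "bij ?\<Psi>"
    by (rule bij_betw_byWitness[of _ "fpullback C"]) (auto simp: fpullback_def fps_eq_iff inv)
  then show "fauto ?\<Psi>"
    by (simp add: fauto_def F_add F_mult F_kap F_X F_pois)
  from jac_eqI[OF this d] show "jac ?\<Psi> d a = kap (B $ a $ d)" .
qed

end

section \<open>Rigidity of invariant tensors\<close>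

text \<open>As \<open>G\<close> has no constant term, order \<open>m\<close> of the product meets
  \<open>H\<close> only below order \<open>m\<close>.\<close>

lemma const_fun_product_nth:
  fixes G H :: "('n::finite) ffun"
  assumes "fps_nth G 0 = 0" "\<And>i. i < m \<Longrightarrow> const_fun (fps_nth G (Suc i))" "\<And>j. j < m \<Longrightarrow> const_fun (fps_nth H j)"
  shows "const_fun (fps_nth (G * H) m)"
  unfolding fps_mult_nth
proof (rule const_fun_sum)
  fix i assume i: "i \<in> {0..m}"
  show "const_fun (fps_nth G i * fps_nth H (m - i))"
  proof (cases i)
    case 0
    then show ?thesis by (simp add: assms(1))
  next
    case (Suc k)
    then show ?thesis using i assms by (intro const_fun_intros(6)) auto
  qed
qed

lemma const_fun_mult_nth:
  fixes G H :: "('n::finite) ffun"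
  assumes "\<And>i. i \<le> m \<Longrightarrow> const_fun (fps_nth G i)" "\<And>j. j \<le> m \<Longrightarrow> const_fun (fps_nth H j)"
  shows "const_fun (fps_nth (G * H) m)"
  unfolding fps_mult_nth by (rule const_fun_sum) (use assms in \<open>auto intro!: const_fun_intros(6)\<close>)

lemma kap_eq_iff: "kap c = (kap d :: ('n::finite) ffun) \<longleftrightarrow> c = d"
proof
  assume "kap c = (kap d :: 'n ffun)"
  then have "fps_nth (kap c :: 'n ffun) 0 = fps_nth (kap d) 0" by simp
  then show "c = d" by (simp add: kap_def)
qed simp

lemma sum_two_ends:
  fixes c :: "nat \<Rightarrow> real" and g :: "nat \<Rightarrow> ('n::finite) smfun"
  assumes "m \<ge> 1" "\<And>j. 1 \<le> j \<Longrightarrow> j < m \<Longrightarrow> c j = 0"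
  shows "(\<Sum>i\<in>{0..m}. of_real (c i) * g (m - i)) = of_real (c 0) * g m + of_real (c m) * g 0"
proof -
  have "(\<Sum>i\<in>{0..m}. of_real (c i) * g (m - i)) = (\<Sum>i\<in>{0, m}. of_real (c i) * g (m - i))"
  proof (rule sum.mono_neutral_right)
    show "\<forall>i\<in>{0..m} - {0, m}. of_real (c i) * g (m - i) = 0"
    proof
      fix i assume "i \<in> {0..m} - {0, m}"
      then have "c i = 0" using assms(2)[of i] by auto
      then show "of_real (c i) * g (m - i) = 0" by simp
    qed
  qed auto
  then show ?thesis using assms(1) by simp
qed

context constant_symplectic
begin

lemma conn_act_comp:
  assumes "fauto \<Psi>" "fauto \<Phi>" shows "conn_act (\<Psi> \<circ> \<Phi>) D = conn_act \<Psi> (conn_act \<Phi> D)"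
proof (intro ext)
  fix X Y
  have i: "inv (\<Psi> \<circ> \<Phi>) = inv \<Phi> \<circ> inv \<Psi>"
    by (rule o_inv_distrib[OF fautoD(1)[OF assms(1)] fautoD(1)[OF assms(2)]])
  show "conn_act (\<Psi> \<circ> \<Phi>) D X Y = conn_act \<Psi> (conn_act \<Phi> D) X Y"
    unfolding conn_act_def i fvf_act_comp[OF assms] fvf_act_comp[OF fauto_inv[OF assms(2)] fauto_inv[OF assms(1)]] ..
qed

lemma conn_act_id: "conn_act id D = D"
  by (intro ext) (simp add: conn_act_def)

lemma conn_act_inv:
  assumes "fauto \<Psi>" "conn_act \<Psi> D = D'" shows "conn_act (inv \<Psi>) D' = D"
proof -
  have "inv \<Psi> \<circ> \<Psi> = id" by (simp add: fun_eq_iff fautoD[OF assms(1)])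
  then show ?thesis
    using conn_act_comp[OF fauto_inv[OF assms(1)] assms(1), of D] by (simp add: assms(2) conn_act_id)
qed

text \<open>In the transformation law every term other than the derivative of the Jacobian carries a
  factor \<open>chr\<close>, which starts at order one. Order \<open>m\<close> of the derivative
  thus involves the Jacobian only below \<open>m\<close>, is constant by induction, and so is
  zero.\<close>

lemma jac_const:
  assumes \<Psi>: "fauto \<Psi>" and A: "A \<in> linear_curves w" and A': "A' \<in> linear_curves w"
    and eq: "conn_act \<Psi> (conn (chr A)) = conn (chr A')"
  shows "fpartial c (jac \<Psi> b f) = 0"
proof -
  note admissible = admissible_chr[OF A] admissible_chr[OF A']
  have s: "sym_low (chr A)" using admissible by (simp add: admissible_def)
  have d: "fpartial a (jac \<Psi> b f) = (\<Sum>c\<in>UNIV. chr A' a b c * jac \<Psi> c f)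
      - (\<Sum>d\<in>UNIV. \<Sum>e\<in>UNIV. chr A d e f * (jac \<Psi> a d * jac \<Psi> b e))" for a b f
  proof -
    have "\<Psi> (chr A d e f) = chr A d e f" for d e f unfolding chr_def by (rule fauto_fcst[OF \<Psi>])
    then show ?thesis using iffD1[OF conn_act_iff[OF \<Psi> s] eq] by (simp add: mult.commute[of "chr A _ _ _"])
  qed
  have 0: "fps_nth (chr B a b c) 0 = 0" if "B \<in> linear_curves w" for B a b c
    using admissible_chr[OF that] by (simp add: admissible_def)
  have c: "const_fun (fps_nth (chr B a b c) k)" for B a b c k by (simp add: chr_def)
  have "\<forall>b f. const_fun (fps_nth (jac \<Psi> b f) m)" for m
  proof (induction m rule: less_induct)
    case (less m)
    have K: "const_fun (fps_nth (jac \<Psi> b f) j)" if "j < m" for b f j using less that by blast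
    show ?case
    proof (intro allI)
      fix b f
      show "const_fun (fps_nth (jac \<Psi> b f) m)"
      proof (rule const_fun_if_partials)
        fix a
        have "const_fun (fps_nth (\<Sum>c\<in>UNIV. chr A' a b c * jac \<Psi> c f) m)"
          unfolding fps_sum_nth by (rule const_fun_sum, rule const_fun_product_nth[OF 0[OF A'] c K])
        moreover have "const_fun (fps_nth (\<Sum>d\<in>UNIV. \<Sum>e\<in>UNIV. chr A d e f * (jac \<Psi> a d * jac \<Psi> b e)) m)"
          unfolding fps_sum_nth
        proof (rule const_fun_sum, rule const_fun_sum, rule const_fun_product_nth[OF 0[OF A] c])
          fix d e j assume "j < m"
          then show "const_fun (fps_nth (jac \<Psi> a d * jac \<Psi> b e) j)"
            by (intro const_fun_mult_nth K) auto
        qed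
        ultimately have "const_fun (fps_nth (fpartial a (jac \<Psi> b f)) m)"
          unfolding d fps_sub_nth by (rule const_fun_intros(5))
        then show "const_fun (partial a (fps_nth (jac \<Psi> b f) m))" by simp
      qed
    qed
  qed
  then show ?thesis by (simp add: fps_eq_iff const_fun_def)
qed

text \<open>In direction \<open>d\<close> the pair \<open>\<Psi> (fcos a)\<close>,
  \<open>\<Psi> (fsin a)\<close> rotates with frequency \<open>\<kappa>\<close>. Order zero is the
  situation of \<open>frequency_integral\<close>; at a later order the variation of the phase has a
  constant derivative proportional to \<open>\<kappa> m\<close>.\<close>

lemma jac_integral:
  assumes \<Psi>: "fauto \<Psi>" and K: "jac \<Psi> d a = fcst \<kappa>"
  shows "\<kappa> 0 \<in> \<int>" "m \<ge> 1 \<Longrightarrow> \<kappa> m = 0"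
proof -
  note D = fautoD[OF \<Psi>]
  define u where "u n = fps_nth (\<Psi> (fsin a)) n" for n
  define v where "v n = fps_nth (\<Psi> (fcos a)) n" for n
  have s: "fpartial d (\<Psi> (fsin a)) = kap (2 * pi) * (fcst \<kappa> * \<Psi> (fcos a))"
    unfolding chain_rule[OF \<Psi>] K[symmetric]
    by (simp add: fpartial_fsin if_distrib[where f=\<Psi>] if_distrib[where f="\<lambda>x. _ * x"] D mult_ac cong: if_cong)
  have c: "fpartial d (\<Psi> (fcos a)) = - (kap (2 * pi) * (fcst \<kappa> * \<Psi> (fsin a)))"
    unfolding chain_rule[OF \<Psi>] K[symmetric]
    by (simp add: fpartial_fcos if_distrib[where f=\<Psi>] if_distrib[where f="\<lambda>x. _ * x"] D mult_ac cong: if_cong)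
  have du: "partial d (u n) = of_real (2 * pi) * (\<Sum>i\<in>{0..n}. of_real (\<kappa> i) * v (n - i))" for n
    using arg_cong[OF s, of "\<lambda>F. fps_nth F n"]
    unfolding nth_fpartial nth_kap_mult by (simp add: u_def v_def fps_mult_nth)
  have dv: "partial d (v n) = - (of_real (2 * pi) * (\<Sum>i\<in>{0..n}. of_real (\<kappa> i) * u (n - i)))" for n
    using arg_cong[OF c, of "\<lambda>F. fps_nth F n"]
    unfolding nth_fpartial nth_kap_mult fps_neg_nth by (simp add: u_def v_def fps_mult_nth)
  have "\<Psi> (fcos a) * \<Psi> (fcos a) + \<Psi> (fsin a) * \<Psi> (fsin a) = 1"
    using arg_cong[OF fcos_fsin[of a], of \<Psi>] by (simp add: D)
  from arg_cong[OF this, of "\<lambda>F. fps_nth F 0"] have uv: "u 0 * u 0 + v 0 * v 0 = 1"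
    by (simp add: u_def v_def add.commute)
  have "partial d (u 0) = of_real (2 * pi * \<kappa> 0) * v 0" "partial d (v 0) = - (of_real (2 * pi * \<kappa> 0) * u 0)"
    by (simp_all add: du dv mult.assoc)
  then show "\<kappa> 0 \<in> \<int>" by (rule frequency_integral[OF _ _ uv])
  show "m \<ge> 1 \<Longrightarrow> \<kappa> m = 0"
  proof (induction m rule: less_induct)
    case (less m)
    have j: "\<kappa> j = 0" if "1 \<le> j" "j < m" for j using less that by blast
    \<comment> \<open>Variation of the phase: the imaginary part of \<open>v m + i u m\<close> times
      the conjugate of \<open>v 0 + i u 0\<close>.\<close>
    define \<theta> where "\<theta> = v 0 * u m - u 0 * v m"
    have du': "partial d (u m) = of_real (2 * pi) * (of_real (\<kappa> 0) * v m + of_real (\<kappa> m) * v 0)"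
      unfolding du by (subst sum_two_ends[where c=\<kappa> and g=v, OF less.prems j]) auto
    have dv': "partial d (v m) = - (of_real (2 * pi) * (of_real (\<kappa> 0) * u m + of_real (\<kappa> m) * u 0))"
      unfolding dv by (subst sum_two_ends[where c=\<kappa> and g=u, OF less.prems j]) auto
    have d0: "partial d (u 0) = of_real (2 * pi) * (of_real (\<kappa> 0) * v 0)"
      "partial d (v 0) = - (of_real (2 * pi) * (of_real (\<kappa> 0) * u 0))"
      by (simp_all add: du dv)
    have "partial d \<theta> = of_real (2 * pi) * of_real (\<kappa> m) * (u 0 * u 0 + v 0 * v 0)"
      unfolding \<theta>_def partial_diff partial_mult du' dv' d0 by (simp add: algebra_simps)
    then have \<theta>: "partial d \<theta> = of_real (2 * pi * \<kappa> m)" by (simp add: uv)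
    then have "const_fun (partial d \<theta>)" by (simp only: const_fun_intros(3))
    then have "partial d \<theta> = 0" by (rule partial_eq_0_if_const)
    with \<theta> have "(of_real (2 * pi * \<kappa> m) :: 'n smfun) = of_real 0" by (simp only: of_real_0)
    then show ?case unfolding of_real_smfun_eq_iff by simp
  qed
qed

lemma jac_int_matrix:
  assumes \<Psi>: "fauto \<Psi>" and A: "A \<in> linear_curves w" and A': "A' \<in> linear_curves w"
    and eq: "conn_act \<Psi> (conn (chr A)) = conn (chr A')"
  obtains B :: "real^'n^'n" where "\<And>d a. jac \<Psi> d a = kap (B $ a $ d)" "\<And>a b. B $ a $ b \<in> \<int>"
proof -
  define \<kappa> where "\<kappa> d a k = lift (fps_nth (jac \<Psi> d a) k) 0" for d a k
  have K: "jac \<Psi> d a = fcst (\<kappa> d a)" for d a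
    unfolding \<kappa>_def[abs_def] by (rule fcst_lift[OF jac_const[OF \<Psi> A A' eq]])
  note I = jac_integral[OF \<Psi> K]
  define B :: "real^'n^'n" where "B = (\<chi> a d. \<kappa> d a 0)"
  have "jac \<Psi> d a = kap (B $ a $ d)" for d a
  proof (rule fps_ext)
    fix n show "fps_nth (jac \<Psi> d a) n = fps_nth (kap (B $ a $ d)) n"
      using I(2)[of n d a] by (cases n) (simp_all add: K B_def kap_def)
  qed
  moreover have "B $ a $ b \<in> \<int>" for a b using I(1)[of b a] by (simp add: B_def)
  ultimately show thesis by (rule that)
qed

lemma symp_mat_jac:
  assumes \<Psi>: "fauto \<Psi>" and B: "\<And>d a. jac \<Psi> d a = kap (B $ a $ d)"
  shows "symp_mat B" and "fvf_act (inv \<Psi>) (axis d 1) = (\<chi> a. kap (B $ a $ d))"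
proof -
  have e: "fvf_act (inv \<Psi>) (axis d 1) = (\<chi> a. kap (B $ a $ d))" for d
    unfolding fvf_act_inv_axis[OF \<Psi>] B by (simp only: fautoD(4)[OF fauto_inv[OF \<Psi>]])
  then show "fvf_act (inv \<Psi>) (axis d 1) = (\<chi> a. kap (B $ a $ d))" .
  have "(\<Sum>c\<in>UNIV. \<Sum>e\<in>UNIV. Om c e * B $ c $ a * B $ e $ b) = Om a b" for a b
  proof -
    have "fform w (fvf_act (inv \<Psi>) (axis a 1)) (fvf_act (inv \<Psi>) (axis b 1)) = kap (Om a b)"
      unfolding fform_act[OF fauto_inv[OF \<Psi>]] fform_axis_axis by (rule fautoD(4)[OF fauto_inv[OF \<Psi>]])
    then have "kap (\<Sum>c\<in>UNIV. \<Sum>e\<in>UNIV. Om c e * B $ c $ a * B $ e $ b) = (kap (Om a b) :: 'n ffun)"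
      unfolding e fform_eq vec_lambda_beta kap_sum kap_mult .
    then show ?thesis by (simp only: kap_eq_iff)
  qed
  then show "symp_mat B" unfolding symp_mat_axis by blast
qed

text \<open>Applied to \<open>\<Psi>\<close> and to its inverse, \<open>jac_int_matrix\<close> gives
  integral matrices \<open>B\<close> and \<open>C\<close>. The two actions on the coordinate frame
  undo each other, so the matrices are mutually inverse.\<close>

lemma Sp_equiv_if_conn_act:
  assumes \<Psi>: "fauto \<Psi>" and A: "A \<in> linear_curves w" and A': "A' \<in> linear_curves w"
    and eq: "conn_act \<Psi> (conn (chr A)) = conn (chr A')"
  shows "(A, A') \<in> Sp_equiv w"
proof -
  note \<Phi> = fauto_inv[OF \<Psi>]
  obtain B :: "real^'n^'n" where B: "\<And>d a. jac \<Psi> d a = kap (B $ a $ d)" and Bi: "\<And>a b. B $ a $ b \<in> \<int>"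
    by (rule jac_int_matrix[OF \<Psi> A A' eq]) (rule that)
  obtain C :: "real^'n^'n" where C: "\<And>d a. jac (inv \<Psi>) d a = kap (C $ a $ d)" and Ci: "\<And>a b. C $ a $ b \<in> \<int>"
    by (rule jac_int_matrix[OF \<Phi> A' A conn_act_inv[OF \<Psi> eq]]) (rule that)
  have eC: "fvf_act \<Psi> (axis d 1) = (\<chi> a. kap (C $ a $ d))" for d
    using symp_mat_jac(2)[OF \<Phi> C, of d] by (simp only: inv_inv_eq[OF fautoD(1)[OF \<Psi>]])
  have CB: "C ** B = mat 1"
  proof -
    have "(C ** B) $ b $ d = (mat 1 :: real^'n^'n) $ b $ d" for b d
    proof -
      have "fvf_act (inv \<Psi>) (axis d 1) = (\<Sum>a\<in>UNIV. kap (B $ a $ d) *s axis a 1)"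
        unfolding symp_mat_jac(2)[OF \<Psi> B] by (subst fvf_basis) simp
      then have "fvf_act \<Psi> (fvf_act (inv \<Psi>) (axis d 1)) = (\<Sum>a\<in>UNIV. kap (B $ a $ d) *s (\<chi> b. kap (C $ b $ a)))"
        by (simp only: fvf_act_sum[OF \<Psi>] fvf_act_scale[OF \<Psi>] eC fautoD(4)[OF \<Psi>])
      then have "(axis d 1 :: 'n fvfield) $ b = (\<Sum>a\<in>UNIV. kap (B $ a $ d) *s (\<chi> b. kap (C $ b $ a))) $ b"
        by (simp only: fvf_act_inv(1)[OF \<Psi>])
      also have "\<dots> = kap ((C ** B) $ b $ d)"
        by (simp add: matrix_matrix_mult_def kap_sum kap_mult mult.commute)
      finally have "(axis d 1 :: 'n fvfield) $ b = kap ((C ** B) $ b $ d)" .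
      moreover have "(axis d 1 :: 'n fvfield) $ b = kap ((mat 1 :: real^'n^'n) $ b $ d)"
        by (simp add: axis_def mat_def)
      ultimately have "kap ((C ** B) $ b $ d) = (kap ((mat 1 :: real^'n^'n) $ b $ d) :: 'n ffun)" by simp
      then show ?thesis by (simp only: kap_eq_iff)
    qed
    then show ?thesis by (simp only: vec_eq_iff) simp
  qed
  then have BC: "B ** C = mat 1" by (simp only: matrix_left_right_inverse)
  have "C \<in> Sp_Z w"
    unfolding Sp_Z_iff using symp_mat_jac(1)[OF \<Phi> C] CB BC Bi Ci by blast
  moreover have "A' = Sp_act C A"
    unfolding Sp_act_iff[OF CB] using const_jac_iff[OF \<Psi> B A A'] eq by simp
  ultimately show ?thesis using A A' by (auto simp: Sp_equiv_def)
qed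

section \<open>Comparison of the two equivalence relations\<close>

lemma curve_equiv_iff:
  "(D, D') \<in> curve_equiv w \<longleftrightarrow> D \<in> ricci_curves w \<and> D' \<in> ricci_curves w \<and>
     (\<exists>\<Psi>. fauto \<Psi> \<and> curve_ext D' = conn_act \<Psi> (curve_ext D))"
proof -
  have "(\<exists>\<psi>. symplecto_curve w \<psi> \<and> curve_ext D' = conn_act (symplecto_ext \<psi>) (curve_ext D))
     \<longleftrightarrow> (\<exists>\<Psi>. fauto \<Psi> \<and> curve_ext D' = conn_act \<Psi> (curve_ext D))"
  proof
    assume "\<exists>\<psi>. symplecto_curve w \<psi> \<and> curve_ext D' = conn_act (symplecto_ext \<psi>) (curve_ext D)"
    then show "\<exists>\<Psi>. fauto \<Psi> \<and> curve_ext D' = conn_act \<Psi> (curve_ext D)" using fauto_symplecto_ext(1) by blast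
  next
    assume "\<exists>\<Psi>. fauto \<Psi> \<and> curve_ext D' = conn_act \<Psi> (curve_ext D)"
    then obtain \<Psi> where \<Psi>: "fauto \<Psi>" "curve_ext D' = conn_act \<Psi> (curve_ext D)" by blast
    then show "\<exists>\<psi>. symplecto_curve w \<psi> \<and> curve_ext D' = conn_act (symplecto_ext \<psi>) (curve_ext D)"
      using symplecto_curve_fauto[OF \<Psi>(1)] by (intro exI[of _ "\<lambda>f. \<Psi> (fps_const f)"]) simp
  qed
  then show ?thesis by (simp add: curve_equiv_def)
qed

lemma Sp_equiv_iff:
  assumes A: "A \<in> linear_curves w" and A': "A' \<in> linear_curves w"
  shows "(A, A') \<in> Sp_equiv w \<longleftrightarrow> (flat_plus A, flat_plus A') \<in> curve_equiv w"
proof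
  assume "(flat_plus A, flat_plus A') \<in> curve_equiv w"
  then obtain \<Psi> where "fauto \<Psi>" "conn (chr A') = conn_act \<Psi> (conn (chr A))"
    unfolding curve_equiv_iff flat_plus_curve[OF A] flat_plus_curve[OF A'] curve_ext_curve by blast
  then show "(A, A') \<in> Sp_equiv w" using Sp_equiv_if_conn_act[OF _ A A'] by simp
next
  assume "(A, A') \<in> Sp_equiv w"
  then obtain C where C: "C \<in> Sp_Z w" "A' = Sp_act C A" by (auto simp: Sp_equiv_def)
  from C(1) obtain B where s: "symp_mat C" and CB: "C ** B = mat 1" and i: "\<And>a b. C $ a $ b \<in> \<int>" "\<And>a b. B $ a $ b \<in> \<int>"
    unfolding Sp_Z_iff by blast
  have "linear_form w (B *v x) (B *v y) = linear_form w (C *v (B *v x)) (C *v (B *v y))" for x y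
    using s by (simp only: symp_mat_def)
  then have sB: "symp_mat B" by (simp add: symp_mat_def matrix_vector_mul_assoc CB)
  note F = fauto_fpullback[OF sB i(2) i(1) CB]
  have "conn_act (fpullback B) (conn (chr A)) = conn (chr A')"
    unfolding const_jac_iff[OF F(1) F(2) A A'] using C(2) unfolding Sp_act_iff[OF CB] .
  then show "(flat_plus A, flat_plus A') \<in> curve_equiv w"
    unfolding curve_equiv_iff using F(1) flat_plus_ricci[OF A] flat_plus_ricci[OF A']
    unfolding flat_plus_curve[OF A] flat_plus_curve[OF A'] curve_ext_curve
    by (intro conjI exI[of _ "fpullback B"]) simp_all
qed

lemma equiv_curve_equiv: "equiv (ricci_curves w) (curve_equiv w)"
proof (rule equivI)
  show "curve_equiv w \<subseteq> ricci_curves w \<times> ricci_curves w" by (auto simp: curve_equiv_def)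
  show "refl_on (ricci_curves w) (curve_equiv w)"
  proof (rule refl_onI)
    fix D assume D: "D \<in> ricci_curves w"
    have "curve_ext D = conn_act id (curve_ext D)" by (simp only: conn_act_id)
    with D fauto_id show "(D, D) \<in> curve_equiv w" unfolding curve_equiv_iff by blast
  qed
  show "sym (curve_equiv w)"
  proof (rule symI)
    fix D D' assume "(D, D') \<in> curve_equiv w"
    then obtain \<Psi> where D: "D \<in> ricci_curves w" "D' \<in> ricci_curves w" and \<Psi>: "fauto \<Psi>"
      and eq: "curve_ext D' = conn_act \<Psi> (curve_ext D)" unfolding curve_equiv_iff by blast
    have "curve_ext D = conn_act (inv \<Psi>) (curve_ext D')"
      by (rule conn_act_inv[OF \<Psi> eq[symmetric], symmetric])
    with D fauto_inv[OF \<Psi>] show "(D', D) \<in> curve_equiv w" unfolding curve_equiv_iff by blast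
  qed
  show "trans (curve_equiv w)"
  proof (rule transI)
    fix D D' D'' assume "(D, D') \<in> curve_equiv w" "(D', D'') \<in> curve_equiv w"
    then obtain \<Psi> \<Phi> where \<Psi>: "fauto \<Psi>" and \<Phi>: "fauto \<Phi>" and eq: "curve_ext D' = conn_act \<Psi> (curve_ext D)"
      "curve_ext D'' = conn_act \<Phi> (curve_ext D')" and D: "D \<in> ricci_curves w" "D'' \<in> ricci_curves w"
      unfolding curve_equiv_iff by blast
    have "curve_ext D'' = conn_act (\<Phi> \<circ> \<Psi>) (curve_ext D)"
      by (simp only: conn_act_comp[OF \<Phi> \<Psi>] eq)
    with D fauto_comp[OF \<Phi> \<Psi>] show "(D, D'') \<in> curve_equiv w" unfolding curve_equiv_iff by blast
  qed
qed

end

text \<open>On \<open>X\<close> the relation \<open>R\<close> is the preimage of \<open>S\<close>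
  under \<open>f\<close>, so it inherits the equivalence laws. For \<open>Sp_equiv\<close> this
  replaces checking that the integral symplectic matrices form a group.\<close>

lemma quotient_bij:
  assumes S: "equiv Y S" and f: "\<And>a. a \<in> X \<Longrightarrow> f a \<in> Y" and R: "R \<subseteq> X \<times> X"
    and iff: "\<And>a b. a \<in> X \<Longrightarrow> b \<in> X \<Longrightarrow> (a, b) \<in> R \<longleftrightarrow> (f a, f b) \<in> S"
    and surj: "\<And>y. y \<in> Y \<Longrightarrow> \<exists>a\<in>X. (f a, y) \<in> S"
  shows "equiv X R" "(\<lambda>a. S `` {f a}) respects R"
    "bij_betw (\<lambda>c. \<Union>a\<in>c. S `` {f a}) (X // R) (Y // S)"
proof -
  have refl: "(y, y) \<in> S" if "y \<in> Y" for y using S that by (auto simp: equiv_def refl_on_def)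
  have symm: "(z, y) \<in> S" if "(y, z) \<in> S" for y z using S that by (auto simp: equiv_def sym_def)
  have tran: "(x, z) \<in> S" if "(x, y) \<in> S" "(y, z) \<in> S" for x y z
    using S that by (auto simp: equiv_def dest: transD)
  show E: "equiv X R"
  proof (rule equivI[OF R])
    show "refl_on X R" by (rule refl_onI) (use iff refl f in blast)
    show "sym R"
    proof (rule symI)
      fix a b assume "(a, b) \<in> R"
      moreover from this have "a \<in> X" "b \<in> X" using R by auto
      ultimately show "(b, a) \<in> R" using iff symm by blast
    qed
    show "trans R"
    proof (rule transI)
      fix a b c assume "(a, b) \<in> R" "(b, c) \<in> R"
      moreover from this have "a \<in> X" "b \<in> X" "c \<in> X" using R by auto
      ultimately show "(a, c) \<in> R" using iff tran by blast
    qed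
  qed
  show resp: "(\<lambda>a. S `` {f a}) respects R"
  proof (rule congruentI)
    fix a b assume ab: "(a, b) \<in> R"
    then have "a \<in> X" "b \<in> X" using R by auto
    with ab have "(f a, f b) \<in> S" using iff by blast
    then show "S `` {f a} = S `` {f b}" by (rule equiv_class_eq[OF S])
  qed
  have val: "(\<Union>b\<in>R `` {a}. S `` {f b}) = S `` {f a}" if "a \<in> X" for a
    by (rule UN_equiv_class[OF E resp that])
  show "bij_betw (\<lambda>c. \<Union>a\<in>c. S `` {f a}) (X // R) (Y // S)"
  proof (rule bij_betw_imageI)
    show "inj_on (\<lambda>c. \<Union>a\<in>c. S `` {f a}) (X // R)"
    proof (rule inj_onI)
      fix c c' assume "c \<in> X // R" "c' \<in> X // R" and eq: "(\<Union>a\<in>c. S `` {f a}) = (\<Union>a\<in>c'. S `` {f a})"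
      then obtain a b where a: "a \<in> X" "c = R `` {a}" and b: "b \<in> X" "c' = R `` {b}" by (auto elim!: quotientE)
      have "S `` {f a} = S `` {f b}" using eq unfolding a(2) b(2) val[OF a(1)] val[OF b(1)] .
      then have "(f a, f b) \<in> S" using eq_equiv_class[OF _ S] f[OF b(1)] by blast
      then have "(a, b) \<in> R" using iff a(1) b(1) by blast
      then show "c = c'" unfolding a(2) b(2) by (rule equiv_class_eq[OF E])
    qed
    show "(\<lambda>c. \<Union>a\<in>c. S `` {f a}) ` (X // R) = Y // S"
    proof (intro equalityI subsetI)
      fix d assume "d \<in> (\<lambda>c. \<Union>a\<in>c. S `` {f a}) ` (X // R)"
      then obtain a where "a \<in> X" "d = (\<Union>b\<in>R `` {a}. S `` {f b})" by (auto elim!: quotientE)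
      then show "d \<in> Y // S" using val f by (simp add: quotientI)
    next
      fix d assume "d \<in> Y // S"
      then obtain y where y: "y \<in> Y" "d = S `` {y}" by (auto elim!: quotientE)
      obtain a where a: "a \<in> X" "(f a, y) \<in> S" using surj[OF y(1)] by blast
      have "d = (\<Union>b\<in>R `` {a}. S `` {f b})" unfolding val[OF a(1)] y(2) by (rule equiv_class_eq[OF S a(2), symmetric])
      then show "d \<in> (\<lambda>c. \<Union>a\<in>c. S `` {f a}) ` (X // R)" using quotientI[OF a(1), of R] by blast
    qed
  qed
qed

section \<open>Gauge transformations\<close>

text \<open>Congruence modulo \<open>t^k\<close>; truncations and \<open>t\<close>-adic limits are
  handled through it.\<close>

definition fcong :: "nat \<Rightarrow> 'a::comm_ring_1 fps \<Rightarrow> 'a fps \<Rightarrow> bool" where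
  "fcong k F G \<longleftrightarrow> (\<forall>j<k. fps_nth F j = fps_nth G j)"

lemma fcong_refl: "fcong k F F" by (simp add: fcong_def)
lemma fcong_sym: "fcong k F G \<Longrightarrow> fcong k G F" by (simp add: fcong_def)
lemma fcong_trans: "fcong k F G \<Longrightarrow> fcong k G H \<Longrightarrow> fcong k F H" by (simp add: fcong_def)
lemma fcong_add: "fcong k F F' \<Longrightarrow> fcong k G G' \<Longrightarrow> fcong k (F + G) (F' + G')" by (simp add: fcong_def)
lemma fcong_diff: "fcong k F F' \<Longrightarrow> fcong k G G' \<Longrightarrow> fcong k (F - G) (F' - G')" by (simp add: fcong_def)
lemma fcong_mult: "fcong k F F' \<Longrightarrow> fcong k G G' \<Longrightarrow> fcong k (F * G) (F' * G')"
  by (auto simp: fcong_def fps_mult_nth intro!: sum.cong)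
lemma fcong_sum: "(\<And>x. x \<in> S \<Longrightarrow> fcong k (f x) (g x)) \<Longrightarrow> fcong k (sum f S) (sum g S)"
  by (simp add: fcong_def fps_sum_nth)
lemma fcong_fpartial: "fcong k F G \<Longrightarrow> fcong k (fpartial a F) (fpartial a G)"
  by (simp add: fcong_def)
lemma fcong_X_power: "fcong k (F + fps_X ^ k * G) F"
  by (simp add: fcong_def fps_X_power_mult_nth)
lemma fcong_X_power_0: "k \<le> m \<Longrightarrow> fcong k (fps_X ^ m * G) 0"
  by (simp add: fcong_def fps_X_power_mult_nth)
lemma fcong_less: "fcong k F G \<Longrightarrow> j \<le> k \<Longrightarrow> fcong j F G"
  by (simp add: fcong_def)
lemma fcongD: "fcong k F G \<Longrightarrow> j < k \<Longrightarrow> fps_nth F j = fps_nth G j"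
  by (simp add: fcong_def)
lemma fcong_eq:
  assumes "\<And>k. fcong (Suc k) F G" shows "F = G"
  by (rule fps_ext, rule fcongD[OF assms lessI])

lemma fcong_decomp:
  assumes "fcong k F G" obtains H where "F = G + fps_X ^ k * H"
proof -
  have "F = G + fps_X ^ k * fps_shift k (F - G)"
    using assms by (auto simp: fps_eq_iff fps_X_power_mult_nth fcong_def)
  then show thesis by (rule that)
qed

lemma sum_triangle:
  fixes g :: "nat \<Rightarrow> nat \<Rightarrow> 'a::comm_monoid_add"
  assumes "\<And>i j. i + j > k \<Longrightarrow> g i j = 0"
  shows "(\<Sum>i\<le>k. \<Sum>j\<le>k. g i j) = (\<Sum>n\<le>k. \<Sum>i\<le>n. g i (n - i))"
proof -
  have "(\<Sum>i\<le>k. \<Sum>j\<le>k. g i j) = (\<Sum>(i, j)\<in>{..k} \<times> {..k}. g i j)"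
    by (simp add: sum.cartesian_product)
  also have "\<dots> = (\<Sum>(i, j)\<in>{(i, j). i + j \<le> k}. g i j)"
    by (rule sum.mono_neutral_right) (auto intro: assms)
  also have "\<dots> = (\<Sum>n\<le>k. \<Sum>i\<le>n. g i (n - i))" by (rule sum.triangle_reindex_eq)
  finally show ?thesis .
qed

context constant_symplectic
begin

section \<open>Jacobi identity and Leibniz rule for the formal bracket\<close>

lemma fpoisson_ctr: "fpoisson w F G = ctr (\<lambda>x y. fpartial y F * fpartial x G)"
  unfolding fpoisson_eq ctr_def by (rule sum.swap)

lemma fpartial_ctr: "fpartial a (ctr f) = ctr (\<lambda>x y. fpartial a (f x y))"
  by (simp add: ctr_def)

lemma ctr_commute: "ctr (\<lambda>x y. ctr (\<lambda>u v. f x y u v)) = ctr (\<lambda>u v. ctr (\<lambda>x y. f x y u v))"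
proof -
  have "ctr (\<lambda>x y. ctr (\<lambda>u v. f x y u v)) = (\<Sum>y\<in>UNIV. \<Sum>x\<in>UNIV. \<Sum>v\<in>UNIV. \<Sum>u\<in>UNIV. pv y x * (pv v u * f x y u v))"
    by (simp add: ctr_def sum_distrib_left)
  also have "\<dots> = (\<Sum>y\<in>UNIV. \<Sum>v\<in>UNIV. \<Sum>x\<in>UNIV. \<Sum>u\<in>UNIV. pv y x * (pv v u * f x y u v))"
    by (rule sum.cong[OF refl], rule sum.swap)
  also have "\<dots> = (\<Sum>v\<in>UNIV. \<Sum>y\<in>UNIV. \<Sum>u\<in>UNIV. \<Sum>x\<in>UNIV. pv y x * (pv v u * f x y u v))"
    by (subst sum.swap, rule sum.cong[OF refl], rule sum.cong[OF refl], rule sum.swap)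
  also have "\<dots> = (\<Sum>v\<in>UNIV. \<Sum>u\<in>UNIV. \<Sum>y\<in>UNIV. \<Sum>x\<in>UNIV. pv y x * (pv v u * f x y u v))"
    by (rule sum.cong[OF refl], rule sum.swap)
  also have "\<dots> = ctr (\<lambda>u v. ctr (\<lambda>x y. f x y u v))"
    by (simp add: ctr_def sum_distrib_left mult_ac)
  finally show ?thesis .
qed

text \<open>Each double bracket expands into terms with one second derivative. Those with second
  derivatives of \<open>F\<close> and of \<open>G\<close> agree after exchanging the two
  contractions; those with second derivatives of \<open>H\<close> cancel by antisymmetry of the
  contraction.\<close>

lemma jacobi: "fpoisson w H (fpoisson w F G) = fpoisson w (fpoisson w H F) G + fpoisson w F (fpoisson w H G)"
proof -
  define h where "h a = fpartial a H" for a
  define f where "f a = fpartial a F" for a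
  define g where "g a = fpartial a G" for a
  define hh where "hh a b = fpartial a (fpartial b H)" for a b
  define ff where "ff a b = fpartial a (fpartial b F)" for a b
  define gg where "gg a b = fpartial a (fpartial b G)" for a b
  have s: "hh a b = hh b a" "ff a b = ff b a" "gg a b = gg b a" for a b
    by (simp_all add: hh_def ff_def gg_def fpartial_commute)
  have "fpoisson w H (fpoisson w F G) = ctr (\<lambda>x y. ctr (\<lambda>u v. h y * (ff x v * g u))) + ctr (\<lambda>x y. ctr (\<lambda>u v. h y * (f v * gg x u)))"
    unfolding fpoisson_ctr fpartial_ctr ctr_add[symmetric]
    by (simp add: ctr_mult[symmetric] h_def f_def g_def ff_def gg_def algebra_simps)
  moreover have "fpoisson w (fpoisson w H F) G = ctr (\<lambda>x y. ctr (\<lambda>u v. (hh y v * f u) * g x)) + ctr (\<lambda>x y. ctr (\<lambda>u v. (h v * ff y u) * g x))"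
    unfolding fpoisson_ctr fpartial_ctr ctr_add[symmetric]
    by (simp add: ctr_mult[symmetric] mult.commute[of "ctr _"] h_def f_def g_def hh_def ff_def algebra_simps)
  moreover have "fpoisson w F (fpoisson w H G) = ctr (\<lambda>x y. ctr (\<lambda>u v. f y * (hh x v * g u))) + ctr (\<lambda>x y. ctr (\<lambda>u v. f y * (h v * gg x u)))"
    unfolding fpoisson_ctr fpartial_ctr ctr_add[symmetric]
    by (simp add: ctr_mult[symmetric] h_def f_def g_def hh_def gg_def algebra_simps)
  moreover have "ctr (\<lambda>x y. ctr (\<lambda>u v. (h v * ff y u) * g x)) = ctr (\<lambda>x y. ctr (\<lambda>u v. h y * (ff x v * g u)))"
    by (subst ctr_commute) (simp only: s(2) mult.assoc)
  moreover have "ctr (\<lambda>x y. ctr (\<lambda>u v. f y * (h v * gg x u))) = ctr (\<lambda>x y. ctr (\<lambda>u v. h y * (f v * gg x u)))"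
    by (subst ctr_commute) (simp only: s(3) mult.left_commute)
  moreover have "ctr (\<lambda>x y. ctr (\<lambda>u v. f y * (hh x v * g u))) = - ctr (\<lambda>x y. ctr (\<lambda>u v. (hh y v * f u) * g x))"
  proof -
    have "ctr (\<lambda>x y. ctr (\<lambda>u v. f y * (hh x v * g u))) = - ctr (\<lambda>x y. ctr (\<lambda>u v. f x * (hh y v * g u)))"
      using ctr_swap[of "\<lambda>x y. ctr (\<lambda>u v. f x * (hh y v * g u))"] .
    also have "ctr (\<lambda>x y. ctr (\<lambda>u v. f x * (hh y v * g u))) = ctr (\<lambda>x y. ctr (\<lambda>u v. (hh y v * f u) * g x))"
      by (subst ctr_commute) (simp only: s(1) mult_ac)
    finally show ?thesis .
  qed
  ultimately show ?thesis by simp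
qed

lemma fpoisson_mult: "fpoisson w H (F * G) = fpoisson w H F * G + F * fpoisson w H G"
  unfolding fvf_app_ham[symmetric] by simp

section \<open>The exponential of a Hamiltonian derivation of order \<open>m\<close>\<close>

context
  fixes h :: "'n smfun" and m :: nat
  assumes m: "m \<ge> 1"
begin

definition ham_der :: "'n ffun \<Rightarrow> 'n ffun" where
  "ham_der F = fps_X ^ m * fpoisson w (fps_const h) F"

text \<open>Divided powers, with which the Leibniz formula has no binomial coefficients.\<close>

definition ham_pow :: "nat \<Rightarrow> 'n ffun \<Rightarrow> 'n ffun" where
  "ham_pow n F = kap (1 / fact n) * (ham_der ^^ n) F"

text \<open>At order \<open>k\<close> the exponential series may stop at \<open>n = k\<close>,
  because \<open>ham_pow n F\<close> begins at order \<open>m * n\<close> or later and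
  \<open>m \<ge> 1\<close>.\<close>

definition ham_exp :: "'n ffun \<Rightarrow> 'n ffun" where
  "ham_exp F = Abs_fps (\<lambda>k. \<Sum>n\<le>k. fps_nth (ham_pow n F) k)"

lemma ham_der_linear: "ham_der (F + G) = ham_der F + ham_der G" "ham_der (kap c * F) = kap c * ham_der F" "ham_der (fps_X * F) = fps_X * ham_der F" "ham_der (kap c) = 0"
  by (simp_all add: ham_der_def fpoisson_bilinear fpoisson_mult algebra_simps) (simp_all add: fpoisson_eq)

lemma ham_der_0: "ham_der 0 = 0" using ham_der_linear(4)[of 0] by simp

lemma ham_der_sum: "ham_der (sum f S) = (\<Sum>x\<in>S. ham_der (f x))" for f :: "nat \<Rightarrow> 'n ffun"
  by (induction S rule: infinite_finite_induct) (simp_all add: ham_der_linear ham_der_0)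

lemma ham_der_pow_linear: "(ham_der ^^ n) (F + G) = (ham_der ^^ n) F + (ham_der ^^ n) G" "(ham_der ^^ n) (fps_X * F) = fps_X * (ham_der ^^ n) F"
  by (induction n) (simp_all add: ham_der_linear)

lemma ham_pow_linear: "ham_pow n (F + G) = ham_pow n F + ham_pow n G" "ham_pow n (fps_X * F) = fps_X * ham_pow n F"
  by (simp_all add: ham_pow_def ham_der_pow_linear distrib_left mult.left_commute)

lemma ham_pow_0: "ham_pow 0 F = F" by (simp add: ham_pow_def)

lemma ham_pow_Suc: "kap (real (Suc n)) * ham_pow (Suc n) F = ham_der (ham_pow n F)"
proof -
  have "real (Suc n) * (1 / fact (Suc n)) = (1 / fact n :: real)" by (simp add: fact_Suc)
  then have "kap (real (Suc n)) * kap (1 / fact (Suc n)) = (kap (1 / fact n) :: 'n ffun)"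
    by (simp only: kap_mult[symmetric])
  then show ?thesis
    by (simp only: ham_pow_def ham_der_linear mult.assoc[symmetric]) simp
qed

lemma ham_der_pow_div: "\<exists>G. (ham_der ^^ n) F = fps_X ^ (m * n) * G"
proof (induction n)
  case 0
  show ?case by (rule exI[of _ F]) simp
next
  case (Suc n)
  then obtain G where G: "(ham_der ^^ n) F = fps_X ^ (m * n) * G" by blast
  have X: "ham_der (fps_X ^ j * G) = fps_X ^ j * ham_der G" for j
    by (induction j) (simp_all add: ham_der_linear mult.assoc)
  have "(ham_der ^^ Suc n) F = fps_X ^ (m * n) * (fps_X ^ m * fpoisson w (fps_const h) G)"
    by (simp only: funpow.simps comp_def G X) (simp add: ham_der_def)
  then show ?case by (intro exI[of _ "fpoisson w (fps_const h) G"]) (simp add: power_add mult_ac)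
qed

lemma ham_pow_div: obtains G where "ham_pow n F = fps_X ^ (m * n) * G"
proof -
  obtain G where "(ham_der ^^ n) F = fps_X ^ (m * n) * G" using ham_der_pow_div by blast
  then have "ham_pow n F = fps_X ^ (m * n) * (kap (1 / fact n) * G)" by (simp add: ham_pow_def mult_ac)
  then show thesis by (rule that)
qed

lemma ham_pow_nth_0: "k < m * n \<Longrightarrow> fps_nth (ham_pow n F) k = 0"
  by (rule ham_pow_div[of n F]) (simp add: fps_X_power_mult_nth)

lemma ham_pow_nth_0': "k < n \<Longrightarrow> fps_nth (ham_pow n F) k = 0"
  using m by (intro ham_pow_nth_0) (metis less_le_trans mult.commute mult_le_mono1 mult_1 nat_mult_1)

lemma ham_exp_cong: "k \<le> N \<Longrightarrow> fcong (Suc k) (ham_exp F) (\<Sum>n\<le>N. ham_pow n F)"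
  unfolding fcong_def
proof (intro allI impI)
  fix j assume "k \<le> N" "j < Suc k"
  then have "(\<Sum>n\<le>N. fps_nth (ham_pow n F) j) = (\<Sum>n\<le>j. fps_nth (ham_pow n F) j)"
    by (intro sum.mono_neutral_right) (auto intro: ham_pow_nth_0')
  then show "fps_nth (ham_exp F) j = fps_nth (\<Sum>n\<le>N. ham_pow n F) j"
    by (simp add: ham_exp_def fps_sum_nth)
qed

lemma ham_exp_add: "ham_exp (F + G) = ham_exp F + ham_exp G"
  by (simp add: ham_exp_def fps_eq_iff ham_pow_linear sum.distrib)

lemma ham_exp_X: "ham_exp (fps_X * F) = fps_X * ham_exp F"
proof (rule fps_ext)
  fix k show "fps_nth (ham_exp (fps_X * F)) k = fps_nth (fps_X * ham_exp F) k"
  proof (cases k)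
    case (Suc j)
    have "fps_nth (ham_exp (fps_X * F)) k = (\<Sum>n\<le>Suc j. fps_nth (ham_pow n F) j)"
      by (simp add: ham_exp_def Suc ham_pow_linear fps_X_mult_nth)
    then show ?thesis by (simp add: ham_exp_def Suc fps_X_mult_nth ham_pow_nth_0')
  qed (simp add: ham_exp_def ham_pow_linear fps_X_mult_nth)
qed

text \<open>The exponential of a derivation respects every bilinear operation that the derivation
  respects. With \<open>B\<close> left abstract, this covers the product and the Poisson bracket at
  once.\<close>

lemma ham_exp_bilinear:
  fixes B :: "'n ffun \<Rightarrow> 'n ffun \<Rightarrow> 'n ffun"
  assumes B: "\<And>F F' G. B (F + F') G = B F G + B F' G" "\<And>F G G'. B F (G + G') = B F G + B F G'"
      "\<And>F G. B (fps_X * F) G = fps_X * B F G" "\<And>F G. B F (fps_X * G) = fps_X * B F G"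
      "\<And>c F G. B (kap c * F) G = kap c * B F G" "\<And>c F G. B F (kap c * G) = kap c * B F G"
    and leibniz: "\<And>F G. ham_der (B F G) = B (ham_der F) G + B F (ham_der G)"
  shows "ham_exp (B F G) = B (ham_exp F) (ham_exp G)"
proof -
  have Bs: "B (sum f S) G = (\<Sum>x\<in>S. B (f x) G)" "B F (sum f S) = (\<Sum>x\<in>S. B F (f x))" 
    for f and S :: "nat set" and F G
  proof -
    have "B 0 G = 0" "B F 0 = 0" for F G using B(5)[of 0 0] B(6)[of _ 0 0] by simp_all
    then show "B (sum f S) G = (\<Sum>x\<in>S. B (f x) G)" "B F (sum f S) = (\<Sum>x\<in>S. B F (f x))"
      by (induction S rule: infinite_finite_induct) (simp_all add: B)
  qed
  have BX: "B (fps_X ^ j * F) G = fps_X ^ j * B F G" "B F (fps_X ^ j * G) = fps_X ^ j * B F G" for j F G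
    by (induction j) (simp_all add: B mult.assoc)
  have D: "ham_pow n (B F G) = (\<Sum>i\<le>n. B (ham_pow i F) (ham_pow (n - i) G))" for n
  proof (induction n)
    case 0
    show ?case by (simp add: ham_pow_0)
  next
    case (Suc n)
    define b where "b i j = B (ham_pow i F) (ham_pow j G)" for i j
    have "kap (real (Suc n)) * ham_pow (Suc n) (B F G) = (\<Sum>i\<le>n. B (ham_der (ham_pow i F)) (ham_pow (n - i) G)) + (\<Sum>i\<le>n. B (ham_pow i F) (ham_der (ham_pow (n - i) G)))"
      by (simp only: ham_pow_Suc Suc ham_der_sum leibniz sum.distrib)
    also have "(\<Sum>i\<le>n. B (ham_der (ham_pow i F)) (ham_pow (n - i) G)) = (\<Sum>i\<le>n. kap (real (Suc i)) * b (Suc i) (n - i))"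
      by (simp only: ham_pow_Suc[symmetric] B b_def)
    also have "\<dots> = (\<Sum>i\<le>Suc n. kap (real i) * b i (Suc n - i))"
      by (simp only: sum.atMost_Suc_shift) simp
    also have "(\<Sum>i\<le>n. B (ham_pow i F) (ham_der (ham_pow (n - i) G))) = (\<Sum>i\<le>n. kap (real (Suc (n - i))) * b i (Suc (n - i)))"
      by (simp only: ham_pow_Suc[symmetric] B b_def)
    also have "\<dots> = (\<Sum>i\<le>n. kap (real (Suc n - i)) * b i (Suc n - i))"
      by (rule sum.cong) (simp_all add: Suc_diff_le)
    also have "\<dots> = (\<Sum>i\<le>Suc n. kap (real (Suc n - i)) * b i (Suc n - i))" by simp
    \<comment> \<open>The weights \<open>i\<close> and \<open>Suc n - i\<close> add up to
      \<open>Suc n\<close>, a factor that is cancelled at the end.\<close>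
    also have "(\<Sum>i\<le>Suc n. kap (real i) * b i (Suc n - i)) + (\<Sum>i\<le>Suc n. kap (real (Suc n - i)) * b i (Suc n - i))
        = (\<Sum>i\<le>Suc n. kap (real (Suc n)) * b i (Suc n - i))"
      unfolding sum.distrib[symmetric] distrib_right[symmetric] kap_add[symmetric]
      by (rule sum.cong) (simp_all add: of_nat_diff del: of_nat_Suc)
    also have "\<dots> = kap (real (Suc n)) * (\<Sum>i\<le>Suc n. b i (Suc n - i))" by (simp only: sum_distrib_left)
    finally have "ham_pow (Suc n) (B F G) = (\<Sum>i\<le>Suc n. b i (Suc n - i))"
      by (rule kap_cancel[rotated]) simp
    then show ?case by (simp only: b_def)
  qed
  have "fps_nth (ham_exp (B F G)) k = fps_nth (B (ham_exp F) (ham_exp G)) k" for k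
  proof -
    \<comment> \<open>The tails of both series are multiples of \<open>fps_X ^ Suc k\<close>, so
      coefficient \<open>k\<close> sees only the truncations.\<close>
    obtain R where R: "ham_exp F = (\<Sum>n\<le>k. ham_pow n F) + fps_X ^ Suc k * R" by (rule fcong_decomp[OF ham_exp_cong[of k k F, OF order_refl]])
    obtain R' where R': "ham_exp G = (\<Sum>n\<le>k. ham_pow n G) + fps_X ^ Suc k * R'" by (rule fcong_decomp[OF ham_exp_cong[of k k G, OF order_refl]])
    have "fps_nth (B (ham_exp F) (ham_exp G)) k = fps_nth (B (\<Sum>n\<le>k. ham_pow n F) (\<Sum>n\<le>k. ham_pow n G)) k"
      unfolding R R' B BX by (simp only: fps_add_nth fps_X_power_mult_nth) simp
    also have "\<dots> = (\<Sum>i\<le>k. \<Sum>j\<le>k. fps_nth (B (ham_pow i F) (ham_pow j G)) k)"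
      by (simp only: Bs fps_sum_nth) (rule sum.swap)
    also have "\<dots> = (\<Sum>n\<le>k. \<Sum>i\<le>n. fps_nth (B (ham_pow i F) (ham_pow (n - i) G)) k)"
    proof (rule sum_triangle)
      fix i j assume ij: "i + j > k"
      obtain P where P: "ham_pow i F = fps_X ^ (m * i) * P" by (rule ham_pow_div)
      obtain Q where Q: "ham_pow j G = fps_X ^ (m * j) * Q" by (rule ham_pow_div)
      have "1 * i + 1 * j \<le> m * i + m * j" using m by (intro add_mono mult_right_mono) auto
      then have "k < m * i + m * j" using ij by linarith
      then show "fps_nth (B (ham_pow i F) (ham_pow j G)) k = 0"
        unfolding P Q BX mult.assoc[symmetric] power_add[symmetric] fps_X_power_mult_nth by (simp add: add.commute)
    qed
    also have "\<dots> = fps_nth (ham_exp (B F G)) k"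
      by (simp add: ham_exp_def D fps_sum_nth)
    finally show ?thesis by (rule sym)
  qed
  then show ?thesis by (simp add: fps_eq_iff)
qed

lemma ham_exp_cong_id: "fcong m (ham_exp F) F"
  unfolding fcong_def
proof (intro allI impI)
  fix j assume j: "j < m"
  have "fps_nth (ham_exp F) j = (\<Sum>n\<le>j. if n = 0 then fps_nth F j else 0)"
    unfolding ham_exp_def fps_nth_Abs_fps
  proof (rule sum.cong[OF refl])
    fix n show "fps_nth (ham_pow n F) j = (if n = 0 then fps_nth F j else 0)"
    proof (cases n)
      case (Suc i)
      then have "j < m * n" using j by (simp add: trans_less_add1)
      then show ?thesis using Suc by (simp add: ham_pow_nth_0)
    qed (simp add: ham_pow_0)
  qed
  then show "fps_nth (ham_exp F) j = fps_nth F j" by simp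
qed

text \<open>The terms with \<open>n \<ge> 2\<close> begin at order \<open>2 * m\<close> or later,
  beyond \<open>m\<close>.\<close>

lemma ham_exp_cong_1: "fcong (Suc m) (ham_exp F) (F + fps_X ^ m * fpoisson w (fps_const h) F)"
proof -
  have "fcong (Suc m) (ham_exp F) (\<Sum>n\<le>m. ham_pow n F)" by (rule ham_exp_cong) simp
  moreover have "fcong (Suc m) (\<Sum>n\<le>m. ham_pow n F) (\<Sum>n\<le>1. ham_pow n F)"
    unfolding fcong_def
  proof (intro allI impI)
    fix j assume j: "j < Suc m"
    have "(\<Sum>n\<le>m. fps_nth (ham_pow n F) j) = (\<Sum>n\<le>1. fps_nth (ham_pow n F) j)"
    proof (rule sum.mono_neutral_right)
      show "\<forall>n\<in>{..m} - {..1}. fps_nth (ham_pow n F) j = 0"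
      proof
        fix n assume "n \<in> {..m} - {..1}"
        then have "m * 2 \<le> m * n" by (intro mult_left_mono) auto
        then have "j < m * n" using j m by linarith
        then show "fps_nth (ham_pow n F) j = 0" by (rule ham_pow_nth_0)
      qed
    qed (use m in auto)
    then show "fps_nth (\<Sum>n\<le>m. ham_pow n F) j = fps_nth (\<Sum>n\<le>1. ham_pow n F) j" by (simp add: fps_sum_nth)
  qed
  moreover have "(\<Sum>n\<le>1. ham_pow n F) = F + fps_X ^ m * fpoisson w (fps_const h) F"
    by (simp add: ham_pow_0) (simp add: ham_pow_def ham_der_def)
  ultimately show ?thesis by (metis fcong_trans)
qed

lemma fauto_ham_exp: "fauto ham_exp"
proof -
  have 1: "ham_exp (F * G) = ham_exp F * ham_exp G" for F G
    by (rule ham_exp_bilinear) (simp_all add: algebra_simps ham_der_def fpoisson_mult)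
  have 2: "ham_exp (fpoisson w F G) = fpoisson w (ham_exp F) (ham_exp G)" for F G
  proof (rule ham_exp_bilinear)
    have X: "fpoisson w (fps_X ^ j * F) G = fps_X ^ j * fpoisson w F G" "fpoisson w F (fps_X ^ j * G) = fps_X ^ j * fpoisson w F G" for j F G
      by (induction j) (simp_all add: fpoisson_bilinear mult.assoc)
    show "ham_der (fpoisson w F G) = fpoisson w (ham_der F) G + fpoisson w F (ham_der G)" for F G
      unfolding ham_der_def X by (subst jacobi) (simp only: distrib_left)
    show "fpoisson w (kap c * F) G = kap c * fpoisson w F G" "fpoisson w F (kap c * G) = kap c * fpoisson w F G" for c F G
      by (simp_all add: fpoisson_eq sum_distrib_left mult_ac)
  qed (rule fpoisson_bilinear)+
  have "ham_pow n (kap c) = (if n = 0 then kap c else 0)" for n c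
  proof (cases n)
    case (Suc k)
    have "(ham_der ^^ n) (kap c) = 0" unfolding Suc funpow_Suc_right by (simp add: ham_der_linear) (induction k; simp add: ham_der_0)
    then show ?thesis by (simp add: ham_pow_def Suc)
  qed (simp add: ham_pow_0)
  then have 3: "ham_exp (kap c) = kap c" for c
    by (simp add: ham_exp_def fps_eq_iff if_distrib[where f="\<lambda>F. fps_nth F _"] cong: if_cong)
  have 4: "ham_exp fps_X = fps_X" using ham_exp_X[of 1] 3[of 1] by simp
  have "fps_nth (ham_exp (fps_const f)) 0 = f" for f
    using fcongD[OF ham_exp_cong_id, of 0 "fps_const f"] m by simp
  then have "bij ham_exp" unfolding ext_bij[of ham_exp, OF ham_exp_add ham_exp_X] by (simp add: bij_def inj_def surj_def)
  then show ?thesis by (simp add: fauto_def ham_exp_add 1 2 3 4)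
qed

text \<open>The correction to the identity is \<open>fps_X ^ m\<close> times the derivative of the
  components \<open>\<xi>\<close> of the Hamiltonian field of \<open>h\<close>, found by inserting
  \<open>ham_exp_cong_1\<close> into \<open>jac\<close>.\<close>

lemma jac_ham_exp:
  "fcong (Suc m) (jac ham_exp d a) ((if d = a then 1 else 0) + fps_X ^ m * (\<Sum>b\<in>UNIV. pv b a * fps_const (partial d (partial b h))))"
proof -
  define \<xi> where "\<xi> = (\<Sum>b\<in>UNIV. pv b a * fps_const (partial b h))"
  have \<xi>: "fpartial d \<xi> = (\<Sum>b\<in>UNIV. pv b a * fps_const (partial d (partial b h)))" by (simp add: \<xi>_def)
  let ?X = "fps_X ^ m :: 'n ffun"
  have ps: "fpoisson w (fps_const h) (fsin a) = kap (2 * pi) * (\<xi> * fcos a)"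
    and pc: "fpoisson w (fps_const h) (fcos a) = - (kap (2 * pi) * (\<xi> * fsin a))"
    unfolding fvf_app_ham[symmetric] fvf_app_fsin fvf_app_fcos by (simp_all add: ham_def \<xi>_def)
  define s1 where "s1 = fsin a + ?X * (kap (2 * pi) * (\<xi> * fcos a))"
  define c1 where "c1 = fcos a - ?X * (kap (2 * pi) * (\<xi> * fsin a))"
  have s: "fcong (Suc m) (ham_exp (fsin a)) s1" using ham_exp_cong_1[of "fsin a"] by (simp add: ps s1_def)
  have c: "fcong (Suc m) (ham_exp (fcos a)) c1" using ham_exp_cong_1[of "fcos a"] by (simp add: pc c1_def)
  have 1: "fcong (Suc m) (jac ham_exp d a) (kap (1 / (2 * pi)) * (c1 * fpartial d s1 - s1 * fpartial d c1))"
    unfolding jac_def by (intro fcong_mult fcong_diff fcong_refl s c fcong_fpartial)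
  have 2: "kap (1 / (2 * pi)) * (c1 * fpartial d s1 - s1 * fpartial d c1)
      = ((if d = a then 1 else 0) + ?X * fpartial d \<xi>) + ?X * ?X * (kap (2 * pi) * kap (2 * pi) * \<xi> * \<xi> * (if d = a then 1 else 0))"
  proof -
    define \<delta> :: "'n ffun" where "\<delta> = (if d = a then 1 else 0)"
    have ds: "fpartial d (fsin a) = kap (2 * pi) * (\<delta> * fcos a)" and dc: "fpartial d (fcos a) = - (kap (2 * pi) * (\<delta> * fsin a))"
      by (auto simp: fpartial_fsin fpartial_fcos \<delta>_def)
    have "c1 * fpartial d s1 - s1 * fpartial d c1
        = kap (2 * pi) * (\<delta> + ?X * fpartial d \<xi> + ?X * ?X * (kap (2 * pi) * kap (2 * pi) * \<xi> * \<xi> * \<delta>)) * (fcos a * fcos a + fsin a * fsin a)"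
      unfolding c1_def s1_def by (simp add: ds dc algebra_simps)
    then have "c1 * fpartial d s1 - s1 * fpartial d c1
        = kap (2 * pi) * (\<delta> + ?X * fpartial d \<xi> + ?X * ?X * (kap (2 * pi) * kap (2 * pi) * \<xi> * \<xi> * \<delta>))"
      by (simp only: fcos_fsin mult_1_right)
    then have "kap (1 / (2 * pi)) * (c1 * fpartial d s1 - s1 * fpartial d c1)
        = \<delta> + ?X * fpartial d \<xi> + ?X * ?X * (kap (2 * pi) * kap (2 * pi) * \<xi> * \<xi> * \<delta>)"
      by (simp flip: mult.assoc kap_mult)
    then show ?thesis by (simp only: \<delta>_def)
  qed
  have 3: "fcong (Suc m) (Y + ?X * ?X * Z) Y" for Y Z :: "'n ffun"
  proof -
    have "fcong (Suc m) (?X * ?X * Z) 0"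
      unfolding power_add[symmetric] by (rule fcong_X_power_0) (use m in simp)
    from fcong_add[OF fcong_refl this] show ?thesis by simp
  qed
  show ?thesis unfolding \<xi>[symmetric] by (rule fcong_trans[OF 1[unfolded 2] 3])
qed

text \<open>Modulo \<open>t^(m+1)\<close>, a correction of order \<open>m\<close> multiplied by
  symbols, which start at order one, drops out of the transformation law. What remains is the
  derivative of the Jacobian, that is third derivatives of \<open>h\<close> with an index
  raised.\<close>

lemma gauge_coeff:
  assumes \<Gamma>: "admissible \<Gamma>" and \<Gamma>': "sym_low \<Gamma>'" and eq: "conn_act ham_exp (conn \<Gamma>) = conn \<Gamma>'"
  shows "fcong (Suc m) (\<Gamma>' a b f) (\<Gamma> a b f + fps_X ^ m * (\<Sum>c\<in>UNIV. pv c f * fps_const (partial a (partial b (partial c h)))))"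
proof -
  let ?X = "fps_X ^ m :: 'n ffun"
  have s: "sym_low \<Gamma>" and \<Gamma>0: "\<And>a b c. fps_nth (\<Gamma> a b c) 0 = 0" using \<Gamma> by (simp_all add: admissible_def)
  define Z where "Z d a = (\<Sum>b\<in>UNIV. pv b a * fps_const (partial d (partial b h)))" for d a
  define K where "K d a = (if d = a then 1 else 0) + ?X * Z d a" for d a
  have K: "fcong (Suc m) (jac ham_exp d a) (K d a)" for d a unfolding K_def Z_def by (rule jac_ham_exp)
  have main: "(\<Sum>c\<in>UNIV. \<Gamma>' a b c * jac ham_exp c f) = fpartial a (jac ham_exp b f)
       + (\<Sum>d\<in>UNIV. \<Sum>e\<in>UNIV. jac ham_exp a d * jac ham_exp b e * ham_exp (\<Gamma> d e f))" for a b f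
    using iffD1[OF conn_act_iff[OF fauto_ham_exp s] eq] by blast
  have small: "fcong (Suc m) (?X * (Y * G)) 0" if "fps_nth G 0 = 0" for Y G :: "'n ffun"
  proof -
    have "G = fps_X * fps_shift 1 G" using fps_decomp[of G] that by simp
    then have "?X * (Y * G) = ?X * (Y * (fps_X * fps_shift 1 G))" by simp
    also have "\<dots> = fps_X ^ Suc m * (Y * fps_shift 1 G)" by (simp add: mult_ac)
    finally show ?thesis using fcong_X_power_0[of "Suc m" "Suc m"] by simp
  qed
  \<comment> \<open>\<open>ham_exp\<close> is the identity below order \<open>m\<close>, and the
    factor \<open>fps_X\<close> in the symbols gains one more order.\<close>
  have E: "fcong (Suc m) (ham_exp (\<Gamma> d e f)) (\<Gamma> d e f)" for d e f
  proof -
    have "\<Gamma> d e f = fps_X * fps_shift 1 (\<Gamma> d e f)" using fps_decomp[of "\<Gamma> d e f"] \<Gamma>0 by simp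
    then have "ham_exp (\<Gamma> d e f) = ham_exp (fps_X * fps_shift 1 (\<Gamma> d e f))" by (rule arg_cong)
    then have "ham_exp (\<Gamma> d e f) = fps_X * ham_exp (fps_shift 1 (\<Gamma> d e f))" by (simp only: ham_exp_X)
    moreover have "fps_nth (fps_X * ham_exp (fps_shift 1 (\<Gamma> d e f))) j = fps_nth (\<Gamma> d e f) j" if "j < Suc m" for j
      using that fcongD[OF ham_exp_cong_id, of "j - 1" "fps_shift 1 (\<Gamma> d e f)"] \<Gamma>0[of d e f]
      by (cases j) (simp_all add: fps_X_mult_nth)
    ultimately show ?thesis by (simp add: fcong_def)
  qed
  have X0: "fps_nth (?X * Y) 0 = 0" for Y using m by (simp add: fps_X_power_mult_nth)
  have dK: "fpartial a (K b f) = ?X * fpartial a (Z b f)" for a b f by (simp add: K_def)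
  have sumK: "(\<Sum>c\<in>UNIV. U c * K c f) = U f + ?X * (\<Sum>c\<in>UNIV. Z c f * U c)" for U f
    by (simp add: K_def distrib_left sum.distrib sum_distrib_left mult_ac)
  have rhs: "fcong (Suc m) (\<Sum>c\<in>UNIV. \<Gamma>' a b c * K c f) (\<Gamma> a b f + ?X * fpartial a (Z b f))" for a b f
  proof -
    have "fcong (Suc m) (\<Sum>c\<in>UNIV. \<Gamma>' a b c * K c f) (\<Sum>c\<in>UNIV. \<Gamma>' a b c * jac ham_exp c f)"
      by (intro fcong_sum fcong_mult fcong_refl fcong_sym[OF K])
    also have "(\<Sum>c\<in>UNIV. \<Gamma>' a b c * jac ham_exp c f) = fpartial a (jac ham_exp b f)
       + (\<Sum>d\<in>UNIV. \<Sum>e\<in>UNIV. jac ham_exp a d * jac ham_exp b e * ham_exp (\<Gamma> d e f))" by (rule main)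
    finally have 1: "fcong (Suc m) (\<Sum>c\<in>UNIV. \<Gamma>' a b c * K c f) \<dots>" .
    have 2: "fcong (Suc m) (fpartial a (jac ham_exp b f)
       + (\<Sum>d\<in>UNIV. \<Sum>e\<in>UNIV. jac ham_exp a d * jac ham_exp b e * ham_exp (\<Gamma> d e f)))
      (?X * fpartial a (Z b f) + (\<Sum>d\<in>UNIV. \<Sum>e\<in>UNIV. K a d * K b e * \<Gamma> d e f))"
      unfolding dK[symmetric] by (intro fcong_sum fcong_mult fcong_add fcong_fpartial K E)
    have 3: "fcong (Suc m) (K a d * K b e * \<Gamma> d e f) ((if a = d then 1 else 0) * (if b = e then 1 else 0) * \<Gamma> d e f)" for d e
    proof -
      have e: "K a d * K b e * \<Gamma> d e f = (if a = d then 1 else 0) * (if b = e then 1 else 0) * \<Gamma> d e f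
          + ?X * (((if a = d then 1 else 0) * Z b e + Z a d * K b e) * \<Gamma> d e f)"
        by (simp add: K_def[of a d] K_def[of b e] distrib_left distrib_right mult_ac)
      have "fcong (Suc m) (K a d * K b e * \<Gamma> d e f) ((if a = d then 1 else 0) * (if b = e then 1 else 0) * \<Gamma> d e f + 0)"
        unfolding e by (rule fcong_add[OF fcong_refl small[OF \<Gamma>0]])
      then show ?thesis by (simp only: add_0_right)
    qed
    have 4: "fcong (Suc m) (\<Sum>d\<in>UNIV. \<Sum>e\<in>UNIV. K a d * K b e * \<Gamma> d e f)
       (\<Sum>d\<in>UNIV. \<Sum>e\<in>UNIV. (if a = d then 1 else 0) * (if b = e then 1 else 0) * \<Gamma> d e f)"
      by (intro fcong_sum 3)
    have 5: "(\<Sum>d\<in>UNIV. \<Sum>e\<in>UNIV. (if a = d then 1 else 0) * (if b = e then 1 else 0) * \<Gamma> d e f) = \<Gamma> a b f"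
      by (simp add: mult.assoc flip: sum_distrib_left)
    have "fcong (Suc m) (?X * fpartial a (Z b f) + (\<Sum>d\<in>UNIV. \<Sum>e\<in>UNIV. K a d * K b e * \<Gamma> d e f)) (?X * fpartial a (Z b f) + \<Gamma> a b f)"
      using fcong_add[OF fcong_refl 4] unfolding 5 .
    from fcong_trans[OF fcong_trans[OF 1 2] this] show ?thesis by (simp only: add.commute)
  qed
  have "m \<noteq> 0" using m by simp
  \<comment> \<open>At order zero the Jacobian is the identity, so the transported symbols start at
    order one as well.\<close>
  then have \<Gamma>'0: "fps_nth (\<Gamma>' a b f) 0 = 0" for a b f
    using fcongD[OF rhs[of a b f], of 0] by (simp add: sumK X0 \<Gamma>0)
  have "fcong (Suc m) (\<Sum>c\<in>UNIV. \<Gamma>' a b c * K c f) (\<Gamma>' a b f)"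
  proof -
    have "fcong (Suc m) (?X * (\<Sum>c\<in>UNIV. Z c f * \<Gamma>' a b c)) 0"
    proof -
      have "fps_nth (\<Sum>c\<in>UNIV. Z c f * \<Gamma>' a b c) 0 = 0" by (simp add: fps_sum_nth \<Gamma>'0)
      from small[OF this, of 1] show ?thesis by simp
    qed
    from fcong_add[OF fcong_refl this] show ?thesis unfolding sumK by simp
  qed
  from fcong_trans[OF fcong_sym[OF this] rhs] show ?thesis by (simp add: Z_def)
qed

end

end

section \<open>Normal forms\<close>

text \<open>Three integrations by \<open>torus_closed_form\<close>, each modulo constants. Symmetry
  of \<open>S\<close> makes the potentials \<open>h\<close> and then \<open>g\<close> closed in
  turn.\<close>

lemma symmetric_closed_tensor:
  fixes S :: "'n \<Rightarrow> 'n \<Rightarrow> 'n \<Rightarrow> 'n::finite smfun"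
  assumes s: "\<And>a b c. S a b c = S b a c" "\<And>a b c. S a b c = S a c b"
    and closed: "\<And>a b c f. const_fun (partial a (S b c f) - partial b (S a c f))"
  obtains h where "\<And>a b c. const_fun (S a b c - partial a (partial b (partial c h)))"
proof -
  have cl: "\<exists>h. \<forall>b. const_fun (A b - partial b h)" if A: "\<And>a b. const_fun (partial a (A b) - partial b (A a))" for A :: "'n \<Rightarrow> 'n smfun"
  proof (rule torus_closed_form[of A, OF A])
    fix h k assume "\<And>b. A b = of_real (k b) + partial b h"
    then have "A b - partial b h = of_real (k b)" for b by simp
    then show ?thesis by (intro exI[of _ h]) simp
  qed
  have c0: "partial a f = partial a g" if "const_fun (f - g)" for a and f g :: "'n smfun"
    using that by (simp add: const_fun_def)
  define h where "h c f = (SOME h. \<forall>b. const_fun (S b c f - partial b h))" for c f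
  have h: "const_fun (S b c f - partial b (h c f))" for b c f
    using someI_ex[OF cl[of "\<lambda>b. S b c f", OF closed]] unfolding h_def by blast
  have h': "const_fun (partial b (h c f) - partial c (h b f))" for b c f
  proof -
    have "partial b (h c f) - partial c (h b f) = (S c b f - partial c (h b f)) - (S b c f - partial b (h c f))"
      by (simp add: s(1)[of c b f])
    then show ?thesis by (simp only: const_fun_intros(5)[OF h h])
  qed
  define g where "g f = (SOME g. \<forall>c. const_fun (h c f - partial c g))" for f
  have g: "const_fun (h c f - partial c (g f))" for c f
    using someI_ex[OF cl[of "\<lambda>c. h c f", OF h']] unfolding g_def by blast
  have Sg: "const_fun (S a b f - partial a (partial b (g f)))" for a b f
    using h[of a b f] unfolding c0[OF g] .
  \<comment> \<open>Closedness of \<open>g\<close> shows up first after one further derivative,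
    which \<open>const_fun_if_partials\<close> removes.\<close>
  have g': "const_fun (partial b (g f) - partial f (g b))" for b f
  proof (rule const_fun_if_partials)
    fix a
    have "partial a (partial b (g f) - partial f (g b))
        = (S a f b - partial a (partial f (g b))) - (S a b f - partial a (partial b (g f)))"
      by (simp add: s(2)[of a f b])
    then show "const_fun (partial a (partial b (g f) - partial f (g b)))" by (simp only: const_fun_intros(5)[OF Sg Sg])
  qed
  obtain k where k: "\<And>b. const_fun (g b - partial b k)" using cl[of g, OF g'] by blast
  have "const_fun (S a b c - partial a (partial b (partial c k)))" for a b c
    using Sg[of a b c] unfolding c0[OF k] .
  then show thesis by (rule that)
qed

text \<open>Both factors start at order one, so neither contributes its coefficient of order
  \<open>m\<close> to order \<open>m\<close> of the product.\<close>

lemma const_fun_product_nth':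
  fixes G H :: "('n::finite) ffun"
  assumes "fps_nth G 0 = 0" "fps_nth H 0 = 0"
    "\<And>j. j < m \<Longrightarrow> const_fun (fps_nth G j)" "\<And>j. j < m \<Longrightarrow> const_fun (fps_nth H j)"
  shows "const_fun (fps_nth (G * H) m)"
  unfolding fps_mult_nth
proof (rule const_fun_sum)
  fix i assume i: "i \<in> {0..m}"
  consider "i = 0" | "i = m" | "i < m" "m - i < m" using i by force
  then show "const_fun (fps_nth G i * fps_nth H (m - i))"
  proof cases
    case 3
    then show ?thesis by (intro const_fun_intros(6) assms)
  qed (simp_all add: assms)
qed

context constant_symplectic
begin

lemma gauge_step:
  assumes N: "CARD('n) > 2" and \<Gamma>: "admissible \<Gamma>" and R: "wricci (curve \<Gamma>)" and m: "m \<ge> 1"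
    and const: "\<And>a b c j. j < m \<Longrightarrow> const_fun (fps_nth (\<Gamma> a b c) j)"
  obtains \<Phi> \<Gamma>' where "fauto \<Phi>" "\<And>F. fcong m (\<Phi> F) F" "admissible \<Gamma>'" "wricci (curve \<Gamma>')"
    "conn_act \<Phi> (conn \<Gamma>) = conn \<Gamma>'" "\<And>a b c. fcong m (\<Gamma>' a b c) (\<Gamma> a b c)"
    "\<And>a b c j. j < Suc m \<Longrightarrow> const_fun (fps_nth (\<Gamma>' a b c) j)"
proof -
  have s: "sym_low \<Gamma>" and \<Gamma>0: "\<And>a b c. fps_nth (\<Gamma> a b c) 0 = 0" using \<Gamma> by (simp_all add: admissible_def)
  obtain r where rs: "\<And>a b. r a b = r b a"
    and r: "\<And>a b c f. fpartial a (low \<Gamma> b c f) - fpartial b (low \<Gamma> a c f) + quad \<Gamma> a f b c - quad \<Gamma> b f a c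
      = 2 * om a b * r c f + om a c * r b f + om a f * r b c - om b c * r a f - om b f * r a c"
    by (rule wricciD[OF R s]) (rule that)
  define lo where "lo a b c = fps_nth (low \<Gamma> a b c) m" for a b c
  have low0: "fps_nth (low \<Gamma> a b c) 0 = 0" for a b c by (simp add: low_def fps_sum_nth \<Gamma>0)
  have lowc: "const_fun (fps_nth (low \<Gamma> a b c) j)" if "j < m" for a b c j
    unfolding low_def fps_sum_nth nth_kap_mult
    by (rule const_fun_sum) (intro const_fun_intros(3,6) const[OF that])
  have FFc: "const_fun (fps_nth (quad \<Gamma> a f b c) m)" for a f b c
    unfolding quad_def fps_sum_nth
    by (rule const_fun_sum, rule const_fun_product_nth'[OF low0 \<Gamma>0 lowc const])
  define q where "q a b c f = fps_nth (quad \<Gamma> a f b c) m - fps_nth (quad \<Gamma> b f a c) m" for a b c f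
  have q: "const_fun (q a b c f)" for a b c f unfolding q_def by (rule const_fun_intros(5)[OF FFc FFc])
  \<comment> \<open>Order \<open>m\<close> of \<open>r\<close>, regarded again as a formal function
    so that \<open>closed_ricci_curvature_const\<close> applies to this order in isolation.\<close>
  define r1 where "r1 a b = fps_const (fps_nth (r a b) m)" for a b
  have r1s: "r1 a b = r1 b a" for a b by (simp only: r1_def rs[of a b])
  have two: "2 * om a b * F = kap (2 * Om a b) * F" for a b F by (simp add: kap_mult)
  have kc: "kap c * fps_const f = fps_const (of_real c * f)" for c and f :: "'n smfun" by (simp add: kap_def)
  have E: "2 * om a b * r1 c f + om a c * r1 b f + om a f * r1 b c - om b c * r1 a f - om b f * r1 a c
      = fps_const (partial a (lo b c f) - partial b (lo a c f) + q a b c f)" for a b c f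
  proof -
    have "partial a (lo b c f) - partial b (lo a c f) + q a b c f
      = fps_nth (2 * om a b * r c f + om a c * r b f + om a f * r b c - om b c * r a f - om b f * r a c) m"
      unfolding r[symmetric] by (simp add: lo_def q_def)
    then show ?thesis
      unfolding two r1_def kc by (simp only: fps_add_nth fps_sub_nth nth_kap_mult fps_const_add fps_const_sub)
  qed
  have "fpartial u (r1 z t) = 0" for u z t
  proof (rule closed_ricci_curvature_const[where r=r1, OF N r1s])
    fix u x y z t
    \<comment> \<open>The second Bianchi identity at this order: \<open>q\<close> is constant, and
      the cyclic sum of derivatives of an exact two-form vanishes.\<close>
    have "partial u (q a b c f) = 0" for u a b c f using q by (simp add: const_fun_def)
    then show "fpartial u (2 * om x y * r1 z t + om x z * r1 y t + om x t * r1 y z - om y z * r1 x t - om y t * r1 x z)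
      + fpartial x (2 * om y u * r1 z t + om y z * r1 u t + om y t * r1 u z - om u z * r1 y t - om u t * r1 y z)
      + fpartial y (2 * om u x * r1 z t + om u z * r1 x t + om u t * r1 x z - om x z * r1 u t - om x t * r1 u z) = 0"
      unfolding E fpartial_fps_const
      by (simp add: partial_commute[of x u] partial_commute[of y u] partial_commute[of y x])
  qed
  then have r1c: "fpartial u (2 * om a b * r1 c f + om a c * r1 b f + om a f * r1 b c - om b c * r1 a f - om b f * r1 a c) = 0" for u a b c f
    unfolding two by simp
  have closed: "const_fun (partial a (lo b c f) - partial b (lo a c f))" for a b c f
  proof -
    have "partial u (partial a (lo b c f) - partial b (lo a c f) + q a b c f) = 0" for u
      using r1c[of u a b c f] unfolding E fpartial_fps_const by simp
    then have "const_fun (partial a (lo b c f) - partial b (lo a c f) + q a b c f)"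
      unfolding const_fun_def by blast
    from const_fun_intros(5)[OF this q[of a b c f]] show ?thesis by simp
  qed
  have los: "lo a b c = lo b a c" "lo a b c = lo a c b" for a b c
    by (simp only: lo_def low_sym(1)[OF s, of a b]) (simp only: lo_def low_sym(2)[OF s, of a b])
  obtain h where h: "\<And>a b c. const_fun (lo a b c - partial a (partial b (partial c h)))"
    by (rule symmetric_closed_tensor[where S=lo, OF los closed]) (rule that)
  \<comment> \<open>\<open>gauge_coeff\<close> adds third derivatives of its generator to the
    symbols, so removing those of \<open>h\<close> takes the generator \<open>- h\<close>.\<close>
  define \<Phi> where "\<Phi> = ham_exp (- h) m"
  have \<Phi>: "fauto \<Phi>" unfolding \<Phi>_def by (rule fauto_ham_exp[OF m])
  obtain \<Gamma>' where \<Gamma>': "sym_low \<Gamma>'" and eq: "conn_act \<Phi> (conn \<Gamma>) = conn \<Gamma>'"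
    by (rule conn_act_ex[OF \<Phi> s]) (rule that)
  have g: "fcong (Suc m) (\<Gamma>' a b f) (\<Gamma> a b f + fps_X ^ m * (\<Sum>c\<in>UNIV. pv c f * fps_const (partial a (partial b (partial c (- h))))))" for a b f
    using gauge_coeff[OF m \<Gamma> \<Gamma>' eq[unfolded \<Phi>_def]] .
  have below: "fcong m (\<Gamma>' a b f) (\<Gamma> a b f)" for a b f
    by (rule fcong_trans[OF fcong_less[OF g] fcong_X_power]) simp
  have at_m: "const_fun (fps_nth (\<Gamma>' a b f) m)" for a b f
  proof -
    have "fps_nth (\<Gamma> a b f) m = (\<Sum>c\<in>UNIV. of_real (P c f) * lo a b c)"
      by (subst low_raise) (simp add: fps_sum_nth lo_def)
    moreover have "fps_nth (\<Gamma>' a b f) m = fps_nth (\<Gamma> a b f) m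
        + (\<Sum>c\<in>UNIV. of_real (P c f) * (partial a (partial b (partial c (- h)))))"
      using fcongD[OF g[of a b f], of m] by (simp add: fps_X_power_mult_nth fps_sum_nth kap_def)
    ultimately have "fps_nth (\<Gamma>' a b f) m = (\<Sum>c\<in>UNIV. of_real (P c f) * (lo a b c - partial a (partial b (partial c h))))"
      by (simp add: right_diff_distrib sum_subtractf sum_negf)
    moreover have "const_fun (\<Sum>c\<in>UNIV. of_real (P c f) * (lo a b c - partial a (partial b (partial c h))))"
      by (rule const_fun_sum, rule const_fun_intros(6)[OF const_fun_intros(3) h])
    ultimately show ?thesis by simp
  qed
  have "admissible \<Gamma>'" unfolding admissible_def using \<Gamma>' fcongD[OF below, of 0] m \<Gamma>0 by simp
  moreover have "wricci (curve \<Gamma>')"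
    by (rule wricci_act[OF \<Phi> _ R]) (simp only: curve_ext_curve eq)
  moreover have "const_fun (fps_nth (\<Gamma>' a b c) j)" if "j < Suc m" for a b c j
  proof (cases "j = m")
    case False
    with that have "j < m" by simp
    then show ?thesis using fcongD[OF below] const by simp
  qed (simp add: at_m)
  ultimately show thesis
    using ham_exp_cong_id[OF m, of "- h"] by (intro that[OF \<Phi> _ _ _ eq below]) (simp_all add: \<Phi>_def)
qed

lemma fcong_fpoisson: "fcong k F F' \<Longrightarrow> fcong k G G' \<Longrightarrow> fcong k (fpoisson w F G) (fpoisson w F' G')"
  unfolding fpoisson_eq by (intro fcong_sum fcong_mult fcong_refl fcong_fpartial)

lemma gauge_limit:
  assumes N: "CARD('n) > 2" and \<Gamma>: "admissible \<Gamma>" and R: "wricci (curve \<Gamma>)"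
  obtains \<Psi> \<Gamma>' where "fauto \<Psi>" "admissible \<Gamma>'" "conn_act \<Psi> (conn \<Gamma>) = conn \<Gamma>'"
    "\<And>a b c e. fpartial e (\<Gamma>' a b c) = 0"
proof -
  have s: "sym_low \<Gamma>" and \<Gamma>0: "\<And>a b c. fps_nth (\<Gamma> a b c) 0 = 0" using \<Gamma> by (simp_all add: admissible_def)
  \<comment> \<open>After stage \<open>n\<close> the coefficients are constant up to and including
    order \<open>n\<close>. Stage \<open>0\<close> is the given connection, whose coefficients of
    order zero vanish. The last clause keeps the leading part the identity, from which bijectivity
    of the limit follows.\<close>
  define PP where "PP n x \<longleftrightarrow> fauto (fst x) \<and> admissible (snd x) \<and> conn_act (fst x) (conn \<Gamma>) = conn (snd x) \<and>
    wricci (curve (snd x)) \<and> (\<forall>a b c j. j < Suc n \<longrightarrow> const_fun (fps_nth (snd x a b c) j)) \<and>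
    (\<forall>f. fps_nth (fst x (fps_const f)) 0 = f)"
    for n :: nat and x :: "('n ffun \<Rightarrow> 'n ffun) \<times> ('n \<Rightarrow> 'n \<Rightarrow> 'n \<Rightarrow> 'n ffun)"
  define QQ where "QQ n x y \<longleftrightarrow> (\<forall>F. fcong (Suc n) (fst y F) (fst x F)) \<and> (\<forall>a b c. fcong (Suc n) (snd y a b c) (snd x a b c))"
    for n :: nat and x y :: "('n ffun \<Rightarrow> 'n ffun) \<times> ('n \<Rightarrow> 'n \<Rightarrow> 'n \<Rightarrow> 'n ffun)"
  have "\<exists>x. PP 0 x"
    by (rule exI[of _ "(id, \<Gamma>)"]) (simp add: PP_def fauto_id \<Gamma> conn_act_id R \<Gamma>0)
  moreover have "\<exists>y. PP (Suc n) y \<and> QQ n x y" if x: "PP n x" for n x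
  proof -
    from x have \<Psi>: "fauto (fst x)" "admissible (snd x)" "conn_act (fst x) (conn \<Gamma>) = conn (snd x)" "wricci (curve (snd x))"
      "\<And>f. fps_nth (fst x (fps_const f)) 0 = f"
      and c: "\<And>a b c j. j < Suc n \<Longrightarrow> const_fun (fps_nth (snd x a b c) j)" unfolding PP_def by blast+
    have m: "Suc n \<ge> 1" by simp
    obtain \<Phi> \<Gamma>' where \<Phi>: "fauto \<Phi>" "\<And>F. fcong (Suc n) (\<Phi> F) F" "admissible \<Gamma>'" "wricci (curve \<Gamma>')"
      "conn_act \<Phi> (conn (snd x)) = conn \<Gamma>'" "\<And>a b c. fcong (Suc n) (\<Gamma>' a b c) (snd x a b c)"
      "\<And>a b c j. j < Suc (Suc n) \<Longrightarrow> const_fun (fps_nth (\<Gamma>' a b c) j)"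
      by (rule gauge_step[OF N \<Psi>(2) \<Psi>(4) m c]) (assumption, rule that)
    have "conn_act (\<Phi> \<circ> fst x) (conn \<Gamma>) = conn \<Gamma>'"
      by (simp only: conn_act_comp[OF \<Phi>(1) \<Psi>(1)] \<Psi>(3) \<Phi>(5))
    moreover have "fps_nth ((\<Phi> \<circ> fst x) (fps_const f)) 0 = f" for f
      using fcongD[OF \<Phi>(2), of 0] \<Psi>(5) by simp
    ultimately have "PP (Suc n) (\<Phi> \<circ> fst x, \<Gamma>')"
      unfolding PP_def fst_conv snd_conv using fauto_comp[OF \<Phi>(1) \<Psi>(1)] \<Phi>(3,4,7) by blast
    moreover have "QQ n x (\<Phi> \<circ> fst x, \<Gamma>')" unfolding QQ_def using \<Phi>(2,6) by simp
    ultimately show ?thesis by blast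
  qed
  ultimately obtain z where z: "\<And>n. PP n (z n)" "\<And>n. QQ n (z n) (z (Suc n))"
    using dependent_nat_choice[of PP QQ] by blast
  define Ps where "Ps n = fst (z n)" for n
  define G where "G n = snd (z n)" for n
  have Ps: "fauto (Ps n)" "admissible (G n)" "conn_act (Ps n) (conn \<Gamma>) = conn (G n)"
    "fps_nth (Ps n (fps_const f)) 0 = f" for n f
    using z(1)[of n] by (simp_all add: PP_def Ps_def G_def)
  have Gc: "j < Suc n \<Longrightarrow> const_fun (fps_nth (G n a b c) j)" for j n a b c
    using z(1)[of n] by (simp add: PP_def G_def)
  have step: "fcong (Suc n) (Ps (Suc n) F) (Ps n F)" "fcong (Suc n) (G (Suc n) a b c) (G n a b c)" for n F a b c
    using z(2)[of n] by (simp_all add: QQ_def Ps_def G_def)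
  \<comment> \<open>The limit takes its coefficient of order \<open>k\<close> from stage
    \<open>k\<close>; later stages do not change it.\<close>
  have lim: "fcong (Suc n) (Abs_fps (\<lambda>k. fps_nth (f k) k)) (f n)" if f: "\<And>n. fcong (Suc n) (f (Suc n)) (f n)"
    for f :: "nat \<Rightarrow> 'n ffun" and n
  proof -
    have st: "fcong (Suc i) (f k) (f i)" if "i \<le> k" for i k
      using that
    proof (induction k rule: dec_induct)
      case (step k)
      have "fcong (Suc i) (f (Suc k)) (f k)"
        by (rule fcong_less[OF f]) (use step.hyps in simp)
      then show ?case using step.IH by (rule fcong_trans)
    qed (rule fcong_refl)
    show ?thesis
      unfolding fcong_def
    proof (intro allI impI)
      fix j assume "j < Suc n"
      then show "fps_nth (Abs_fps (\<lambda>k. fps_nth (f k) k)) j = fps_nth (f n) j"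
        using fcongD[OF st[of j n], of j] by simp
    qed
  qed
  define \<Psi> where "\<Psi> F = Abs_fps (\<lambda>k. fps_nth (Ps k F) k)" for F
  define \<Gamma>' where "\<Gamma>' a b c = Abs_fps (\<lambda>k. fps_nth (G k a b c) k)" for a b c
  have \<Psi>c: "fcong (Suc n) (\<Psi> F) (Ps n F)" for n F
    unfolding \<Psi>_def by (rule lim[OF step(1)])
  have Gc': "fcong (Suc n) (\<Gamma>' a b c) (G n a b c)" for n a b c
    unfolding \<Gamma>'_def by (rule lim[OF step(2)])
  note D = fautoD[OF Ps(1)]
  have add: "\<Psi> (F + H) = \<Psi> F + \<Psi> H" for F H
    by (rule fcong_eq, rule fcong_trans[OF \<Psi>c], unfold D) (intro fcong_add fcong_sym[OF \<Psi>c])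
  have mult: "\<Psi> (F * H) = \<Psi> F * \<Psi> H" for F H
    by (rule fcong_eq, rule fcong_trans[OF \<Psi>c], unfold D) (intro fcong_mult fcong_sym[OF \<Psi>c])
  have pois: "\<Psi> (fpoisson w F H) = fpoisson w (\<Psi> F) (\<Psi> H)" for F H
    by (rule fcong_eq, rule fcong_trans[OF \<Psi>c], unfold D) (intro fcong_fpoisson fcong_sym[OF \<Psi>c])
  have kap: "\<Psi> (kap c) = kap c" for c
    by (rule fcong_eq, rule fcong_trans[OF \<Psi>c], unfold D) (rule fcong_refl)
  have X: "\<Psi> fps_X = fps_X"
    by (rule fcong_eq, rule fcong_trans[OF \<Psi>c], unfold D) (rule fcong_refl)
  have X': "\<Psi> (fps_X * F) = fps_X * \<Psi> F" for F by (simp add: mult X)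
  have "fps_nth (\<Psi> (fps_const f)) 0 = f" for f by (simp add: \<Psi>_def Ps(4))
  then have "bij \<Psi>" unfolding ext_bij[of \<Psi>, OF add X'] by (simp add: bij_def inj_def surj_def)
  then have \<Psi>: "fauto \<Psi>" by (simp add: fauto_def add mult pois kap X)
  have jac: "fcong (Suc n) (jac \<Psi> d a) (jac (Ps n) d a)" for n d a
    unfolding jac_def by (intro fcong_mult fcong_diff fcong_refl fcong_fpartial \<Psi>c)
  \<comment> \<open>The transformation law is polynomial in the Jacobian, its derivatives and the
    symbols, so it passes to the \<open>t\<close>-adic limit by congruences.\<close>
  have "conn_act \<Psi> (conn \<Gamma>) = conn \<Gamma>'"
    unfolding conn_act_iff[OF \<Psi> s]
  proof (intro allI, rule fcong_eq)
    fix a b f n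
    have 1: "fcong (Suc n) (\<Sum>c\<in>UNIV. \<Gamma>' a b c * jac \<Psi> c f) (\<Sum>c\<in>UNIV. G n a b c * jac (Ps n) c f)"
      by (intro fcong_sum fcong_mult Gc' jac)
    have 2: "(\<Sum>c\<in>UNIV. G n a b c * jac (Ps n) c f) = fpartial a (jac (Ps n) b f)
       + (\<Sum>d\<in>UNIV. \<Sum>e\<in>UNIV. jac (Ps n) a d * jac (Ps n) b e * Ps n (\<Gamma> d e f))"
      using iffD1[OF conn_act_iff[OF Ps(1) s] Ps(3)] by blast
    have 3: "fcong (Suc n) (fpartial a (jac (Ps n) b f)
       + (\<Sum>d\<in>UNIV. \<Sum>e\<in>UNIV. jac (Ps n) a d * jac (Ps n) b e * Ps n (\<Gamma> d e f)))
       (fpartial a (jac \<Psi> b f) + (\<Sum>d\<in>UNIV. \<Sum>e\<in>UNIV. jac \<Psi> a d * jac \<Psi> b e * \<Psi> (\<Gamma> d e f)))"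
      by (intro fcong_add fcong_fpartial fcong_sum fcong_mult fcong_sym[OF jac] fcong_sym[OF \<Psi>c])
    show "fcong (Suc n) (\<Sum>c\<in>UNIV. \<Gamma>' a b c * jac \<Psi> c f)
       (fpartial a (jac \<Psi> b f) + (\<Sum>d\<in>UNIV. \<Sum>e\<in>UNIV. jac \<Psi> a d * jac \<Psi> b e * \<Psi> (\<Gamma> d e f)))"
      by (rule fcong_trans[OF 1[unfolded 2] 3])
  qed
  moreover have "admissible \<Gamma>'"
  proof -
    have low: "fcong (Suc n) (low \<Gamma>' a b c) (low (G n) a b c)" for n a b c
      unfolding low_def by (intro fcong_sum fcong_mult fcong_refl Gc')
    have sG: "sym_low (G n)" for n using Ps(2) by (simp add: admissible_def)
    have "low \<Gamma>' a b c = low \<Gamma>' b a c" for a b c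
      by (rule fcong_eq, rule fcong_trans[OF low], subst low_sym(1)[OF sG]) (rule fcong_sym[OF low])
    moreover have "low \<Gamma>' a b c = low \<Gamma>' a c b" for a b c
      by (rule fcong_eq, rule fcong_trans[OF low], subst low_sym(2)[OF sG]) (rule fcong_sym[OF low])
    ultimately have "sym_low \<Gamma>'" unfolding sym_low_def by blast
    moreover have "fps_nth (\<Gamma>' a b c) 0 = 0" for a b c
      using Ps(2)[of 0] by (simp add: \<Gamma>'_def admissible_def)
    ultimately show ?thesis by (simp add: admissible_def)
  qed
  moreover have "fpartial e (\<Gamma>' a b c) = 0" for a b c e
    using Gc by (simp add: fps_eq_iff \<Gamma>'_def const_fun_def)
  ultimately show thesis using that[OF \<Psi>] by blast
qed

lemma flat_plus_surj:
  assumes N: "CARD('n) > 2" and D: "D \<in> ricci_curves w"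
  shows "\<exists>A\<in>linear_curves w. (flat_plus A, D) \<in> curve_equiv w"
proof -
  obtain \<Gamma> where \<Gamma>: "admissible \<Gamma>" "D = curve \<Gamma>" "ricci_type w D" using D unfolding ricci_curves_iff by blast
  have R: "wricci (curve \<Gamma>)" using ricci_type_wricci \<Gamma> by simp
  obtain \<Psi> \<Gamma>' where \<Psi>: "fauto \<Psi>" "admissible \<Gamma>'" "conn_act \<Psi> (conn \<Gamma>) = conn \<Gamma>'"
    "\<And>a b c e. fpartial e (\<Gamma>' a b c) = 0"
    by (rule gauge_limit[OF N \<Gamma>(1) R]) (rule that)
  have "wricci (curve \<Gamma>')"
    by (rule wricci_act[OF \<Psi>(1) _ R]) (simp only: curve_ext_curve \<Psi>(3))
  then obtain A where A: "A \<in> linear_curves w" "curve \<Gamma>' = flat_plus A"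
    by (rule const_ricci_flat_plus[OF N \<Psi>(2) _ \<Psi>(4)]) (rule that)
  have "curve_ext (flat_plus A) = conn_act \<Psi> (curve_ext D)"
    by (simp only: A(2)[symmetric] \<Gamma>(2) curve_ext_curve \<Psi>(3))
  then have "(D, flat_plus A) \<in> curve_equiv w"
    unfolding curve_equiv_iff using D flat_plus_ricci[OF A(1)] \<Psi>(1) by blast
  then have "(flat_plus A, D) \<in> curve_equiv w"
    using equiv_curve_equiv by (auto simp: equiv_def dest: symD)
  with A(1) show ?thesis by blast
qed

end

text \<open>Invariance under translations makes the components constant, nondegeneracy makes their
  matrix invertible, and uniqueness of inverses makes the inverse antisymmetric.\<close>

lemma constant_symplectic_ex:
  fixes w :: "('n::finite) form2"
  assumes "symplectic_form w" and "torus_invariant w"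
  obtains Om P where "constant_symplectic w Om P"
proof -
  have form: "form_at w (proj x) (axis a 1) (axis b 1) = lift (w $ a $ b) x" for x a b
    by (simp only: form_at_def bil_def vec_lambda_beta lift_def)
      (simp add: axis_def if_distrib[where f="\<lambda>x. _ * x"] cong: if_cong)
  define Om where "Om a b = lift (w $ a $ b) 0" for a b
  have w: "w $ a $ b = of_real (Om a b)" for a b
  proof (rule lift_ext)
    fix x
    have "form_at w (proj (0 + x)) = form_at w (proj 0)" using assms(2) unfolding torus_invariant_def by blast
    then have "lift (w $ a $ b) x = lift (w $ a $ b) 0" unfolding form[symmetric] by simp
    then show "lift (w $ a $ b) x = lift (of_real (Om a b)) x" by (simp add: Om_def)
  qed
  have anti: "Om a b = - Om b a" for a b
  proof -
    have "w $ a $ b = - (w $ b $ a)" using assms(1) unfolding symplectic_form_def by blast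
    then show ?thesis by (simp add: Om_def)
  qed
  define W :: "real^'n^'n" where "W = (\<chi> a b. Om a b)"
  \<comment> \<open>Nondegeneracy is stated for \<open>v\<close> in the first slot, which
    corresponds to multiplication by the transpose.\<close>
  have "v = 0" if "transpose W *v v = 0" for v
  proof -
    have "form_at w (proj 0) v u = 0" for u
    proof -
      have "form_at w (proj 0) v u = (\<Sum>a\<in>UNIV. \<Sum>b\<in>UNIV. Om a b * v $ a * u $ b)"
        by (simp only: form_at_def bil_def vec_lambda_beta Om_def lift_def)
      also have "\<dots> = (\<Sum>b\<in>UNIV. (transpose W *v v) $ b * u $ b)"
        by (subst sum.swap) (simp add: matrix_vector_mult_def transpose_def W_def sum_distrib_right)
      also have "\<dots> = 0" by (simp only: that zero_index mult_zero_left sum.neutral_const)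
      finally show ?thesis .
    qed
    then show ?thesis using assms(1) unfolding symplectic_form_def by blast
  qed
  then have "inj ((*v) (transpose W))"
    by (intro injI) (metis matrix_vector_mult_diff_distrib right_minus_eq)
  then obtain B where B: "B ** transpose W = mat 1" using matrix_left_invertible_injective by blast
  \<comment> \<open>The transpose of \<open>W\<close> is \<open>- W\<close>, whence the
    sign.\<close>
  define Q :: "real^'n^'n" where "Q = (\<chi> i j. - (B $ i $ j))"
  have "(Q ** W) $ i $ j = (B ** transpose W) $ i $ j" for i j
    by (simp add: matrix_matrix_mult_def transpose_def Q_def W_def anti[of _ j])
  then have QW: "Q ** W = mat 1" by (simp add: vec_eq_iff flip: B)
  then have WQ: "W ** Q = mat 1" by (simp only: matrix_left_right_inverse)
  define Q' :: "real^'n^'n" where "Q' = (\<chi> i j. - (Q $ j $ i))"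
  have "(Q' ** W) $ i $ j = (W ** Q) $ j $ i" for i j
  proof -
    have "- (Q $ k $ i) * W $ k $ j = W $ j $ k * Q $ k $ i" for k
      by (simp add: W_def anti[of k j])
    then show ?thesis by (simp add: matrix_matrix_mult_def Q'_def)
  qed
  then have "Q' ** W = mat 1" by (simp add: vec_eq_iff WQ mat_def)
  then have "Q' = Q" using WQ by (metis matrix_mul_assoc matrix_mul_lid matrix_mul_rid)
  then have Qanti: "Q $ a $ b = - (Q $ b $ a)" for a b by (metis Q'_def vec_lambda_beta)
  have "constant_symplectic w Om (\<lambda>a b. Q $ a $ b)"
  proof
    show "(\<Sum>b\<in>UNIV. Om a b * Q $ b $ c) = (if a = c then 1 else 0)" for a c
    proof -
      have "(W ** Q) $ a $ c = (mat 1 :: real^'n^'n) $ a $ c" by (simp only: WQ)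
      then show ?thesis by (simp add: matrix_matrix_mult_def W_def mat_def)
    qed
    show "(\<Sum>b\<in>UNIV. Q $ a $ b * Om b c) = (if a = c then 1 else 0)" for a c
    proof -
      have "(Q ** W) $ a $ c = (mat 1 :: real^'n^'n) $ a $ c" by (simp only: QW)
      then show ?thesis by (simp add: matrix_matrix_mult_def W_def mat_def)
    qed
  qed (fact w anti Qanti)+
  then show thesis by (rule that)
qed

theorem theorem3:
  fixes w :: "('n::finite) form2" and n :: nat
  assumes "CARD('n) = 2 * n" and "2 * n \<ge> 4"
    and "symplectic_form w" and "torus_invariant w"
  shows "flat_plus ` linear_curves w \<subseteq> ricci_curves w
    \<and> equiv (linear_curves w) (Sp_equiv w)
    \<and> equiv (ricci_curves w) (curve_equiv w)
    \<and> (\<lambda>A. curve_equiv w `` {flat_plus A}) respects Sp_equiv w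
    \<and> bij_betw (\<lambda>S. \<Union>A\<in>S. curve_equiv w `` {flat_plus A})
        (linear_curves w // Sp_equiv w) (ricci_curves w // curve_equiv w)"
proof -
  obtain Om P where "constant_symplectic w Om P" using constant_symplectic_ex[OF assms(3,4)] .
  then interpret constant_symplectic w Om P .
  have N: "CARD('n) > 2" using assms(1,2) by simp
  have sub: "Sp_equiv w \<subseteq> linear_curves w \<times> linear_curves w" by (auto simp: Sp_equiv_def)
  note Q = quotient_bij[where f=flat_plus, OF equiv_curve_equiv flat_plus_ricci sub Sp_equiv_iff flat_plus_surj[OF N]]
  show ?thesis using flat_plus_ricci equiv_curve_equiv Q by (intro conjI) auto
qed

end
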